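(* The following equalities of sets of primitive forms hold (modular forms being identified with their $q$-expansions): $$\mathcal P_{12}(1)=\{\Delta_1\},\quad \mathcal P_8(2;2)=\{\Delta_2\},\quad \mathcal P_6(3;1)=\{\Delta_3\},\quad \mathcal P_6(4)=\{\Delta_4\},$$ $$\mathcal P_4(6;6)=\{\Delta_6\},\quad \mathcal P_4(8)=\{\Delta_8\},\quad \mathcal P_4^0(9)=\{\Delta_9\}.$$
   Context: For positive integers $k,N$, $\mathcal M_k(N)$ and $\mathcal S_k(N)$ are the spaces of modular forms and cusp forms of weight $k$ for $\Gamma_0(N)$ (trivial character), regarded as subspaces of $\mathbb C[[q]]$ via $q$-expansions at infinity, $q=e^{2\pi i z}$; $a_l(f)$ is the $l$-th Fourier coefficient of $f$. $\mathcal S_k^0(N)\subset\mathcal S_k(N)$ is the subspace of newforms, and $\mathcal P_k(N)$ is the set of primitive forms in $\mathcal S_k^0(N)$, i.e. the common eigenfunctions $f\in\mathcal S_k^0(N)$ of all Hecke operators normalized by $a_1(f)=1$. Let $N^\times$ be the product of the primes $p$ with $p\mid N$, $p^2\nmid N$, and $\varkappa=\frac k2-1$. For a divisor $i$ of $N^\times$, $\mathcal P_k(N;i)$ is the set of $f\in\mathcal P_k(N)$ with $a_p(f)=-p^\varkappa$ for every prime $p\mid i$ and $a_p(f)=p^\varkappa$ for every prime $p\mid N^\times/i$. $\rho_3,\rho_4$ are the non-trivial Dirichlet characters mod $3$ and mod $4$. The twist is $f\otimes\rho_3=\sum_n\rho_3(n)a_n(f)q^n$. Put $\mathcal P_k^1(9)=\{f\otimes\rho_3\mid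 f\in\mathcal P_k(1)\cup\mathcal P_k(3)\}$ and $\mathcal P_k^0(9)=\mathcal P_k(9)\setminus\mathcal P_k^1(9)$. For a power series $f$ write $f^{(h)}(q)=f(q^h)$. Let $B_k$ be the $k$-th Bernoulli number, $E_k=1-\frac{2k}{B_k}\sum_{n\ge1}\big(\sum_{d\mid n}d^{k-1}\big)q^n$, and for $N>1$, $C_N=\frac1{\gcd(N-1,24)}(N E_2^{(N)}-E_2)$. Put $$F_3=1+6\sum_{n\ge1}\Big(\sum_{d\mid n}\rho_3(d)\Big)q^n,\qquad F_4=1+4\sum_{n\ge1}\Big(\sum_{d\mid n}\rho_4(d)\Big)q^n,$$ $\alpha_6=\frac16(F_3-F_3^{(2)})$, $\alpha_8=\frac14(F_4-F_4^{(2)})$, $\alpha_9=\frac16(F_3-F_3^{(3)})$, $\alpha_4=F_4^{(2)}\alpha_8$, $\alpha_2=C_4\alpha_4$, $\alpha_3=C_9\alpha_9$, and $$\Delta_1=\tfrac1{12^3}(E_4^3-E_6^2),\quad \Delta_2=\alpha_2(C_2^2-64\alpha_2),\quad \Delta_3=\alpha_3(F_3^3-27\alpha_3),\quad \Delta_4=\alpha_2(C_4-16\alpha_4),$$ $$\Delta_6=\alpha_6(F_3-3\alpha_6)(F_3-4\alpha_6)(F_3-12\alpha_6),\quad \Delta_8=\alpha_4F_4(F_4-8\alpha_8),\quad \Delta_9=\alpha_3(F_3-9\alpha_9).$$ *)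

theory Defs
  imports "HOL-Analysis.Analysis" "HOL-Computational_Algebra.Computational_Algebra"
begin

definition upper_half_plane :: "complex set" where
  "upper_half_plane = {z. Im z > 0}"

text \<open>The tuple \<open>(a, b, c, d)\<close> stands for the matrix with rows \<open>(a, b)\<close> and \<open>(c, d)\<close>.\<close>

type_synonym imat = "int \<times> int \<times> int \<times> int"

definition SL2Z :: "imat set" where
  "SL2Z = {(a, b, c, d) | a b c d. a * d - b * c = 1}"

definition Gamma0 :: "nat \<Rightarrow> imat set" where
  "Gamma0 N = {(a, b, c, d) | a b c d. a * d - b * c = 1 \<and> int N dvd c}"

text \<open>
  The weight-\<open>k\<close> slash action, normalised by the factor \<open>det\<^bsup>k-1\<^esup>\<close>; the normalisation is
  irrelevant on \<^const>\<open>SL2Z\<close> and makes the Hecke operators below plain sums of slashes.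
\<close>

definition slash :: "nat \<Rightarrow> imat \<Rightarrow> (complex \<Rightarrow> complex) \<Rightarrow> complex \<Rightarrow> complex" where
  "slash k = (\<lambda>(a, b, c, d) f z.
     of_int (a * d - b * c) ^ (k - 1) / (of_int c * z + of_int d) ^ k *
       f ((of_int a * z + of_int b) / (of_int c * z + of_int d)))"

abbreviation at_i_infinity :: "complex filter" where
  "at_i_infinity \<equiv> filtercomap Im at_top"

text \<open>
  Every cusp is of the form \<open>\<gamma> \<infinity>\<close> with \<open>\<gamma>\<close> in \<^const>\<open>SL2Z\<close>, so holomorphy (vanishing) at the
  cusps says that every \<open>f|\<gamma>\<close> is bounded (tends to 0) as \<open>Im z \<rightarrow> \<infinity>\<close>.
\<close>

definition is_modular_form :: "nat \<Rightarrow> nat \<Rightarrow> (complex \<Rightarrow> complex) \<Rightarrow> bool" where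
  "is_modular_form k N f \<longleftrightarrow>
     f holomorphic_on upper_half_plane \<and>
     (\<forall>\<gamma>\<in>Gamma0 N. \<forall>z\<in>upper_half_plane. slash k \<gamma> f z = f z) \<and>
     (\<forall>\<gamma>\<in>SL2Z. Bfun (slash k \<gamma> f) at_i_infinity)"

definition vanishes_at_cusps :: "nat \<Rightarrow> (complex \<Rightarrow> complex) \<Rightarrow> bool" where
  "vanishes_at_cusps k f \<longleftrightarrow> (\<forall>\<gamma>\<in>SL2Z. (slash k \<gamma> f \<longlongrightarrow> 0) at_i_infinity)"

text \<open>
  Forms are identified with their \<open>q\<close>-expansions: \<open>fun_of_qexp F\<close> is the function on the upper
  half-plane with \<open>q\<close>-expansion \<open>F\<close>, provided that \<open>F\<close> converges on the open unit disc.
\<close>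

definition fun_of_qexp :: "complex fps \<Rightarrow> complex \<Rightarrow> complex" where
  "fun_of_qexp F z = eval_fps F (exp (2 * of_real pi * \<i> * z))"

definition modular_forms :: "nat \<Rightarrow> nat \<Rightarrow> complex fps set" where
  "modular_forms k N = {F. fps_conv_radius F \<ge> 1 \<and> is_modular_form k N (fun_of_qexp F)}"

definition cusp_forms :: "nat \<Rightarrow> nat \<Rightarrow> complex fps set" where
  "cusp_forms k N = {F \<in> modular_forms k N. vanishes_at_cusps k (fun_of_qexp F)}"

text \<open>\<open>F(q\<^sup>h)\<close>; the composition of power series is meaningful for \<open>h > 0\<close> only.\<close>

definition qpow :: "complex fps \<Rightarrow> nat \<Rightarrow> complex fps" where
  "qpow F h = F oo fps_X ^ h"

definition oldforms :: "nat \<Rightarrow> nat \<Rightarrow> complex fps set" where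
  "oldforms k N = module.span (\<lambda>c F. fps_const c * F)
     {qpow F h | F h M. M dvd N \<and> M \<noteq> N \<and> h * M dvd N \<and> F \<in> cusp_forms k M}"

definition SL2Z_fundamental_domain :: "complex set" where
  "SL2Z_fundamental_domain = {z. Im z > 0 \<and> \<bar>Re z\<bar> \<le> 1 / 2 \<and> norm z \<ge> 1}"

text \<open>
  Two matrices \<open>\<gamma>, \<gamma>'\<close> lie in the same coset \<open>\<Gamma>\<^sub>0(N) \<gamma>\<close> in \<open>SL\<^sub>2(\<int>)\<close> iff \<open>N\<close> divides the lower left
  entry \<open>c' d - d' c\<close> of \<open>\<gamma>' \<gamma>\<^sup>-\<^sup>1\<close>.
\<close>

definition Gamma0_coset_rel :: "nat \<Rightarrow> (imat \<times> imat) set" where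
  "Gamma0_coset_rel N = {((a, b, c, d), (a', b', c', d')) | a b c d a' b' c' d'.
     (a, b, c, d) \<in> SL2Z \<and> (a', b', c', d') \<in> SL2Z \<and> int N dvd c' * d - d' * c}"

text \<open>
  The (unnormalised) Petersson product: a fundamental domain of \<open>\<Gamma>\<^sub>0(N)\<close> is the union of the
  translates of the one of \<open>SL\<^sub>2(\<int>)\<close> by coset representatives. For forms for \<open>\<Gamma>\<^sub>0(N)\<close> the
  choice of the representatives is immaterial.
\<close>

definition petersson :: "nat \<Rightarrow> nat \<Rightarrow> (complex \<Rightarrow> complex) \<Rightarrow> (complex \<Rightarrow> complex) \<Rightarrow> complex" where
  "petersson k N f g =
     (\<Sum>C\<in>SL2Z // Gamma0_coset_rel N.
        let \<gamma> = (SOME \<gamma>. \<gamma> \<in> C) in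
        (LINT z : SL2Z_fundamental_domain | lborel.
           slash k \<gamma> f z * cnj (slash k \<gamma> g z) * of_real (Im z ^ k / Im z ^ 2)))"

definition newforms :: "nat \<Rightarrow> nat \<Rightarrow> complex fps set" where
  "newforms k N = {F \<in> cusp_forms k N.
     \<forall>G\<in>oldforms k N. petersson k N (fun_of_qexp F) (fun_of_qexp G) = 0}"

text \<open>
  The Hecke operator \<open>T\<^sub>n\<close> on forms for \<open>\<Gamma>\<^sub>0(N)\<close> with trivial character, the sum running over the
  usual upper triangular representatives modulo \<open>\<Gamma>\<^sub>0(N)\<close> of the integral matrices of determinant
  \<open>n\<close> with \<open>N | c\<close> and \<open>gcd(a, N) = 1\<close>. For a prime \<open>p | N\<close>, \<open>T\<^sub>p\<close> is the operator also known as
  \<open>U\<^sub>p\<close>.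
\<close>

definition hecke :: "nat \<Rightarrow> nat \<Rightarrow> nat \<Rightarrow> (complex \<Rightarrow> complex) \<Rightarrow> complex \<Rightarrow> complex" where
  "hecke k N n f z =
     (\<Sum>\<gamma>\<in>{(a, b, 0, d) | a b d. a > 0 \<and> a * d = int n \<and> coprime a (int N) \<and> 0 \<le> b \<and> b < d}.
        slash k \<gamma> f z)"

definition hecke_eigenform :: "nat \<Rightarrow> nat \<Rightarrow> (complex \<Rightarrow> complex) \<Rightarrow> bool" where
  "hecke_eigenform k N f \<longleftrightarrow>
     (\<forall>n>0. \<exists>c. \<forall>z\<in>upper_half_plane. hecke k N n f z = c * f z)"

definition primitive_forms :: "nat \<Rightarrow> nat \<Rightarrow> complex fps set" where
  "primitive_forms k N =
     {F \<in> newforms k N. hecke_eigenform k N (fun_of_qexp F) \<and> fps_nth F 1 = 1}"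

definition simple_part :: "nat \<Rightarrow> nat" where
  "simple_part N = \<Prod>{p. prime p \<and> p dvd N \<and> \<not> p\<^sup>2 dvd N}"

text \<open>The index \<open>i\<close> is meant to be a divisor of \<^term>\<open>simple_part N\<close>.\<close>

definition primitive_forms_sign :: "nat \<Rightarrow> nat \<Rightarrow> nat \<Rightarrow> complex fps set" where
  "primitive_forms_sign k N i = {F \<in> primitive_forms k N.
     (\<forall>p. prime p \<and> p dvd i \<longrightarrow>
        fps_nth F p = - of_real (real p powr (real k / 2 - 1))) \<and>
     (\<forall>p. prime p \<and> p dvd simple_part N div i \<longrightarrow>
        fps_nth F p = of_real (real p powr (real k / 2 - 1)))}"

definition rho3 :: "nat \<Rightarrow> complex" where
  "rho3 n = (if n mod 3 = 1 then 1 else if n mod 3 = 2 then -1 else 0)"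

definition rho4 :: "nat \<Rightarrow> complex" where
  "rho4 n = (if n mod 4 = 1 then 1 else if n mod 4 = 3 then -1 else 0)"

definition twist :: "complex fps \<Rightarrow> (nat \<Rightarrow> complex) \<Rightarrow> complex fps" where
  "twist F \<rho> = Abs_fps (\<lambda>n. \<rho> n * fps_nth F n)"

definition primitive_forms_9_twisted :: "nat \<Rightarrow> complex fps set" where
  "primitive_forms_9_twisted k =
     {twist F rho3 | F. F \<in> primitive_forms k 1 \<union> primitive_forms k 3}"

definition primitive_forms_9_untwisted :: "nat \<Rightarrow> complex fps set" where
  "primitive_forms_9_untwisted k = primitive_forms k 9 - primitive_forms_9_twisted k"

fun bernoulli :: "nat \<Rightarrow> complex" where
  "bernoulli 0 = 1"
| "bernoulli (Suc n) =
     - (\<Sum>k\<le>n. of_nat ((n + 2) choose k) * bernoulli k) / of_nat (n + 2)"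

definition divisor_sum_series :: "(nat \<Rightarrow> complex) \<Rightarrow> complex fps" where
  "divisor_sum_series g = Abs_fps (\<lambda>n. if n = 0 then 0 else (\<Sum>d | d dvd n. g d))"

definition Eisen :: "nat \<Rightarrow> complex fps" where
  "Eisen k = 1 - fps_const (2 * of_nat k / bernoulli k) *
     divisor_sum_series (\<lambda>d. of_nat d ^ (k - 1))"

definition C_form :: "nat \<Rightarrow> complex fps" where
  "C_form N = fps_const (1 / of_nat (gcd (N - 1) 24)) *
     (of_nat N * qpow (Eisen 2) N - Eisen 2)"

definition F3 :: "complex fps" where
  "F3 = 1 + 6 * divisor_sum_series rho3"

definition F4 :: "complex fps" where
  "F4 = 1 + 4 * divisor_sum_series rho4"

definition alpha6 :: "complex fps" where
  "alpha6 = fps_const (1 / 6) * (F3 - qpow F3 2)"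

definition alpha8 :: "complex fps" where
  "alpha8 = fps_const (1 / 4) * (F4 - qpow F4 2)"

definition alpha9 :: "complex fps" where
  "alpha9 = fps_const (1 / 6) * (F3 - qpow F3 3)"

definition alpha4 :: "complex fps" where
  "alpha4 = qpow F4 2 * alpha8"

definition alpha2 :: "complex fps" where
  "alpha2 = C_form 4 * alpha4"

definition alpha3 :: "complex fps" where
  "alpha3 = C_form 9 * alpha9"

definition Delta1 :: "complex fps" where
  "Delta1 = fps_const (1 / 12 ^ 3) * (Eisen 4 ^ 3 - Eisen 6 ^ 2)"

definition Delta2 :: "complex fps" where
  "Delta2 = alpha2 * (C_form 2 ^ 2 - 64 * alpha2)"

definition Delta3 :: "complex fps" where
  "Delta3 = alpha3 * (F3 ^ 3 - 27 * alpha3)"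

definition Delta4 :: "complex fps" where
  "Delta4 = alpha2 * (C_form 4 - 16 * alpha4)"

definition Delta6 :: "complex fps" where
  "Delta6 = alpha6 * (F3 - 3 * alpha6) * (F3 - 4 * alpha6) * (F3 - 12 * alpha6)"

definition Delta8 :: "complex fps" where
  "Delta8 = alpha4 * F4 * (F4 - 8 * alpha8)"

definition Delta9 :: "complex fps" where
  "Delta9 = alpha3 * (F3 - 9 * alpha9)"

end

theory Submission
  imports Defs "HOL-Complex_Analysis.Complex_Analysis" "HOL-Library.Landau_Symbols"
begin

text \<open>
  Each of the spaces of cusp forms in question has dimension one, and the cusp forms of the proper
  divisors of the level vanish. So there are no oldforms, a cusp form with \<open>a\<^sub>1 = 1\<close> is determined,
  and it is an eigenform since the Hecke operators act on a line.

  The upper bounds for the dimensions come from Sturm's argument: the product of the \<open>f|\<gamma>\<close> over all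
  cosets of \<open>\<Gamma>\<^sub>0(N)\<close> has level one, and a level one form of weight \<open>K\<close> that vanishes at \<open>\<infinity>\<close> to an
  order above \<open>K/10\<close> is zero by the maximum principle. A cusp form of level \<open>N\<close> gains one unit of
  this order from every cusp.

  The modularity of all the Eisenstein series follows from that of \<open>Z(u) = \<theta>\<^sub>1'(u)/\<theta>\<^sub>1(u)\<close>, which is
  an instance of Liouville's theorem for elliptic functions: \<open>E\<^sub>2\<close>, \<open>E\<^sub>4\<close>, \<open>E\<^sub>6\<close> are Taylor coefficients
  of \<open>Z\<close> at 0, whereas \<open>F\<^sub>3\<close> and \<open>F\<^sub>4\<close> are its values at the torsion points \<open>1/3\<close> and \<open>1/4\<close>. The same
  formulas give the values at all cusps, from which one reads off that the \<open>\<Delta>\<^sub>N\<close> are cusp forms.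

  The level of \<open>\<alpha>\<^sub>4\<close>, \<open>\<alpha>\<^sub>2\<close> and \<open>\<Delta>\<^sub>3\<close> is lower than their definitions show. By Sturm's bound, comparing
  a few coefficients identifies them with combinations of Eisenstein series of the right level,
  for instance \<open>432 \<Delta>\<^sub>3 = 7 F\<^sub>3\<^sup>2 E\<^sub>4 - 9 F\<^sub>3\<^sup>6 + 2 E\<^sub>6\<close>.
\<close>

section \<open>The slash action\<close>

text \<open>The constant 10 is weaker than the 12 of the valence formula, but the maximum principle
  yields it without contour integrals around elliptic points. It suffices because at each of the
  seven levels weight times index of \<Gamma>_0(N) equals 12 h, where h is the number of cusps.
  Uniqueness of a normalised cusp form then asks for h + 1 > 12 h / 10, that is h < 5, and h takes
  the values 1, 2, 2, 3, 4, 4, 4.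

  At the levels 2, 4, 6, 8 and 9 cuspidality comes from the factorisations in the definitions: every
  cusp is a zero of some factor. This is why each form is carried along with the table of its values
  at all cusps, a datum that passes to products, linear combinations and the substitution of q^h for
  q.

  E_2 is not modular and F_3, F_4 have a character. Both defects have a source in Z: the anomaly of
  E_2 is the linear term 2 pi i c u in the transformation law of Z, and the characters come from Z
  being odd with period 1.\<close>

abbreviation qe :: "complex \<Rightarrow> complex" where
  "qe z \<equiv> exp (2 * of_real pi * \<i> * z)"

fun imat_mult :: "imat \<Rightarrow> imat \<Rightarrow> imat" where
  "imat_mult (a, b, c, d) (a', b', c', d') =
     (a * a' + b * c', a * b' + b * d', c * a' + d * c', c * b' + d * d')"

fun imat_det :: "imat \<Rightarrow> int" where
  "imat_det (a, b, c, d) = a * d - b * c"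

fun imat_adj :: "imat \<Rightarrow> imat" where
  "imat_adj (a, b, c, d) = (d, -b, -c, a)"

fun aut_factor :: "imat \<Rightarrow> complex \<Rightarrow> complex" where
  "aut_factor (a, b, c, d) z = of_int c * z + of_int d"

fun moebius_map :: "imat \<Rightarrow> complex \<Rightarrow> complex" where
  "moebius_map (a, b, c, d) z = (of_int a * z + of_int b) / (of_int c * z + of_int d)"

lemma slash_altdef:
  "slash k \<gamma> f z = of_int (imat_det \<gamma>) ^ (k - 1) / aut_factor \<gamma> z ^ k * f (moebius_map \<gamma> z)"
  by (cases \<gamma>) (simp add: slash_def)

lemma SL2Z_iff: "\<gamma> \<in> SL2Z \<longleftrightarrow> imat_det \<gamma> = 1"
  by (cases \<gamma>) (auto simp: SL2Z_def)

lemma Gamma0_iff: "(a, b, c, d) \<in> Gamma0 N \<longleftrightarrow> a * d - b * c = 1 \<and> int N dvd c"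
  by (auto simp: Gamma0_def)

lemma Gamma0_subset_SL2Z: "Gamma0 N \<subseteq> SL2Z"
  by (auto simp: Gamma0_def SL2Z_def)

lemma imat_det_mult: "imat_det (imat_mult \<alpha> \<beta>) = imat_det \<alpha> * imat_det \<beta>"
  by (cases \<alpha>; cases \<beta>) (simp add: algebra_simps)

lemma imat_mult_assoc: "imat_mult (imat_mult \<alpha> \<beta>) \<gamma> = imat_mult \<alpha> (imat_mult \<beta> \<gamma>)"
  by (cases \<alpha>; cases \<beta>; cases \<gamma>) (simp add: algebra_simps)

lemma imat_det_adj [simp]: "imat_det (imat_adj \<gamma>) = imat_det \<gamma>"
  by (cases \<gamma>) (simp add: algebra_simps)

lemma imat_mult_adj:
  "imat_det \<gamma> = 1 \<Longrightarrow> imat_mult \<gamma> (imat_adj \<gamma>) = (1, 0, 0, 1)"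
  "imat_det \<gamma> = 1 \<Longrightarrow> imat_mult (imat_adj \<gamma>) \<gamma> = (1, 0, 0, 1)"
  by (cases \<gamma>, simp add: algebra_simps)+

lemma imat_mult_one [simp]: "imat_mult (1, 0, 0, 1) \<gamma> = \<gamma>" "imat_mult \<gamma> (1, 0, 0, 1) = \<gamma>"
  by (cases \<gamma>, simp)+

lemma SL2Z_mult: "\<alpha> \<in> SL2Z \<Longrightarrow> \<beta> \<in> SL2Z \<Longrightarrow> imat_mult \<alpha> \<beta> \<in> SL2Z"
  by (simp add: SL2Z_iff imat_det_mult)

lemma SL2Z_adj: "\<alpha> \<in> SL2Z \<Longrightarrow> imat_adj \<alpha> \<in> SL2Z"
  by (simp add: SL2Z_iff)

lemma Gamma0_mult: "\<alpha> \<in> Gamma0 N \<Longrightarrow> \<beta> \<in> Gamma0 N \<Longrightarrow> imat_mult \<alpha> \<beta> \<in> Gamma0 N"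
proof -
  assume "\<alpha> \<in> Gamma0 N" "\<beta> \<in> Gamma0 N"
  moreover from this have "imat_mult \<alpha> \<beta> \<in> SL2Z"
    using Gamma0_subset_SL2Z by (blast intro: SL2Z_mult)
  ultimately show ?thesis
    by (cases \<alpha>; cases \<beta>) (auto simp: Gamma0_iff SL2Z_iff)
qed

lemma aut_factor_nonzero:
  assumes "Im z > 0" "imat_det \<gamma> \<noteq> 0"
  shows "aut_factor \<gamma> z \<noteq> 0"
proof (cases \<gamma>)
  case (fields a b c d)
  show ?thesis
  proof
    assume "aut_factor \<gamma> z = 0"
    hence eq: "of_int c * z + of_int d = 0" by (simp add: fields)
    hence "Im (of_int c * z + of_int d) = 0" by simp
    hence "c = 0" using assms by simp
    with eq have "d = 0" by simp
    with \<open>c = 0\<close> show False using assms by (simp add: fields)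
  qed
qed

lemma Im_moebius:
  assumes "Im z > 0"
  shows "Im (moebius_map \<gamma> z) = of_int (imat_det \<gamma>) * Im z / norm (aut_factor \<gamma> z) ^ 2"
  by (cases \<gamma>) (simp add: Im_divide cmod_power2 algebra_simps add_divide_distrib diff_divide_distrib)

lemma moebius_in_H:
  assumes "Im z > 0" "imat_det \<gamma> > 0"
  shows "Im (moebius_map \<gamma> z) > 0"
  using assms aut_factor_nonzero[of z \<gamma>] by (simp add: Im_moebius)

lemma aut_factor_mult:
  assumes "Im z > 0" "imat_det \<beta> > 0"
  shows "aut_factor (imat_mult \<alpha> \<beta>) z = aut_factor \<alpha> (moebius_map \<beta> z) * aut_factor \<beta> z"
proof -
  have "aut_factor \<beta> z \<noteq> 0" using aut_factor_nonzero assms by auto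
  thus ?thesis
    by (cases \<alpha>; cases \<beta>) (simp add: field_simps)
qed

lemma moebius_mult:
  assumes "Im z > 0" "imat_det \<beta> > 0" "imat_det \<alpha> > 0"
  shows "moebius_map (imat_mult \<alpha> \<beta>) z = moebius_map \<alpha> (moebius_map \<beta> z)"
proof -
  have nz: "aut_factor \<beta> z \<noteq> 0" "aut_factor \<alpha> (moebius_map \<beta> z) \<noteq> 0"
    using aut_factor_nonzero moebius_in_H assms by auto
  obtain a b c d where \<alpha>: "\<alpha> = (a, b, c, d)" by (cases \<alpha>)
  obtain a' b' c' d' where \<beta>: "\<beta> = (a', b', c', d')" by (cases \<beta>)
  define j where "j = of_int c' * z + of_int d'"
  have j: "j \<noteq> 0" using nz by (simp add: \<beta> j_def)
  have "moebius_map \<alpha> (moebius_map \<beta> z) = 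
     (of_int a * ((of_int a' * z + of_int b') / j) + of_int b) / (of_int c * ((of_int a' * z + of_int b') / j) + of_int d)"
    by (simp add: \<alpha> \<beta> j_def)
  also have "\<dots> = (of_int a * (of_int a' * z + of_int b') + of_int b * j) / (of_int c * (of_int a' * z + of_int b') + of_int d * j)"
    using j by (simp add: add_divide_eq_iff divide_simps)
  also have "\<dots> = moebius_map (imat_mult \<alpha> \<beta>) z"
    by (simp add: \<alpha> \<beta> j_def algebra_simps)
  finally show ?thesis ..
qed

lemma slash_mult:
  assumes "Im z > 0" "imat_det \<beta> > 0" "imat_det \<alpha> > 0"
  shows "slash k (imat_mult \<alpha> \<beta>) f z = slash k \<beta> (slash k \<alpha> f) z"
  using assms
  by (simp add: slash_altdef imat_det_mult aut_factor_mult moebius_mult power_mult_distrib mult_ac)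

lemma slash_cong_H:
  assumes "\<And>z. Im z > 0 \<Longrightarrow> f z = g z" "Im z > 0" "imat_det \<gamma> > 0"
  shows "slash k \<gamma> f z = slash k \<gamma> g z"
  using assms moebius_in_H by (simp add: slash_altdef)

lemma slash_one [simp]: "slash k (1, 0, 0, 1) f z = f z"
  by (simp add: slash_altdef)

lemma slash_mult_fun:
  assumes "imat_det \<gamma> = 1"
  shows "slash (k + l) \<gamma> (\<lambda>z. f z * g z) z = slash k \<gamma> f z * slash l \<gamma> g z"
  using assms by (simp add: slash_altdef power_add)

lemma open_upper_half_plane: "open upper_half_plane"
  unfolding upper_half_plane_def by (rule open_halfspace_Im_gt)

lemma connected_upper_half_plane: "connected upper_half_plane"
  unfolding upper_half_plane_def by (intro convex_connected convex_halfspace_Im_gt)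

lemma in_H_iff: "z \<in> upper_half_plane \<longleftrightarrow> Im z > 0"
  by (simp add: upper_half_plane_def)

lemma holomorphic_moebius:
  assumes "imat_det \<gamma> > 0"
  shows "moebius_map \<gamma> holomorphic_on upper_half_plane"
proof (cases \<gamma>)
  case (fields a b c d)
  have "(\<lambda>z. (of_int a * z + of_int b) / (of_int c * z + of_int d)) holomorphic_on upper_half_plane"
    using aut_factor_nonzero[of _ \<gamma>] assms
    by (intro holomorphic_intros) (auto simp: fields in_H_iff)
  also have "(\<lambda>z. (of_int a * z + of_int b) / (of_int c * z + of_int d)) = moebius_map \<gamma>"
    by (auto simp: fields)
  finally show ?thesis .
qed

lemma holomorphic_slash:
  assumes "f holomorphic_on upper_half_plane" "imat_det \<gamma> > 0"
  shows "slash k \<gamma> f holomorphic_on upper_half_plane"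
proof (cases \<gamma>)
  case (fields a b c d)
  have "(f \<circ> moebius_map \<gamma>) holomorphic_on upper_half_plane"
    using assms by (intro holomorphic_on_compose_gen[of _ _ _ upper_half_plane] holomorphic_moebius)
       (auto simp: in_H_iff moebius_in_H)
  moreover have "(\<lambda>z. of_int (imat_det \<gamma>) ^ (k - 1) / (of_int c * z + of_int d) ^ k) holomorphic_on upper_half_plane"
    using aut_factor_nonzero[of _ \<gamma>] assms
    by (intro holomorphic_intros) (auto simp: fields in_H_iff)
  ultimately have "(\<lambda>z. of_int (imat_det \<gamma>) ^ (k - 1) / (of_int c * z + of_int d) ^ k * (f \<circ> moebius_map \<gamma>) z)
          holomorphic_on upper_half_plane"
    by (rule holomorphic_on_mult[rotated])
  thus ?thesis
    by (simp add: slash_altdef[abs_def] fields del: moebius_map.simps)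
qed

lemma eventually_at_i_infinity:
  "eventually P at_i_infinity \<longleftrightarrow> (\<exists>Y>0. \<forall>z. Im z \<ge> Y \<longrightarrow> P z)"
proof
  assume "eventually P at_i_infinity"
  then obtain Q where Q: "eventually Q at_top" "\<And>z. Q (Im z) \<Longrightarrow> P z"
    by (auto simp: eventually_filtercomap)
  then obtain Y where "\<And>y. y \<ge> Y \<Longrightarrow> Q y" by (auto simp: eventually_at_top_linorder)
  thus "\<exists>Y>0. \<forall>z. Im z \<ge> Y \<longrightarrow> P z" using Q(2)
    by (intro exI[of _ "max Y 1"]) auto
next
  assume "\<exists>Y>0. \<forall>z. Im z \<ge> Y \<longrightarrow> P z"
  then obtain Y where "\<forall>z. Im z \<ge> Y \<longrightarrow> P z" by blast
  thus "eventually P at_i_infinity"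
    unfolding eventually_filtercomap by (intro exI[of _ "\<lambda>y. y \<ge> Y"]) (auto intro: eventually_ge_at_top)
qed

lemma eventually_Im_gt [simp, intro]: "eventually (\<lambda>z. Im z > y) at_i_infinity"
proof -
  have "max y 0 + 1 > 0" by auto
  thus ?thesis unfolding eventually_at_i_infinity by (intro exI[of _ "max y 0 + 1"]) auto
qed

lemma at_i_infinity_neq_bot [simp]: "at_i_infinity \<noteq> bot"
proof
  assume "at_i_infinity = bot"
  hence "eventually (\<lambda>z. False) at_i_infinity" by simp
  then obtain Y where "\<forall>z. Im z \<ge> Y \<longrightarrow> False" by (auto simp: eventually_at_i_infinity)
  from this[rule_format, of "Complex 0 Y"] show False by simp
qed

lemma filterlim_Im_at_i_infinity: "filterlim Im at_top at_i_infinity"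
  by (rule filterlim_filtercomap)

text \<open>Hermite normal form: the primitive column (a, c) / g is the first column of some
  unimodular matrix, whose inverse clears the lower left entry. Slashing by an integral matrix is
  thereby reduced to slashing by \<open>SL2Z\<close> and then by an upper triangular matrix, which
  fixes the cusp at infinity.\<close>

lemma imat_upper_triangular:
  assumes "imat_det (a, b, c, d) > 0"
  obtains x y B where "(a div gcd a c, x, c div gcd a c, y) \<in> SL2Z"
    "(a, b, c, d) = imat_mult (a div gcd a c, x, c div gcd a c, y) 
        (gcd a c, B, 0, imat_det (a, b, c, d) div gcd a c)"
    "gcd a c dvd imat_det (a, b, c, d)"
proof -
  define g where "g = gcd a c"
  have g: "g > 0" using assms unfolding g_def by (auto simp: gcd_pos_int)
  define a1 c1 where "a1 = a div g" and "c1 = c div g"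
  have a: "a = g * a1" and c: "c = g * c1" by (simp_all add: a1_def c1_def g_def)
  have cop: "coprime a1 c1"
    unfolding a1_def c1_def g_def using g by (intro div_gcd_coprime) (auto simp: g_def)
  then obtain s t where st: "s * a1 + t * c1 = 1"
    using coprime_iff_gcd_eq_1 bezout_int by metis
  have det: "imat_det (a, b, c, d) = g * (a1 * d - b * c1)" by (simp add: a c algebra_simps)
  hence det': "imat_det (a, b, c, d) div g = a1 * d - b * c1" using g by simp
  show ?thesis
  proof (rule that[of "-t" s "s * b + t * d"])
    show "(a div gcd a c, - t, c div gcd a c, s) \<in> SL2Z"
      using st by (simp add: SL2Z_iff flip: g_def a1_def c1_def) (simp add: algebra_simps)
    show "gcd a c dvd imat_det (a, b, c, d)" using det by (simp flip: g_def)
    have "b = (s * a1 + t * c1) * b" "d = (s * a1 + t * c1) * d" by (simp_all add: st)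
    thus "(a, b, c, d) = imat_mult (a div gcd a c, - t, c div gcd a c, s) 
        (gcd a c, s * b + t * d, 0, imat_det (a, b, c, d) div gcd a c)"
      unfolding g_def[symmetric] a1_def[symmetric] c1_def[symmetric] det'
      by (simp only: a c imat_mult.simps prod.inject) (simp add: algebra_simps)
  qed
qed

lemma filterlim_moebius_upper:
  assumes "A > 0" "D > 0"
  shows "filterlim (moebius_map (A, B, 0, D)) at_i_infinity at_i_infinity"
proof -
  have "filterlim (\<lambda>z. of_int A / of_int D * Im z) at_top at_i_infinity"
    using assms by (intro filterlim_tendsto_pos_mult_at_top[OF tendsto_const] filterlim_Im_at_i_infinity) auto
  also have "(\<lambda>z. of_int A / of_int D * Im z) = (\<lambda>z. Im (moebius_map (A, B, 0, D) z))"
    by (auto simp: Im_divide power2_eq_square)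
  finally show ?thesis by (simp add: filterlim_filtercomap_iff o_def)
qed

lemma tendsto_slash_upper:
  assumes "(f \<longlongrightarrow> L) at_i_infinity" "A > 0" "D > 0"
  shows "(slash k (A, B, 0, D) f \<longlongrightarrow> of_int (A * D) ^ (k - 1) / of_int D ^ k * L) at_i_infinity"
proof -
  have "(\<lambda>z. of_int (A * D) ^ (k - 1) / of_int D ^ k * f (moebius_map (A, B, 0, D) z))
     = slash k (A, B, 0, D) f"
    by (auto simp: slash_altdef)
  moreover have "((\<lambda>z. f (moebius_map (A, B, 0, D) z)) \<longlongrightarrow> L) at_i_infinity"
    using filterlim_compose[OF assms(1) filterlim_moebius_upper] assms by blast
  ultimately show ?thesis by (metis tendsto_mult_left)
qed

text \<open>The matrix sends infinity to the cusp a / c, so only the reduced first column enters the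
  limit. The upper triangular factor merely rescales and shifts z; it contributes the determinant
  and its lower right entry. This serves both the substitution of q^h for q and the Hecke
  operators.\<close>

lemma tendsto_slash_det_pos:
  assumes "\<And>a b c d. (a, b, c, d) \<in> SL2Z \<Longrightarrow> (slash k (a, b, c, d) f \<longlongrightarrow> v a c) at_i_infinity"
  assumes "imat_det (a, b, c, d) > 0"
  shows "(slash k (a, b, c, d) f \<longlongrightarrow> 
    of_int (imat_det (a, b, c, d)) ^ (k - 1) / of_int (imat_det (a, b, c, d) div gcd a c) ^ k * 
      v (a div gcd a c) (c div gcd a c)) at_i_infinity"
proof -
  define g where "g = gcd a c"
  define n where "n = imat_det (a, b, c, d)"
  have g: "g > 0" using assms unfolding g_def by (auto simp: gcd_pos_int)
  obtain x y B where *: "(a div g, x, c div g, y) \<in> SL2Z"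
    "(a, b, c, d) = imat_mult (a div g, x, c div g, y) (g, B, 0, n div g)" "g dvd n"
    using imat_upper_triangular[OF assms(2)] unfolding g_def n_def by metis
  have n: "n > 0" using assms(2) by (simp add: n_def)
  have D: "n div g > 0" using n g *(3) by (simp add: pos_imp_zdiv_pos_iff zdvd_imp_le)
  have "(slash k (g, B, 0, n div g) (slash k (a div g, x, c div g, y) f) \<longlongrightarrow>
     of_int (g * (n div g)) ^ (k - 1) / of_int (n div g) ^ k * v (a div g) (c div g)) at_i_infinity"
    by (intro tendsto_slash_upper assms(1) * g D)
  moreover have "g * (n div g) = n" using *(3) by simp
  ultimately have "(slash k (g, B, 0, n div g) (slash k (a div g, x, c div g, y) f) \<longlongrightarrow>
     of_int n ^ (k - 1) / of_int (n div g) ^ k * v (a div g) (c div g)) at_i_infinity" by simp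
  also have "?this \<longleftrightarrow> (slash k (a, b, c, d) f \<longlongrightarrow> of_int n ^ (k - 1) / of_int (n div g) ^ k * v (a div g) (c div g)) at_i_infinity"
  proof (intro filterlim_cong refl)
    have "slash k (g, B, 0, n div g) (slash k (a div g, x, c div g, y) f) z = slash k (a, b, c, d) f z"
      if "Im z > 0" for z
      unfolding *(2) using *(1) that g D by (subst slash_mult) (auto simp: SL2Z_iff)
    thus "\<forall>\<^sub>F z in at_i_infinity. slash k (g, B, 0, n div g) (slash k (a div g, x, c div g, y) f) z = slash k (a, b, c, d) f z"
      by (intro eventually_mono[OF eventually_Im_gt[of 0]]) auto
  qed
  finally show ?thesis by (simp add: g_def n_def del: imat_det.simps)
qed

section \<open>Level one\<close>

lemma SL2Z_translate_invert:
  assumes "(a, b, c, d) \<in> SL2Z"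
  shows "(a - n * c, b - n * d, c, d) \<in> SL2Z" "(- c, - d, a, b) \<in> SL2Z"
  using assms by (simp_all add: SL2Z_iff algebra_simps)

lemma coprime_SL2Z_bottom: "(a, b, c, d) \<in> SL2Z \<Longrightarrow> coprime c d"
proof -
  assume "(a, b, c, d) \<in> SL2Z"
  hence "a * d - b * c = 1" by (simp add: SL2Z_iff)
  thus "coprime c d" unfolding coprime_iff_gcd_eq_1
    by (metis dvd_diff dvd_mult gcd_dvd1 gcd_dvd2 is_unit_gcd_iff)
qed

lemma coprime_imp_SL2Z_bottom:
  assumes "coprime c (d :: int)"
  obtains a b where "(a, b, c, d) \<in> SL2Z"
proof -
  obtain s t where "s * c + t * d = 1"
    using assms coprime_iff_gcd_eq_1 bezout_int by metis
  hence "(t, - s, c, d) \<in> SL2Z" by (simp add: SL2Z_iff algebra_simps)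
  thus ?thesis using that by blast
qed

lemma finite_small_aut_factor:
  assumes "Im z > 0"
  shows "finite {(c, d). norm (aut_factor (a, b, c, d) z) \<le> 1}"
proof -
  define B where "B = (1 + 1 / Im z * \<bar>Re z\<bar>)"
  define M where "M = \<lceil>max B (1 / Im z)\<rceil>"
  have "{(c, d). norm (aut_factor (a, b, c, d) z) \<le> 1} \<subseteq> {-M..M} \<times> {-M..M}"
  proof clarify
    fix c d :: int
    assume le: "norm (aut_factor (a, b, c, d) z) \<le> 1"
    have "\<bar>Im (of_int c * z + of_int d)\<bar> \<le> 1" 
      using le abs_Im_le_cmod order_trans by (auto simp del: plus_complex.simps times_complex.simps)
    hence "\<bar>of_int c\<bar> * Im z \<le> 1" using assms by (simp add: abs_mult)
    hence c: "\<bar>of_int c\<bar> \<le> 1 / Im z" using assms by (simp add: field_simps)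
    have "\<bar>Re (of_int c * z + of_int d)\<bar> \<le> 1" 
      using le abs_Re_le_cmod order_trans by (auto simp del: plus_complex.simps times_complex.simps)
    hence "\<bar>of_int c * Re z + of_int d\<bar> \<le> 1" by simp
    hence "\<bar>of_int d\<bar> \<le> 1 + \<bar>of_int c\<bar> * \<bar>Re z\<bar>" by (simp add: abs_mult[symmetric])
    also have "\<dots> \<le> B" unfolding B_def using c by (intro add_left_mono mult_right_mono) auto
    finally have d: "\<bar>of_int d\<bar> \<le> B" .
    have "\<bar>of_int c\<bar> \<le> real_of_int M" "\<bar>of_int d\<bar> \<le> real_of_int M"
      using c d unfolding M_def by linarith+
    thus "c \<in> {-M..M} \<and> d \<in> {-M..M}" by (auto simp: abs_le_iff)
  qed
  thus ?thesis by (rule finite_subset) auto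
qed

text \<open>The imaginary part of \<gamma> z is Im z / |c z + d|^2, so it is largest where |c z + d|
  is smallest over coprime pairs. After a translation to |Re w| \<le> 1/2, maximality forces |w|
  \<ge> 1, and Pythagoras gives (Im w)^2 \<ge> 3/4.\<close>

lemma SL2Z_reduce:
  assumes "Im z > 0"
  obtains \<gamma> where "\<gamma> \<in> SL2Z" "\<bar>Re (moebius_map \<gamma> z)\<bar> \<le> 1 / 2" "Im (moebius_map \<gamma> z) \<ge> sqrt 3 / 2"
proof -
  \<comment> \<open>The pair (0, 1) has factor 1, so a minimum over this finite set is a minimum
    over all coprime pairs.\<close>
  define S where "S = {(c, d). coprime c d \<and> norm (aut_factor (0, 0, c, d) z) \<le> 1}"
  define \<phi> where "\<phi> = (\<lambda>(c, d). norm (aut_factor (0, 0, c, d) z))"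
  have "finite S"
    by (rule finite_subset[OF _ finite_small_aut_factor[OF assms, of 0 0]]) (auto simp: S_def)
  moreover have "(0, 1) \<in> S" by (simp add: S_def)
  ultimately have "\<exists>p\<in>S. \<forall>p'\<in>S. \<phi> p \<le> \<phi> p'"
    by (metis arg_min_if_finite(1) arg_min_least empty_iff)
  then obtain c d where cd: "(c, d) \<in> S" "\<And>c' d'. (c', d') \<in> S \<Longrightarrow> \<phi> (c, d) \<le> \<phi> (c', d')" by auto
  have min: "\<phi> (c, d) \<le> \<phi> (c', d')" if "coprime c' d'" for c' d'
  proof (cases "(c', d') \<in> S")
    case False
    hence "\<phi> (c', d') > 1" using that by (auto simp: S_def \<phi>_def)
    thus ?thesis using cd(1) by (auto simp: S_def \<phi>_def)
  qed (use cd in auto)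
  obtain a b where ab: "(a, b, c, d) \<in> SL2Z"
    using cd(1) coprime_imp_SL2Z_bottom[of c d] by (auto simp: S_def)
  define n where "n = round (Re (moebius_map (a, b, c, d) z))"
  define \<gamma> where "\<gamma> = (a - n * c, b - n * d, c, d)"
  have \<gamma>: "\<gamma> \<in> SL2Z" using ab SL2Z_translate_invert(1) by (simp add: \<gamma>_def)
  define w where "w = moebius_map \<gamma> z"
  have nz: "of_int c * z + of_int d \<noteq> 0"
    using aut_factor_nonzero[of z \<gamma>] \<gamma> assms by (auto simp: SL2Z_iff \<gamma>_def)
  have "w = moebius_map (a, b, c, d) z - of_int n"
    using nz by (simp add: w_def \<gamma>_def field_simps)
  hence Re_w: "\<bar>Re w\<bar> \<le> 1 / 2"
    using of_int_round_abs_le[of "Re (moebius_map (a, b, c, d) z)"] by (simp add: n_def abs_minus_commute)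
  have Im_w: "Im w > 0" using \<gamma> assms unfolding w_def by (intro moebius_in_H) (auto simp: SL2Z_iff)
  have "norm w \<ge> 1"
  proof (rule ccontr)
    assume *: "\<not> norm w \<ge> 1"
    \<comment> \<open>Inverting w yields a matrix with bottom row of factor |w| |c z + d|, which
      would beat the minimum if |w| < 1.\<close>
    have "(- c, - d, a - n * c, b - n * d) \<in> SL2Z"
      using \<gamma> SL2Z_translate_invert(2) by (simp add: \<gamma>_def)
    hence "coprime (a - n * c) (b - n * d)" by (rule coprime_SL2Z_bottom)
    hence "\<phi> (c, d) \<le> \<phi> (a - n * c, b - n * d)" by (rule min)
    also have "\<phi> (a - n * c, b - n * d) = norm (w * (of_int c * z + of_int d))"
      using nz by (simp add: \<phi>_def w_def \<gamma>_def)
    also have "\<dots> = norm w * \<phi> (c, d)" by (simp add: norm_mult \<phi>_def)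
    finally have "norm w \<ge> 1" using nz by (simp add: \<phi>_def)
    with * show False by simp
  qed
  hence "1 \<le> (norm w)\<^sup>2" by simp
  also have "(norm w)\<^sup>2 = \<bar>Re w\<bar>\<^sup>2 + (Im w)\<^sup>2" by (simp add: cmod_power2)
  also have "\<bar>Re w\<bar>\<^sup>2 \<le> (1 / 2)\<^sup>2" using Re_w by (intro power_mono) auto
  finally have "(sqrt 3 / 2)\<^sup>2 \<le> (Im w)\<^sup>2" by (simp add: power_divide)
  hence "sqrt 3 / 2 \<le> Im w" using Im_w by (subst (asm) power_mono_iff) auto
  with Re_w \<gamma> show ?thesis using that unfolding w_def by blast
qed

section \<open>Maximum principle for level one\<close>

lemma sqrt_3_half_gt: "sqrt 3 / 2 > 43 / 50"
proof -
  have "sqrt ((43 / 25)\<^sup>2) < sqrt 3" unfolding real_sqrt_less_iff by (simp add: power2_eq_square)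
  thus ?thesis by simp
qed

lemma compact_rectangle: "compact {z. \<bar>Re z\<bar> \<le> a \<and> b \<le> Im z \<and> Im z \<le> c}"
proof -
  have "{z. \<bar>Re z\<bar> \<le> a \<and> b \<le> Im z \<and> Im z \<le> c} = cbox (Complex (-a) b) (Complex a c)"
    by (auto simp: cbox_complex_eq)
  thus ?thesis by simp
qed

text \<open>The logarithm (K/2) ln y - 2 pi m y decreases for y > K / (4 pi m). With K < 10 m this
  threshold lies below 21/25, already because pi > 3 and 12 * 21/25 = 10.08. At the same time 21/25
  < 43/50 < \<open>sqrt 3 / 2\<close>, so the boundary line at height 21/25 runs below every reduced
  point.\<close>

lemma exp_powr_strict_decreasing:
  fixes K m y y' :: real
  assumes "K \<ge> 0" "K < 10 * m" "21 / 25 \<le> y" "y < y'"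
  shows "y' powr (K / 2) * exp (- (2 * pi * m * y')) < y powr (K / 2) * exp (- (2 * pi * m * y))"
proof -
  have "ln y' - ln y \<le> (y' - y) / y" using ln_diff_le[of y' y] assms by simp
  hence "K / 2 * (ln y' - ln y) \<le> K / 2 * ((y' - y) / y)" using assms by (intro mult_left_mono) auto
  also have "\<dots> = K * (y' - y) / (2 * y)" by simp
  also have "\<dots> < 2 * pi * m * (y' - y)"
  proof -
    have "K < 10 * m" by fact
    also have "10 \<le> (2 * pi) * (2 * (21 / 25))" using pi_gt3 by simp
    also have "\<dots> \<le> (2 * pi) * (2 * y)" using assms pi_gt3 by (intro mult_left_mono) auto
    finally have "K < (2 * pi * (2 * y)) * m" using assms by simp
    hence "K * (y' - y) < ((2 * pi * (2 * y)) * m) * (y' - y)" 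
      using assms by (intro mult_strict_right_mono) auto
    thus ?thesis using assms by (simp add: field_simps)
  qed
  finally have "K / 2 * ln y' - 2 * pi * m * y' < K / 2 * ln y - 2 * pi * m * y"
    unfolding right_diff_distrib by linarith
  thus ?thesis using assms by (simp add: powr_def flip: exp_add)
qed

text \<open>
  \<open>|F(z)| (Im z)\<^bsup>K/2\<^esup>\<close> is invariant and attains its maximum at some \<open>z\<^sub>0\<close> with \<open>Im z\<^sub>0 \<ge> \<surd>3/2\<close>. If \<open>F\<close>
  decays too fast, this contradicts the maximum principle on a half plane whose boundary line
  lies below \<open>z\<^sub>0\<close>. The sharp constant would be 12 instead of 10.
\<close>

lemma level_one_vanishing:
  fixes m :: real and K :: nat
  assumes holo: "F holomorphic_on upper_half_plane"
  assumes inv: "\<And>\<gamma> z. \<gamma> \<in> SL2Z \<Longrightarrow> Im z > 0 \<Longrightarrow> 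
                  norm (F (moebius_map \<gamma> z)) = norm (aut_factor \<gamma> z) ^ K * norm (F z)"
  assumes bigo: "F \<in> O[at_i_infinity](\<lambda>z. qe (of_real m * z))"
  assumes m: "m > K / 10" and z: "Im z > 0"
  shows "F z = 0"
proof (rule ccontr)
  assume nonzero: "F z \<noteq> 0"
  \<comment> \<open>A value strictly between K/10 and m: being below m it lets \<open>h\<close> tend
    to 0, being above K/10 it makes \<open>\<psi>\<close> decreasing.\<close>
  define m' where "m' = (m + K / 10) / 2"
  have m': "m' < m" "real K < 10 * m'" using m by (auto simp: m'_def field_simps)
  define P where "P = (\<lambda>z. norm (F z) * Im z powr (K / 2))"
  \<comment> \<open>The invariant \<open>P\<close> is split as |h| times \<open>\<psi>\<close> of
    the height, a holomorphic factor for the maximum principle and a decreasing one to compare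
    heights.\<close>
  define h where "h = (\<lambda>z. F z * qe (- of_real m' * z))"
  define \<psi> where "\<psi> = (\<lambda>y. y powr (K / 2) * exp (- (2 * pi * m' * y)))"
  have \<psi>_less: "\<psi> y' < \<psi> y" if "21 / 25 \<le> y" "y < y'" for y y'
    unfolding \<psi>_def using m' that by (intro exp_powr_strict_decreasing) auto
  have \<psi>_pos: "\<psi> y > 0" if "y > 0" for y using that by (simp add: \<psi>_def)
  have P_eq: "P z = norm (h z) * \<psi> (Im z)" for z
    by (simp add: P_def h_def \<psi>_def norm_mult flip: exp_add)
  have P_inv: "P (moebius_map \<gamma> z) = P z" if "\<gamma> \<in> SL2Z" "Im z > 0" for \<gamma> z
  proof -
    have nz: "aut_factor \<gamma> z \<noteq> 0" using that aut_factor_nonzero by (auto simp: SL2Z_iff)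
    have "(norm (aut_factor \<gamma> z) ^ 2) powr (real K / 2) = norm (aut_factor \<gamma> z) powr K"
    proof -
      have "norm (aut_factor \<gamma> z) ^ 2 = norm (aut_factor \<gamma> z) powr 2" using nz by simp
      thus ?thesis by (simp only: powr_powr) simp
    qed
    also have "\<dots> = norm (aut_factor \<gamma> z) ^ K" using nz by (simp add: powr_realpow)
    finally have "(Im z / norm (aut_factor \<gamma> z) ^ 2) powr (K / 2) = 
                    Im z powr (K / 2) / norm (aut_factor \<gamma> z) ^ K"
      using that by (subst powr_divide) auto
    thus ?thesis using inv[OF that] nz that by (simp add: P_def Im_moebius SL2Z_iff)
  qed
  have h_tendsto: "((\<lambda>z. norm (h z)) \<longlongrightarrow> 0) at_i_infinity"
  proof -
    have "(\<lambda>z. h z) \<in> O[at_i_infinity](\<lambda>z. qe (of_real m * z) * qe (- of_real m' * z))"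
      unfolding h_def by (intro landau_o.big.mult bigo) auto
    also have "(\<lambda>z. qe (of_real m * z) * qe (- of_real m' * z)) = (\<lambda>z. qe (of_real (m - m') * z))"
      by (simp add: algebra_simps flip: exp_add)
    also have "(\<lambda>z. qe (of_real (m - m') * z)) \<in> o[at_i_infinity](\<lambda>_. 1)"
    proof (rule smalloI_tendsto)
      have "((\<lambda>z. exp (- (2 * pi * (m - m') * Im z))) \<longlongrightarrow> 0) at_i_infinity"
      proof (rule filterlim_compose[OF exp_at_bot])
        have "filterlim (\<lambda>z. 2 * pi * (m - m') * Im z) at_top at_i_infinity"
          using m' by (intro filterlim_tendsto_pos_mult_at_top[OF tendsto_const] filterlim_Im_at_i_infinity) auto
        thus "LIM z at_i_infinity. - (2 * pi * (m - m') * Im z) :> at_bot"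
          by (simp add: filterlim_uminus_at_bot)
      qed
      thus "((\<lambda>z. qe (of_real (m - m') * z) / 1) \<longlongrightarrow> 0) at_i_infinity"
        by (subst tendsto_norm_zero_iff[symmetric]) (simp add: mult_ac)
    qed auto
    finally have "h \<in> o[at_i_infinity](\<lambda>_. 1)" .
    thus ?thesis using smalloD_tendsto by (fastforce intro: tendsto_norm_zero)
  qed
  have cont_F: "continuous_on A F" if "A \<subseteq> upper_half_plane" for A
    using holo holomorphic_on_imp_continuous_on holomorphic_on_subset that by blast
  have cont_P: "continuous_on A P" if "\<And>z. z \<in> A \<Longrightarrow> Im z > 0" for A
    unfolding P_def using that by (intro continuous_intros cont_F) (force simp: in_H_iff)+
  have cont_h: "continuous_on A (\<lambda>z. norm (h z))" if "\<And>z. z \<in> A \<Longrightarrow> Im z > 0" for A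
    unfolding h_def using that by (intro continuous_intros cont_F) (force simp: in_H_iff)+

  define D where "D = {z. \<bar>Re z\<bar> \<le> 1 / 2 \<and> sqrt 3 / 2 \<le> Im z}"
  have D_Im: "Im z > 43 / 50" if "z \<in> D" for z using that sqrt_3_half_gt by (auto simp: D_def)
  have to_D: "\<exists>z'\<in>D. P z' = P z" if "Im z > 0" for z
    using SL2Z_reduce[OF that] P_inv that unfolding D_def by (smt (verit) mem_Collect_eq)
  obtain z1 where z1: "z1 \<in> D" "P z1 = P z" using to_D[OF z] by blast
  have P_z: "P z > 0" using nonzero z by (simp add: P_def)
  have "\<forall>\<^sub>F z in at_i_infinity. norm (h z) < P z1 / \<psi> (21 / 25)"
    using z1 P_z \<psi>_pos[of "21/25"] by (intro order_tendstoD(2)[OF h_tendsto]) auto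
  then obtain Y where Y: "\<And>z. Im z \<ge> Y \<Longrightarrow> norm (h z) < P z1 / \<psi> (21 / 25)"
    by (auto simp: eventually_at_i_infinity)
  \<comment> \<open>Points of large height cannot compete with \<open>z1\<close>, so the supremum of
    \<open>P\<close> over the non-compact set \<open>D\<close> is attained on a compact
    part.\<close>
  have P_small: "P u < P z1" if "Im u \<ge> Y" "Im u \<ge> 43 / 50" for u
  proof -
    have "P u = norm (h u) * \<psi> (Im u)" by (rule P_eq)
    also have "\<dots> \<le> norm (h u) * \<psi> (21 / 25)" 
      using \<psi>_less[of "21/25" "Im u"] that by (intro mult_left_mono) auto
    also have "\<dots> < P z1 / \<psi> (21 / 25) * \<psi> (21 / 25)"
      using Y[OF that(1)] \<psi>_pos[of "21/25"] by (intro mult_strict_right_mono) auto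
    also have "\<dots> = P z1" using \<psi>_pos[of "21/25"] by simp
    finally show ?thesis .
  qed
  define C where "C = {z. \<bar>Re z\<bar> \<le> 1 / 2 \<and> sqrt 3 / 2 \<le> Im z \<and> Im z \<le> Y}"
  have D_C: "u \<in> C" if "u \<in> D" "P u \<ge> P z1" for u
    using that P_small[of u] D_Im[of u] by (force simp: C_def D_def)
  have "compact C" unfolding C_def by (rule compact_rectangle)
  moreover have "z1 \<in> C" using z1 by (intro D_C) auto
  moreover have "continuous_on C P" 
    by (intro cont_P) (use sqrt_3_half_gt in \<open>auto simp: C_def\<close>)
  ultimately obtain z0 where z0: "z0 \<in> C" "\<And>u. u \<in> C \<Longrightarrow> P u \<le> P z0"
    using continuous_attains_sup[of C P] by blast
  have z0_ge: "P z0 \<ge> P z1" using z0 \<open>z1 \<in> C\<close> by blast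
  have P_max: "P u \<le> P z0" if "Im u > 0" for u
    using to_D[OF that] D_C z0(2) z0_ge by fastforce
  have Im_z0: "Im z0 > 43 / 50" using z0(1) sqrt_3_half_gt by (auto simp: C_def)

  \<comment> \<open>On a line below \<open>z0\<close> the factor \<open>\<psi>\<close> is larger
    than at \<open>z0\<close> while \<open>P\<close> is at most \<open>P z0\<close>, so |h| must be
    strictly smaller. Hence |h| has its maximum over the closed half plane in the interior.\<close>
  have h_line: "norm (h u) < norm (h z0)" if "Im u = 21 / 25" for u
  proof -
    have "norm (h u) * \<psi> (21 / 25) \<le> norm (h z0) * \<psi> (Im z0)"
      using P_max[of u] P_eq[of u] P_eq[of z0] that by simp
    also have "\<dots> < norm (h z0) * \<psi> (21 / 25)"
    proof -
      have "norm (h z0) > 0" using P_eq[of z0] z0_ge z1 P_z by auto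
      thus ?thesis using Im_z0 \<psi>_less[of "21/25" "Im z0"] by (intro mult_strict_left_mono) auto
    qed
    finally show ?thesis using \<psi>_pos[of "21/25"] by simp
  qed
  have "norm (h z0) > 0" using P_eq[of z0] z0_ge z1 P_z by auto
  hence "\<forall>\<^sub>F z in at_i_infinity. norm (h z) < norm (h z0)"
    by (intro order_tendstoD(2)[OF h_tendsto])
  then obtain Y' where Y': "\<And>z. Im z \<ge> Y' \<Longrightarrow> norm (h z) < norm (h z0)"
    by (auto simp: eventually_at_i_infinity)
  \<comment> \<open>Only the modulus of \<open>h\<close> is periodic: \<open>m'\<close> need not be
    an integer, and \<open>F\<close> is invariant in absolute value only. This is enough to confine
    the search for a maximum to a strip.\<close>
  have h_translate: "norm (h (u + of_int n)) = norm (h u)" if "Im u > 0" for u n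
  proof -
    have "P (moebius_map (1, n, 0, 1) u) = P u" by (intro P_inv that) (simp add: SL2Z_iff)
    thus ?thesis using P_eq[of "u + of_int n"] P_eq[of u] \<psi>_pos[of "Im u"] that by simp
  qed
  define C' where "C' = {z. \<bar>Re z\<bar> \<le> 1 / 2 \<and> 21 / 25 \<le> Im z \<and> Im z \<le> Y'}"
  have "compact C'" unfolding C'_def by (rule compact_rectangle)
  moreover have "z0 \<in> C'" using z0(1) Im_z0 Y'[of z0] by (force simp: C'_def C_def)
  moreover have "continuous_on C' (\<lambda>z. norm (h z))" by (intro cont_h) (auto simp: C'_def)
  ultimately obtain w where w: "w \<in> C'" "\<And>u. u \<in> C' \<Longrightarrow> norm (h u) \<le> norm (h w)"
    using continuous_attains_sup[of C' "\<lambda>z. norm (h z)"] by blast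
  have w_ge: "norm (h w) \<ge> norm (h z0)" using w \<open>z0 \<in> C'\<close> by blast
  have w_max: "norm (h u) \<le> norm (h w)" if "Im u \<ge> 21 / 25" for u
  proof (cases "Im u \<ge> Y'")
    case False
    define n where "n = - round (Re u)"
    have "u + of_int n \<in> C'" using False that of_int_round_abs_le[of "Re u"]
      by (auto simp: C'_def n_def abs_minus_commute)
    from w(2)[OF this] show ?thesis using h_translate[of u n] that by simp
  qed (use Y' w_ge in force)
  define U where "U = {u. Im u > 21 / 25}"
  have "h constant_on U"
  proof (rule maximum_modulus_principle[where U = U and \<xi> = w])
    have "F holomorphic_on U" by (rule holomorphic_on_subset[OF holo]) (auto simp: U_def in_H_iff)
    thus "h holomorphic_on U" unfolding h_def by (intro holomorphic_intros)
    show "open U" "open U" unfolding U_def by (rule open_halfspace_Im_gt)+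
    show "connected U" unfolding U_def by (intro convex_connected convex_halfspace_Im_gt)
    show "w \<in> U" using w(1) h_line[of w] w_ge by (force simp: C'_def U_def)
    show "norm (h u) \<le> norm (h w)" if "u \<in> U" for u using that w_max by (auto simp: U_def)
  qed auto
  moreover have "z0 \<in> U" using Im_z0 by (simp add: U_def)
  \<comment> \<open>A point so high that |h| is smaller there than at \<open>z0\<close>, which
    contradicts constancy.\<close>
  moreover define v where "v = Complex 0 (max Y' 1)"
  have "v \<in> U" by (simp add: v_def U_def)
  ultimately have "h v = h z0" by (metis constant_on_def)
  moreover have "norm (h v) < norm (h z0)" by (intro Y') (simp add: v_def)
  ultimately show False by simp
qed

section \<open>Level \<open>N\<close>\<close>

definition Gamma0_invariant :: "nat \<Rightarrow> nat \<Rightarrow> (complex \<Rightarrow> complex) \<Rightarrow> bool" where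
  "Gamma0_invariant k N f \<longleftrightarrow> (\<forall>\<gamma>\<in>Gamma0 N. \<forall>z\<in>upper_half_plane. slash k \<gamma> f z = f z)"

text \<open>
  The bottom rows of matrices in \<^const>\<open>SL2Z\<close> modulo \<open>N\<close>. They index the cosets of \<open>\<Gamma>\<^sub>1(N)\<close>, so each
  coset of \<open>\<Gamma>\<^sub>0(N)\<close> is counted \<open>\<phi>(N)\<close> times; this avoids choosing coset representatives.
\<close>

definition bottom_rows :: "nat \<Rightarrow> (int \<times> int) set" where
  "bottom_rows N = {(c, d) \<in> {0..<int N} \<times> {0..<int N}. gcd (gcd c d) (int N) = 1}"

fun row_mod :: "nat \<Rightarrow> imat \<Rightarrow> int \<times> int" where
  "row_mod N (a, b, c, d) = (c mod int N, d mod int N)"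

lemma finite_bottom_rows [simp, intro]: "finite (bottom_rows N)"
  unfolding bottom_rows_def by (rule finite_subset[of _ "{0..<int N} \<times> {0..<int N}"]) auto

lemma row_mod_in_bottom_rows:
  assumes "\<gamma> \<in> SL2Z" "N > 0"
  shows "row_mod N \<gamma> \<in> bottom_rows N"
proof (cases \<gamma>)
  case (fields a b c d)
  have "coprime c d" using assms coprime_SL2Z_bottom fields by blast
  have *: "gcd (x mod int N) (int N) = gcd x (int N)" for x
    using assms(2) by (simp add: gcd_mod_left)
  have "gcd (gcd (c mod int N) (d mod int N)) (int N) = gcd (gcd (c mod int N) (int N)) (gcd (d mod int N) (int N))"
    by (rule zdvd_antisym_nonneg) (auto intro: dvd_trans)
  also have "\<dots> = gcd (gcd c (int N)) (gcd d (int N))" by (simp only: *)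
  also have "\<dots> = 1" using \<open>coprime c d\<close>
    by (simp add: coprime_iff_gcd_eq_1 gcd.assoc gcd.left_commute[of "int N"] flip: gcd.assoc[of c d])
  finally show ?thesis using assms(2) by (simp add: bottom_rows_def fields)
qed

text \<open>Surjectivity of the reduction modulo N on bottom rows: d is moved by a multiple of N
  until it becomes coprime to c.\<close>

lemma bottom_rows_lift:
  assumes "(c, d) \<in> bottom_rows N" "N > 0"
  obtains \<gamma> where "\<gamma> \<in> SL2Z" "row_mod N \<gamma> = (c, d)"
proof -
  \<comment> \<open>Zero is replaced by N, since the argument runs over the finitely many prime
    factors of the left entry.\<close>
  define c' where "c' = (if c = 0 then int N else c)"
  have c': "c' > 0" "c' mod int N = c" using assms by (auto simp: c'_def bottom_rows_def)
  have gcd: "gcd (gcd c' d) (int N) = 1"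
    using assms by (auto simp: bottom_rows_def c'_def gcd.commute gcd.left_commute)
  \<comment> \<open>With this t every prime dividing \<open>c'\<close> divides exactly one of d and
    N t: if it misses d it divides t, and if it divides d it divides neither t nor, by the gcd
    condition, N.\<close>
  define t where "t = \<Prod>{p\<in>prime_factors c'. \<not> p dvd d}"
  have "coprime c' (d + int N * t)"
  proof (rule ccontr)
    assume "\<not> coprime c' (d + int N * t)"
    hence "\<not> is_unit (gcd c' (d + int N * t))" by (simp add: coprime_iff_gcd_eq_1)
    then obtain p where "prime p" "p dvd gcd c' (d + int N * t)"
      using prime_divisorE[of "gcd c' (d + int N * t)"] c' by auto
    hence p: "prime p" "p dvd c'" "p dvd d + int N * t" by auto
    have pt: "p dvd t \<longleftrightarrow> \<not> p dvd d"
    proof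
      assume "p dvd t"
      then obtain p' where p': "p' \<in> prime_factors c'" "\<not> p' dvd d" "p dvd p'"
        unfolding t_def using p(1) by (subst (asm) prime_dvd_prod_iff) auto
      hence "p = p'" using p(1) by (auto intro: primes_dvd_imp_eq)
      with p' show "\<not> p dvd d" by simp
    next
      assume "\<not> p dvd d"
      hence "p \<in> {p\<in>prime_factors c'. \<not> p dvd d}" using p c' by (auto simp: prime_factors_dvd)
      thus "p dvd t" unfolding t_def by (rule dvd_prodI[rotated]) auto
    qed
    have "p dvd d"
    proof (rule ccontr)
      assume "\<not> p dvd d"
      hence "p dvd int N * t" using pt by simp
      hence "p dvd d" using p(3) by (simp add: dvd_add_left_iff)
      thus False using \<open>\<not> p dvd d\<close> by simp
    qed
    hence "p dvd int N * t" using p(3) by (simp add: dvd_add_right_iff)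
    hence "p dvd int N" using pt \<open>p dvd d\<close> p(1) by (auto simp: prime_dvd_mult_iff)
    with p \<open>p dvd d\<close> have "p dvd gcd (gcd c' d) (int N)" by simp
    thus False using gcd p(1) by auto
  qed
  then obtain a b where "(a, b, c', d + int N * t) \<in> SL2Z"
    using coprime_imp_SL2Z_bottom by blast
  moreover have "row_mod N (a, b, c', d + int N * t) = (c, d)"
    using c' assms by (auto simp: bottom_rows_def)
  ultimately show ?thesis using that by blast
qed

lemma row_mod_mult_cong:
  assumes "row_mod N \<alpha> = row_mod N \<beta>"
  shows "row_mod N (imat_mult \<alpha> \<gamma>) = row_mod N (imat_mult \<beta> \<gamma>)"
  using assms by (cases \<alpha>; cases \<beta>; cases \<gamma>) (auto intro!: mod_add_cong mod_mult_cong)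

text \<open>The quotient \<open>\<alpha>\<close> \<open>\<beta>\<close>^(-1) has the bottom row of
  the identity modulo N and therefore lies in \<open>Gamma0 N\<close>.\<close>

lemma slash_eq_if_row_mod_eq:
  assumes "Gamma0_invariant k N f" "\<alpha> \<in> SL2Z" "\<beta> \<in> SL2Z" "row_mod N \<alpha> = row_mod N \<beta>" "Im z > 0"
  shows "slash k \<alpha> f z = slash k \<beta> f z"
proof -
  define \<delta> where "\<delta> = imat_mult \<alpha> (imat_adj \<beta>)"
  have SL: "\<delta> \<in> SL2Z" unfolding \<delta>_def by (intro SL2Z_mult SL2Z_adj assms)
  have "row_mod N \<delta> = row_mod N (imat_mult \<beta> (imat_adj \<beta>))"
    unfolding \<delta>_def by (intro row_mod_mult_cong assms)
  also have "\<dots> = row_mod N (1, 0, 0, 1)" using assms(3) by (simp add: imat_mult_adj SL2Z_iff)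
  finally have "\<delta> \<in> Gamma0 N" using SL
    by (cases \<delta>) (auto simp: Gamma0_iff SL2Z_iff mod_0_imp_dvd)
  hence inv: "slash k \<delta> f z = f z" if "Im z > 0" for z
    using assms(1) that by (simp add: Gamma0_invariant_def in_H_iff)
  have "imat_mult \<delta> \<beta> = \<alpha>"
    using assms(3) by (simp add: \<delta>_def imat_mult_assoc imat_mult_adj SL2Z_iff)
  hence "slash k \<alpha> f z = slash k \<beta> (slash k \<delta> f) z"
    using assms SL slash_mult[of z \<beta> \<delta> k f] by (simp add: SL2Z_iff)
  also have "\<dots> = slash k \<beta> f z"
    using assms inv by (intro slash_cong_H) (auto simp: SL2Z_iff)
  finally show ?thesis .
qed

lemma holomorphic_mult_eq_0:
  assumes "f holomorphic_on S" "g holomorphic_on S" "open S" "connected S"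
  assumes "\<And>z. z \<in> S \<Longrightarrow> f z * g z = 0"
  shows "(\<forall>z\<in>S. f z = 0) \<or> (\<forall>z\<in>S. g z = 0)"
proof (cases "\<forall>z\<in>S. f z = 0")
  case False
  then obtain z0 where z0: "z0 \<in> S" "f z0 \<noteq> 0" by blast
  have "continuous_on S f" using assms(1) holomorphic_on_imp_continuous_on by blast
  hence "open (f -` (-{0}) \<inter> S)" using assms(3) by (auto simp: continuous_on_open_vimage)
  moreover have "z0 \<in> f -` (-{0}) \<inter> S" using z0 by auto
  ultimately have "g z = 0" if "z \<in> S" for z
    using analytic_continuation_open[of "f -` (-{0}) \<inter> S" S g "\<lambda>_. 0" z] assms that by fastforce
  thus ?thesis by blast
qed auto

lemma holomorphic_prod_eq_0:
  assumes "finite A" "\<And>i. i \<in> A \<Longrightarrow> f i holomorphic_on S" "open S" "connected S" "S \<noteq> {}"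
  assumes "\<And>z. z \<in> S \<Longrightarrow> (\<Prod>i\<in>A. f i z) = 0"
  shows "\<exists>i\<in>A. \<forall>z\<in>S. f i z = 0"
  using assms(1,2,6)
proof (induction A)
  case (insert i A)
  have "(\<lambda>z. \<Prod>i\<in>A. f i z) holomorphic_on S" using insert.prems by (intro holomorphic_intros) auto
  hence "(\<forall>z\<in>S. f i z = 0) \<or> (\<forall>z\<in>S. (\<Prod>i\<in>A. f i z) = 0)"
    using insert assms(3,4) by (intro holomorphic_mult_eq_0) auto
  thus ?case using insert.IH insert.prems by auto
qed (use assms(5) in auto)

text \<open>
  Sturm's bound: the norm of \<open>f\<close>, the product of the \<open>f|\<gamma>\<close> over all rows \<open>(c, d)\<close>, has level one.
\<close>

theorem Gamma0_vanishing:
  fixes t :: "int \<Rightarrow> real"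
  assumes N: "N > 0"
  assumes holo: "f holomorphic_on upper_half_plane"
  assumes inv: "Gamma0_invariant k N f"
  assumes bigo: "\<And>a b c d. (a, b, c, d) \<in> SL2Z \<Longrightarrow> 
     slash k (a, b, c, d) f \<in> O[at_i_infinity](\<lambda>z. qe (of_real (t (c mod int N)) * z))"
  assumes ord: "(\<Sum>(c, d)\<in>bottom_rows N. t c) > of_nat (k * card (bottom_rows N)) / 10"
  assumes z: "Im z > 0"
  shows "f z = 0"
proof -
  have "\<exists>\<gamma>. \<gamma> \<in> SL2Z \<and> row_mod N \<gamma> = p" if "p \<in> bottom_rows N" for p
    using bottom_rows_lift[of "fst p" "snd p" N] that N by (metis prod.collapse)
  then obtain rep where rep: "\<And>p. p \<in> bottom_rows N \<Longrightarrow> rep p \<in> SL2Z" "\<And>p. p \<in> bottom_rows N \<Longrightarrow> row_mod N (rep p) = p"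
    by metis
  define F where "F = (\<lambda>z. \<Prod>p\<in>bottom_rows N. slash k (rep p) f z)"
  have holo_slash: "slash k (rep p) f holomorphic_on upper_half_plane" if "p \<in> bottom_rows N" for p
    using rep[OF that] by (intro holomorphic_slash holo) (auto simp: SL2Z_iff)
  have F_inv: "F (moebius_map \<gamma> z) = aut_factor \<gamma> z ^ (k * card (bottom_rows N)) * F z" 
    if \<gamma>: "\<gamma> \<in> SL2Z" and z: "Im z > 0" for \<gamma> z
  proof -
    \<comment> \<open>Right multiplication by \<open>\<gamma>\<close> permutes the rows, so it
      permutes the factors of the norm and leaves behind one automorphy factor for each of
      them.\<close>
    define act where "act = (\<lambda>p. row_mod N (imat_mult (rep p) \<gamma>))"
    have act_in: "act p \<in> bottom_rows N" if "p \<in> bottom_rows N" for p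
      unfolding act_def using that \<gamma> rep N by (intro row_mod_in_bottom_rows SL2Z_mult) auto
    have "inj_on act (bottom_rows N)"
    proof (rule inj_onI)
      fix p p' assume p: "p \<in> bottom_rows N" "p' \<in> bottom_rows N" "act p = act p'"
      have "row_mod N (imat_mult (imat_mult (rep p) \<gamma>) (imat_adj \<gamma>)) = 
            row_mod N (imat_mult (imat_mult (rep p') \<gamma>) (imat_adj \<gamma>))"
        using p(3) unfolding act_def by (rule row_mod_mult_cong)
      thus "p = p'" using p rep \<gamma> by (simp add: imat_mult_assoc imat_mult_adj SL2Z_iff)
    qed
    hence bij: "bij_betw act (bottom_rows N) (bottom_rows N)"
      using act_in by (simp add: bij_betw_def endo_inj_surj image_subsetI)
    have nz: "aut_factor \<gamma> z \<noteq> 0" using aut_factor_nonzero \<gamma> z by (auto simp: SL2Z_iff)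
    have "slash k (rep p) f (moebius_map \<gamma> z) = aut_factor \<gamma> z ^ k * slash k (rep (act p)) f z"
      if p: "p \<in> bottom_rows N" for p
    proof -
      have "slash k (rep p) f (moebius_map \<gamma> z) = aut_factor \<gamma> z ^ k * slash k \<gamma> (slash k (rep p) f) z"
        using nz \<gamma> by (simp add: slash_altdef[of k \<gamma>] SL2Z_iff)
      also have "slash k \<gamma> (slash k (rep p) f) z = slash k (imat_mult (rep p) \<gamma>) f z"
        using \<gamma> z rep[OF p] by (subst slash_mult) (auto simp: SL2Z_iff)
      also have "\<dots> = slash k (rep (act p)) f z"
        using rep[OF p] rep[OF act_in[OF p]] \<gamma> z
        by (intro slash_eq_if_row_mod_eq[OF inv] SL2Z_mult) (simp_all add: act_def)
      finally show ?thesis .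
    qed
    hence "F (moebius_map \<gamma> z) = (\<Prod>p\<in>bottom_rows N. aut_factor \<gamma> z ^ k * slash k (rep (act p)) f z)"
      unfolding F_def by (intro prod.cong) auto
    also have "\<dots> = aut_factor \<gamma> z ^ (k * card (bottom_rows N)) * (\<Prod>p\<in>bottom_rows N. slash k (rep (act p)) f z)"
      by (simp add: prod.distrib power_mult)
    also have "(\<Prod>p\<in>bottom_rows N. slash k (rep (act p)) f z) = F z"
      unfolding F_def by (rule prod.reindex_bij_betw[OF bij])
    finally show ?thesis .
  qed
  have F_zero: "F z = 0" if "Im z > 0" for z
  proof (rule level_one_vanishing[of F "k * card (bottom_rows N)" "\<Sum>(c, d)\<in>bottom_rows N. t c"])
    show "F holomorphic_on upper_half_plane"
      unfolding F_def by (intro holomorphic_intros holo_slash)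
    have "F \<in> O[at_i_infinity](\<lambda>z. \<Prod>p\<in>bottom_rows N. qe (of_real (t (fst p)) * z))"
      unfolding F_def
    proof (intro landau_o.big_prod)
      fix p assume p: "p \<in> bottom_rows N"
      obtain a b c d where abcd: "rep p = (a, b, c, d)" by (cases "rep p")
      have "c mod int N = fst p" using rep(2)[OF p] by (auto simp: abcd)
      thus "slash k (rep p) f \<in> O[at_i_infinity](\<lambda>z. qe (of_real (t (fst p)) * z))"
        using bigo[of a b c d] rep(1)[OF p] by (simp add: abcd)
    qed
    also have "(\<lambda>z. \<Prod>p\<in>bottom_rows N. qe (of_real (t (fst p)) * z)) = 
               (\<lambda>z. qe (of_real (\<Sum>(c, d)\<in>bottom_rows N. t c) * z))"
      by (simp add: case_prod_unfold sum_distrib_left sum_distrib_right mult_ac flip: exp_sum)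
    finally show "F \<in> O[at_i_infinity](\<lambda>z. qe (of_real (\<Sum>(c, d)\<in>bottom_rows N. t c) * z))" .
  qed (use that F_inv ord in \<open>simp_all add: norm_mult norm_power\<close>)
  have "\<exists>p\<in>bottom_rows N. \<forall>z\<in>upper_half_plane. slash k (rep p) f z = 0"
  proof (rule holomorphic_prod_eq_0)
    show "upper_half_plane \<noteq> {}" using z by (auto simp: in_H_iff)
  qed (use F_zero holo_slash open_upper_half_plane connected_upper_half_plane in \<open>auto simp: F_def in_H_iff\<close>)
  then obtain p where p: "p \<in> bottom_rows N" "\<And>z. Im z > 0 \<Longrightarrow> slash k (rep p) f z = 0"
    by (auto simp: in_H_iff)
  \<comment> \<open>A vanishing product has a factor that vanishes identically; slashing that factor
    back recovers f.\<close>
  have "f z = slash k (imat_mult (rep p) (imat_adj (rep p))) f z"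
    using rep[OF p(1)] by (simp add: imat_mult_adj SL2Z_iff)
  also have "\<dots> = slash k (imat_adj (rep p)) (slash k (rep p) f) z"
    using rep[OF p(1)] z by (intro slash_mult) (auto simp: SL2Z_iff)
  also have "\<dots> = slash k (imat_adj (rep p)) (\<lambda>_. 0) z"
    using rep[OF p(1)] z p by (intro slash_cong_H) (auto simp: SL2Z_iff)
  also have "\<dots> = 0" by (simp add: slash_altdef)
  finally show ?thesis .
qed

section \<open>Expansion of periodic functions in the local parameter at a cusp\<close>

lemma qe_eq_iff: "qe x = qe y \<longleftrightarrow> (\<exists>n. x = y + of_int n)"
proof -
  have "qe x = qe y \<longleftrightarrow> (\<exists>n. 2 * of_real pi * \<i> * x = 2 * of_real pi * \<i> * y + of_int (2 * n) * of_real pi * \<i>)"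
    by (simp add: exp_eq)
  also have "\<dots> \<longleftrightarrow> (\<exists>n. (2 * of_real pi * \<i>) * x = (2 * of_real pi * \<i>) * (y + of_int n))"
    by (simp add: algebra_simps)
  finally show ?thesis by simp
qed

lemma Im_qe_inverse:
  assumes "x \<noteq> 0"
  shows "Im (of_real w * Ln x / (2 * of_real pi * \<i>)) = - w * ln (norm x) / (2 * pi)"
  using assms by (simp add: Im_divide power2_eq_square field_simps)

lemma periodic_translate_int:
  fixes f :: "complex \<Rightarrow> complex"
  assumes per: "\<And>z. Im z > 0 \<Longrightarrow> f (z + of_real w) = f z" and "Im z > 0"
  shows "f (z + of_int n * of_real w) = f z"
proof -
  have *: "f (z + of_nat m * of_real w) = f z" if "Im z > 0" for z m
  proof (induction m)
    case (Suc m)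
    have "f (z + of_nat (Suc m) * of_real w) = f ((z + of_nat m * of_real w) + of_real w)"
      by (simp add: algebra_simps)
    also have "\<dots> = f (z + of_nat m * of_real w)" using that by (intro per) auto
    finally show ?case using Suc by simp
  qed auto
  show ?thesis
  proof (cases "n \<ge> 0")
    case True
    thus ?thesis using *[of z "nat n"] assms(2) by simp
  next
    case False
    thus ?thesis using *[of "z + of_int n * of_real w" "nat (-n)"] assms(2) by simp
  qed
qed

text \<open>Periodicity makes f a function of the local parameter on the punctured disc. Decay at
  infinity makes the puncture a removable singularity with value 0.\<close>

lemma periodic_holomorphic_factor:
  assumes holo: "f holomorphic_on upper_half_plane" and w: "w > 0"
  assumes per: "\<And>z. Im z > 0 \<Longrightarrow> f (z + of_real w) = f z"
  assumes lim: "(f \<longlongrightarrow> 0) at_i_infinity"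
  obtains g where "g holomorphic_on ball 0 1" "g 0 = 0" "\<And>z. Im z > 0 \<Longrightarrow> f z = g (qe (z / of_real w))"
proof -
  define L where "L = (\<lambda>y. of_real w * y / (2 * of_real pi * \<i>))"
  define g where "g = (\<lambda>x. if x = 0 then 0 else f (L (Ln x)))"
  have L_exp: "qe (L y / of_real w) = exp y" for y using w by (simp add: L_def)
  have f_eq: "f u = f v" if uv: "Im u > 0" "Im v > 0" "qe (u / of_real w) = qe (v / of_real w)" for u v
  proof -
    obtain n where "u / of_real w = v / of_real w + of_int n" using uv(3) unfolding qe_eq_iff by blast
    hence "u = v + of_int n * of_real w" using w by (simp add: field_simps)
    thus ?thesis using periodic_translate_int[of f w v n] per uv by auto
  qed
  have Im_L: "Im (L y) > 0 \<longleftrightarrow> norm (exp y) < 1" for y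
  proof -
    have "Im (L y) = - w * Re y / (2 * pi)" by (simp add: L_def Im_divide power2_eq_square field_simps)
    hence "Im (L y) > 0 \<longleftrightarrow> w * Re y < 0" by (simp add: divide_less_0_iff)
    thus ?thesis using w by (simp add: mult_less_0_iff)
  qed
  have g_f: "f z = g (qe (z / of_real w))" if "Im z > 0" for z
  proof -
    have *: "qe (L (Ln (qe (z / of_real w))) / of_real w) = qe (z / of_real w)" 
      unfolding L_exp by (rule exp_Ln) simp
    have "Im (L (Ln (qe (z / of_real w)))) > 0" unfolding Im_L using w that by simp
    hence "f z = f (L (Ln (qe (z / of_real w))))" using * that by (intro f_eq) auto
    thus ?thesis by (simp add: g_def)
  qed
  have lim_g: "g \<midarrow>0\<rightarrow> g 0"
  proof -
    have "filterlim (\<lambda>x. Im (L (Ln x))) at_top (at 0)"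
    proof -
      have "filterlim (\<lambda>x::complex. - ln (norm x)) at_top (at 0)"
      proof (rule filterlim_compose[where g = "\<lambda>x. - ln x" and f = norm])
        show "filterlim (\<lambda>x. - ln x) at_top (at_right (0::real))"
          by (subst filterlim_uminus_at_top) (simp add: ln_at_0)
      next
        show "filterlim (\<lambda>x::complex. norm x) (at_right 0) (at 0)"
          unfolding filterlim_at eventually_at_filter
          using tendsto_norm_zero[OF tendsto_ident_at[of "0::complex" UNIV]]
          by simp
      qed
      hence "filterlim (\<lambda>x::complex. w / (2 * pi) * - ln (norm x)) at_top (at 0)"
        using w by (intro filterlim_tendsto_pos_mult_at_top[OF tendsto_const]) auto
      also have "?this \<longleftrightarrow> ?thesis"
      proof (intro filterlim_cong refl)
        show "\<forall>\<^sub>F x in at 0. w / (2 * pi) * - ln (norm x) = Im (L (Ln x))"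
          unfolding eventually_at_filter L_def by (intro always_eventually allI impI) (simp add: Im_qe_inverse)
      qed
      finally show ?thesis .
    qed
    hence "filterlim (\<lambda>x. L (Ln x)) at_i_infinity (at 0)"
      by (simp add: filterlim_filtercomap_iff o_def)
    hence "(\<lambda>x. f (L (Ln x))) \<midarrow>0\<rightarrow> 0" by (rule filterlim_compose[OF lim])
    also have "?this \<longleftrightarrow> ?thesis"
      by (intro filterlim_cong) (auto simp: g_def eventually_at_filter)
    finally show ?thesis .
  qed
  have "g field_differentiable (at x0)" if x0: "x0 \<in> ball 0 1 - {0}" for x0
  proof -
    define U where "U = (\<lambda>x. x / x0) -` (- \<real>\<^sub>\<le>\<^sub>0) \<inter> (ball 0 1 - {0})"
    \<comment> \<open>\<open>Ln\<close> jumps across the negative axis, so differentiability at x0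
      is proved with the branch \<open>Ln (x / x0) + Ln x0\<close>, which is smooth near x0. By
      periodicity f does not see the choice of branch.\<close>
    define G where "G = (\<lambda>x. f (L (Ln (x / x0) + Ln x0)))"
    have "open ((\<lambda>x. x / x0) -` (- \<real>\<^sub>\<le>\<^sub>0))"
      using x0 by (intro open_vimage continuous_intros open_Compl closed_nonpos_Reals_complex) auto
    hence U: "open U" unfolding U_def by (intro open_Int open_delete open_ball)
    have exp: "exp (Ln (x / x0) + Ln x0) = x" if "x \<in> U" for x
      using that x0 by (auto simp: U_def exp_add)
    have "(f \<circ> (\<lambda>x. L (Ln (x / x0) + Ln x0))) holomorphic_on U"
    proof (rule holomorphic_on_compose_gen[OF _ holo])
      show "(\<lambda>x. L (Ln (x / x0) + Ln x0)) holomorphic_on U"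
        unfolding L_def using x0 by (intro holomorphic_intros) (auto simp: U_def)
      show "(\<lambda>x. L (Ln (x / x0) + Ln x0)) ` U \<subseteq> upper_half_plane"
        using exp by (auto simp: in_H_iff Im_L) (auto simp: U_def)
    qed
    hence "G holomorphic_on U" by (simp add: G_def o_def)
    hence "g holomorphic_on U"
    proof (rule holomorphic_transform)
      fix x assume x: "x \<in> U"
      hence "Im (L (Ln (x / x0) + Ln x0)) > 0" "Im (L (Ln x)) > 0" 
        using exp[OF x] by (auto simp: Im_L U_def)
      moreover have "qe (L (Ln (x / x0) + Ln x0) / of_real w) = qe (L (Ln x) / of_real w)"
        unfolding L_exp using exp[OF x] x by (auto simp: U_def)
      ultimately have "G x = f (L (Ln x))" unfolding G_def by (rule f_eq)
      thus "G x = g x" using x by (auto simp: g_def U_def)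
    qed
    moreover have "x0 \<in> U" using x0 by (auto simp: U_def)
    ultimately show ?thesis using U holomorphic_on_imp_differentiable_at by blast
  qed
  hence "g holomorphic_on (ball 0 1 - {0})" 
    unfolding holomorphic_on_def using field_differentiable_at_within by blast
  moreover have "(g \<longlongrightarrow> g z) (at z within ball 0 1)" if "z \<in> {0}" for z
    using tendsto_within_subset[OF lim_g subset_UNIV, of "ball 0 1"] that by simp
  ultimately have "g holomorphic_on ball 0 1"
    using no_isolated_singularity'[of "{0}" g "ball 0 1"] open_ball by blast
  thus ?thesis by (rule that) (use g_f in \<open>auto simp: g_def\<close>)
qed

lemma tendsto_qe_at_i_infinity:
  assumes "w > 0"
  shows "((\<lambda>z. qe (z / of_real w)) \<longlongrightarrow> 0) at_i_infinity"
proof -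
  have "((\<lambda>z. exp (- (2 * pi / w * Im z))) \<longlongrightarrow> 0) at_i_infinity"
  proof (rule filterlim_compose[OF exp_at_bot])
    have "filterlim (\<lambda>z. 2 * pi / w * Im z) at_top at_i_infinity"
      using assms by (intro filterlim_tendsto_pos_mult_at_top[OF tendsto_const] filterlim_Im_at_i_infinity) auto
    thus "LIM z at_i_infinity. - (2 * pi / w * Im z) :> at_bot"
      by (simp add: filterlim_uminus_at_bot)
  qed
  thus ?thesis using assms
    by (subst tendsto_norm_zero_iff[symmetric]) (simp add: mult_ac)
qed

lemma periodic_first_coeff:
  assumes holo: "f holomorphic_on upper_half_plane" and w: "w > 0"
  assumes per: "\<And>z. Im z > 0 \<Longrightarrow> f (z + of_real w) = f z"
  assumes lim: "(f \<longlongrightarrow> 0) at_i_infinity"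
  obtains a where "(\<lambda>z. f z - a * qe (z / of_real w)) \<in> O[at_i_infinity](\<lambda>z. qe (2 * (z / of_real w)))"
proof -
  obtain g where g: "g holomorphic_on ball 0 1" "g 0 = 0" "\<And>z. Im z > 0 \<Longrightarrow> f z = g (qe (z / of_real w))"
    using periodic_holomorphic_factor[OF assms] by blast
  \<comment> \<open>Two successive difference quotients at 0 give g(q) = g1(0) q + g2(q) q^2 with g2
    holomorphic, hence bounded near 0.\<close>
  define g1 where "g1 = (\<lambda>z. if z = 0 then deriv g 0 else (g z - g 0) / (z - 0))"
  define g2 where "g2 = (\<lambda>z. if z = 0 then deriv g1 0 else (g1 z - g1 0) / (z - 0))"
  have g1: "g1 holomorphic_on ball 0 1" unfolding g1_def by (intro pole_lemma_open g) auto
  have "g2 holomorphic_on ball 0 1" unfolding g2_def by (intro pole_lemma_open g1) auto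
  hence "isCont g2 0"
    using continuous_on_interior[of "ball 0 1" g2 0] by (simp add: holomorphic_on_imp_continuous_on)
  hence "((\<lambda>z. g2 (qe (z / of_real w))) \<longlongrightarrow> g2 0) at_i_infinity"
    by (intro isCont_tendsto_compose[of 0 g2] tendsto_qe_at_i_infinity w)
  hence *: "(\<lambda>z. g2 (qe (z / of_real w))) \<in> O[at_i_infinity](\<lambda>_. 1)"
    by (intro bigoI_tendsto) auto
  have eq: "f z - g1 0 * qe (z / of_real w) = g2 (qe (z / of_real w)) * qe (2 * (z / of_real w))"
    if "Im z > 0" for z
  proof -
    define q where "q = qe (z / of_real w)"
    have "q \<noteq> 0" by (simp add: q_def)
    have "g q - g1 0 * q = g2 q * (q * q)"
      using \<open>q \<noteq> 0\<close> g(2) by (simp add: g2_def g1_def field_simps)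
    moreover have "q * q = qe (2 * (z / of_real w))" 
      unfolding q_def exp_add[symmetric] by (rule arg_cong[of _ _ exp]) simp
    ultimately show ?thesis using g(3)[OF that] by (simp add: q_def)
  qed
  have "(\<lambda>z. g2 (qe (z / of_real w)) * qe (2 * (z / of_real w))) \<in> O[at_i_infinity](\<lambda>z. 1 * qe (2 * (z / of_real w)))"
    by (intro landau_o.big.mult *) auto
  also have "?this \<longleftrightarrow> (\<lambda>z. f z - g1 0 * qe (z / of_real w)) \<in> O[at_i_infinity](\<lambda>z. 1 * qe (2 * (z / of_real w)))"
    by (intro landau_o.big.in_cong eventually_mono[OF eventually_Im_gt[of 0]] eq[symmetric])
  finally show ?thesis using that[of "g1 0"] by simp
qed

lemma bigo_qe_mono:
  assumes "s \<le> t"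
  shows "(\<lambda>z. qe (of_real t * z)) \<in> O[at_i_infinity](\<lambda>z. qe (of_real s * z))"
proof (rule bigoI[of _ 1], rule eventually_mono[OF eventually_Im_gt[of 0]])
  fix z assume "Im z > 0"
  thus "norm (qe (of_real t * z)) \<le> 1 * norm (qe (of_real s * z))"
    using assms by simp
qed

text \<open>A periodic holomorphic function that merely tends to 0 already decays like its local
  parameter. This is the unit of vanishing order contributed by a cusp of width w; measured in the
  parameter of level one it is 1/w.\<close>

lemma periodic_vanishing_bigo:
  assumes "f holomorphic_on upper_half_plane" and w: "w > 0"
  assumes "\<And>z. Im z > 0 \<Longrightarrow> f (z + of_real w) = f z"
  assumes "(f \<longlongrightarrow> 0) at_i_infinity"
  shows "f \<in> O[at_i_infinity](\<lambda>z. qe (of_real (1 / w) * z))"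
proof -
  obtain a where a: "(\<lambda>z. f z - a * qe (z / of_real w)) \<in> O[at_i_infinity](\<lambda>z. qe (2 * (z / of_real w)))"
    using periodic_first_coeff[OF assms] by blast
  also have "(\<lambda>z. qe (2 * (z / of_real w))) = (\<lambda>z. qe (of_real (2 / w) * z))"
    using w by (intro ext arg_cong[of _ _ exp]) (simp add: field_simps)
  also have "(\<lambda>z. qe (of_real (2 / w) * z)) \<in> O[at_i_infinity](\<lambda>z. qe (of_real (1 / w) * z))"
    using w by (intro bigo_qe_mono) (simp add: divide_simps)
  finally have "(\<lambda>z. (f z - a * qe (z / of_real w)) + a * qe (z / of_real w)) \<in> O[at_i_infinity](\<lambda>z. qe (of_real (1 / w) * z))"
    by (rule sum_in_bigo) simp
  thus ?thesis by simp
qed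

section \<open>Cusp forms and Hecke operators\<close>

definition cusp_fun :: "nat \<Rightarrow> nat \<Rightarrow> (complex \<Rightarrow> complex) \<Rightarrow> bool" where
  "cusp_fun k N f \<longleftrightarrow> f holomorphic_on upper_half_plane \<and> Gamma0_invariant k N f \<and> vanishes_at_cusps k f"

text \<open>Conjugating the translation by w with \<gamma> gives a unimodular matrix with lower left
  entry - w c^2, an element of \<open>Gamma0 N\<close> as soon as N divides w c^2.\<close>

lemma slash_width_periodic:
  assumes inv: "Gamma0_invariant k N f" and SL: "(a, b, c, d) \<in> SL2Z"
    and w: "int N dvd w * c ^ 2" and z: "Im z > 0"
  shows "slash k (a, b, c, d) f (z + of_int w) = slash k (a, b, c, d) f z"
proof -
  define \<gamma> where "\<gamma> = (a, b, c, d)"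
  define T where "T = (1 :: int, w, 0 :: int, 1 :: int)"
  define \<delta> where "\<delta> = imat_mult (imat_mult \<gamma> T) (imat_adj \<gamma>)"
  have T: "T \<in> SL2Z" by (simp add: T_def SL2Z_iff)
  have \<gamma>: "\<gamma> \<in> SL2Z" using SL by (simp add: \<gamma>_def)
  have \<delta>: "\<delta> \<in> SL2Z" unfolding \<delta>_def by (intro SL2Z_mult SL2Z_adj T \<gamma>)
  have "\<delta> = (1 - w * a * c, w * a ^ 2, - (w * c ^ 2), 1 + w * a * c)"
    using SL by (simp add: \<delta>_def \<gamma>_def T_def SL2Z_iff algebra_simps power2_eq_square)
  with \<delta> w have "\<delta> \<in> Gamma0 N" by (simp add: Gamma0_iff SL2Z_iff)
  hence *: "slash k \<delta> f z = f z" if "Im z > 0" for z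
    using inv that by (simp add: Gamma0_invariant_def in_H_iff)
  have "imat_mult \<delta> \<gamma> = imat_mult \<gamma> T"
    using \<gamma> by (simp add: \<delta>_def imat_mult_assoc imat_mult_adj SL2Z_iff)
  hence "slash k (imat_mult \<gamma> T) f z = slash k \<gamma> (slash k \<delta> f) z"
    using z \<gamma> \<delta> slash_mult[of z \<gamma> \<delta> k f] by (simp add: SL2Z_iff)
  also have "\<dots> = slash k \<gamma> f z" using z \<gamma> * by (intro slash_cong_H) (auto simp: SL2Z_iff)
  finally have "slash k T (slash k \<gamma> f) z = slash k \<gamma> f z"
    using slash_mult[of z T \<gamma> k f] z \<gamma> T by (simp add: SL2Z_iff)
  thus ?thesis by (simp add: slash_altdef[of k "(1, w, 0, 1)"] T_def \<gamma>_def del: slash_one)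
qed

lemma dvd_width:
  assumes "N > 0"
  shows "int N dvd (int N div gcd (c ^ 2) (int N)) * c ^ 2"
proof -
  have "(int N div gcd (c ^ 2) (int N)) * c ^ 2 = int N * (c ^ 2 div gcd (c ^ 2) (int N))"
    by (metis div_mult_swap dvd_div_mult gcd_dvd1 gcd_dvd2)
  thus ?thesis by simp
qed

text \<open>The exponent is the reciprocal of the width N / gcd(c^2, N) of the cusp a / c. It is
  written through c mod N because \<open>Gamma0_vanishing\<close> takes exponents that depend only
  on the row modulo N.\<close>

lemma cusp_fun_bigo:
  assumes N: "N > 0" and f: "cusp_fun k N f" and SL: "(a, b, c, d) \<in> SL2Z"
  shows "slash k (a, b, c, d) f \<in> O[at_i_infinity](\<lambda>z. qe (of_real (of_int (gcd ((c mod int N) ^ 2) (int N)) / of_nat N) * z))"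
proof -
  define w where "w = int N div gcd (c ^ 2) (int N)"
  have "w > 0" using N unfolding w_def by (simp add: pos_imp_zdiv_pos_iff zdvd_imp_le)
  have gw: "gcd (c ^ 2) (int N) * w = int N" by (simp add: w_def)
  have "slash k (a, b, c, d) f \<in> O[at_i_infinity](\<lambda>z. qe (of_real (1 / of_int w) * z))"
  proof (rule periodic_vanishing_bigo)
    show "slash k (a, b, c, d) f holomorphic_on upper_half_plane"
      using SL f by (intro holomorphic_slash) (auto simp: SL2Z_iff cusp_fun_def)
    show "(slash k (a, b, c, d) f \<longlongrightarrow> 0) at_i_infinity"
      using SL f by (auto simp: cusp_fun_def vanishes_at_cusps_def)
    show "slash k (a, b, c, d) f (z + of_real (real_of_int w)) = slash k (a, b, c, d) f z" if "Im z > 0" for z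
      using slash_width_periodic[of k N f a b c d w z] f SL that dvd_width[OF N]
      by (simp add: cusp_fun_def w_def)
  qed (use \<open>w > 0\<close> in auto)
  also have "1 / real_of_int w = of_int (gcd (c ^ 2) (int N)) / of_nat N"
  proof -
    have "real_of_int (gcd (c ^ 2) (int N)) * of_int w = real N"
      using arg_cong[OF gw, of real_of_int] by simp
    thus ?thesis using N \<open>w > 0\<close> by (simp add: field_simps)
  qed
  also have "gcd (c ^ 2) (int N) = gcd ((c mod int N) ^ 2) (int N)"
  proof -
    have *: "gcd (x mod int N) (int N) = gcd x (int N)" for x
      using N by (simp add: gcd_mod_left)
    show ?thesis using *[of "c ^ 2"] *[of "(c mod int N) ^ 2"] by (simp add: power_mod)
  qed
  finally show ?thesis .
qed

text \<open>The numerical hypotheses are stated over the integers, multiplied by 10 N, so that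
  evaluation can decide them. This brings them back to the form of Sturm's bound.\<close>

lemma divide_10_less_aux:
  fixes K N S T :: real
  shows "10 * S > K * N \<Longrightarrow> T = S / N \<Longrightarrow> N > 0 \<Longrightarrow> K / 10 < T"
  by (simp add: less_divide_eq mult.commute)

text \<open>A cusp of width w is met by w cosets of \<open>Gamma0 N\<close>, so the reciprocal
  widths add up to the number of cusps, times \<phi>(N) for the repeated rows. The same factor
  \<phi>(N) is contained in the number of rows, so the hypothesis says that the number of cusps
  exceeds weight times index over 10.\<close>

theorem cusp_fun_eq_0:
  assumes N: "N > 0" and f: "cusp_fun k N f"
    and "10 * (\<Sum>(c, d)\<in>bottom_rows N. gcd (c ^ 2) (int N)) > int (k * N * card (bottom_rows N))"
    and z: "Im z > 0"
  shows "f z = 0"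
proof (rule Gamma0_vanishing[where k = k and N = N and f = f and z = z and t = "\<lambda>c. of_int (gcd (c ^ 2) (int N)) / of_nat N"])
  have "real_of_int (10 * (\<Sum>(c, d)\<in>bottom_rows N. gcd (c ^ 2) (int N))) > real_of_int (int (k * N * card (bottom_rows N)))"
    using assms(3) unfolding of_int_less_iff .
  hence "10 * real_of_int (\<Sum>(c, d)\<in>bottom_rows N. gcd (c ^ 2) (int N)) > real (k * card (bottom_rows N)) * real N"
    by (simp add: mult_ac)
  moreover have "(\<Sum>(c, d)\<in>bottom_rows N. of_int (gcd (c ^ 2) (int N)) / of_nat N) = 
      real_of_int (\<Sum>(c, d)\<in>bottom_rows N. gcd (c ^ 2) (int N)) / real N"
    by (simp add: case_prod_unfold sum_divide_distrib)
  ultimately show "real (k * card (bottom_rows N)) / 10 < (\<Sum>(c, d)\<in>bottom_rows N. of_int (gcd (c ^ 2) (int N)) / of_nat N)"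
    using of_nat_0_less_iff[THEN iffD2, OF N] by (rule divide_10_less_aux)
  show "slash k (a, b, c, d) f \<in> O[at_i_infinity](\<lambda>z. qe (of_real (of_int (gcd ((c mod int N) ^ 2) (int N)) / of_nat N) * z))"
    if "(a, b, c, d) \<in> SL2Z" for a b c d by (rule cusp_fun_bigo[OF N f that])
qed (use assms in \<open>auto simp: cusp_fun_def\<close>)

lemma slash_lin:
  "slash k \<gamma> (\<lambda>z. a * f z + b * g z) = (\<lambda>z. a * slash k \<gamma> f z + b * slash k \<gamma> g z)"
  by (rule ext) (simp add: slash_altdef algebra_simps add_divide_distrib)

lemma slash_sum:
  "slash k \<gamma> (\<lambda>z. \<Sum>i\<in>A. f i z) z = (\<Sum>i\<in>A. slash k \<gamma> (f i) z)"
  by (simp add: slash_altdef sum_distrib_left)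

lemma Gamma0_invariant_lin:
  "Gamma0_invariant k N f \<Longrightarrow> Gamma0_invariant k N g \<Longrightarrow> Gamma0_invariant k N (\<lambda>z. a * f z + b * g z)"
  by (simp add: Gamma0_invariant_def slash_lin)

lemma cusp_fun_lin:
  assumes "cusp_fun k N f" "cusp_fun k N g"
  shows "cusp_fun k N (\<lambda>z. a * f z + b * g z)"
proof -
  have "(slash k \<gamma> (\<lambda>z. a * f z + b * g z) \<longlongrightarrow> 0) at_i_infinity" if "\<gamma> \<in> SL2Z" for \<gamma>
  proof -
    have "((\<lambda>z. a * slash k \<gamma> f z + b * slash k \<gamma> g z) \<longlongrightarrow> a * 0 + b * 0) at_i_infinity"
      using assms that by (intro tendsto_intros) (auto simp: cusp_fun_def vanishes_at_cusps_def)
    thus ?thesis by (simp add: slash_lin)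
  qed
  thus ?thesis using assms 
    by (auto simp: cusp_fun_def vanishes_at_cusps_def intro!: Gamma0_invariant_lin holomorphic_intros)
qed

text \<open>Subtracting the right multiple of g cancels the coefficient of q. The difference then
  vanishes at infinity to order 2 instead of 1, which is the extra summand on the rows with c =
  0.\<close>

theorem cusp_fun_one_dim:
  assumes N: "N > 0" and f: "cusp_fun k N f" and g: "cusp_fun k N g"
    and g1: "(\<lambda>z. g z - qe z) \<in> O[at_i_infinity](\<lambda>z. qe (2 * z))"
    and ord: "10 * (\<Sum>(c, d)\<in>bottom_rows N. gcd (c ^ 2) (int N) + (if c = 0 then int N else 0)) > int (k * N * card (bottom_rows N))"
  obtains a where "\<And>z. Im z > 0 \<Longrightarrow> f z = a * g z"
proof -
  have one: "(1, 0, 0, 1) \<in> SL2Z" by (simp add: SL2Z_iff)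
  have slash_one': "slash k (1, 0, 0, 1) h = h" for h by (rule ext) simp
  have f': "f holomorphic_on upper_half_plane" "(f \<longlongrightarrow> 0) at_i_infinity"
    using f one slash_one'[of f] by (force simp: cusp_fun_def vanishes_at_cusps_def)+
  have per: "f (z + of_real 1) = f z" if "Im z > 0" for z
    using slash_width_periodic[of k N f 1 0 0 1 1 z] f that by (simp add: cusp_fun_def SL2Z_iff)
  obtain a where a: "(\<lambda>z. f z - a * qe (z / of_real 1)) \<in> O[at_i_infinity](\<lambda>z. qe (2 * (z / of_real 1)))"
    using periodic_first_coeff[OF f'(1) zero_less_one per f'(2)] by blast
  define h where "h = (\<lambda>z. 1 * f z + (-a) * g z)"
  have h: "cusp_fun k N h" unfolding h_def by (intro cusp_fun_lin f g)
  have "(\<lambda>z. a * (g z - qe z)) \<in> O[at_i_infinity](\<lambda>z. qe (2 * z))"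
    using g1 by (cases "a = 0") simp_all
  with a have "(\<lambda>z. (f z - a * qe z) - a * (g z - qe z)) \<in> O[at_i_infinity](\<lambda>z. qe (2 * z))"
    unfolding of_real_1 div_by_1 by (rule sum_in_bigo(2))
  also have "(\<lambda>z. (f z - a * qe z) - a * (g z - qe z)) = h" by (auto simp: h_def algebra_simps)
  finally have h2: "h \<in> O[at_i_infinity](\<lambda>z. qe (2 * z))" .
  define t where "t = (\<lambda>c. of_int (gcd (c ^ 2) (int N) + (if c = 0 then int N else 0)) / real N)"
  have "h z = 0" if "Im z > 0" for z
  proof (rule Gamma0_vanishing[where k = k and N = N and f = h and z = z and t = t])
    have "real_of_int (10 * (\<Sum>(c, d)\<in>bottom_rows N. gcd (c ^ 2) (int N) + (if c = 0 then int N else 0))) > real_of_int (int (k * N * card (bottom_rows N)))"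
      using ord unfolding of_int_less_iff .
    hence "10 * real_of_int (\<Sum>(c, d)\<in>bottom_rows N. gcd (c ^ 2) (int N) + (if c = 0 then int N else 0)) > real (k * card (bottom_rows N)) * real N"
      by (simp only: of_int_mult of_int_of_nat_eq of_nat_mult mult_ac of_int_numeral)
    moreover have "(\<Sum>(c, d)\<in>bottom_rows N. t c) = 
        real_of_int (\<Sum>(c, d)\<in>bottom_rows N. gcd (c ^ 2) (int N) + (if c = 0 then int N else 0)) / real N"
      by (simp add: case_prod_unfold sum_divide_distrib t_def del: of_int_add)
    ultimately show "real (k * card (bottom_rows N)) / 10 < (\<Sum>(c, d)\<in>bottom_rows N. t c)"
      using of_nat_0_less_iff[THEN iffD2, OF N] by (rule divide_10_less_aux)
    show "slash k (a, b, c, d) h \<in> O[at_i_infinity](\<lambda>z. qe (of_real (t (c mod int N)) * z))"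
      if SL: "(a, b, c, d) \<in> SL2Z" for a b c d
    proof (cases "c mod int N = 0")
      case False
      thus ?thesis using cusp_fun_bigo[OF N h SL] by (simp add: t_def)
    next
      case True
      hence "(a, b, c, d) \<in> Gamma0 N" using SL by (auto simp: Gamma0_iff SL2Z_iff)
      hence eq: "slash k (a, b, c, d) h z = h z" if "Im z > 0" for z
        using h that by (auto simp: cusp_fun_def Gamma0_invariant_def in_H_iff)
      \<comment> \<open>The cusp at infinity has width 1, so gcd(0, N) / N = 1, and the cancelled
        coefficient of q adds another 1.\<close>
      have "t (c mod int N) = 2" using True N by (simp add: t_def)
      hence "h \<in> O[at_i_infinity](\<lambda>z. qe (of_real (t (c mod int N)) * z))" using h2 by simp
      also have "?this \<longleftrightarrow> ?thesis"
        by (intro landau_o.big.in_cong eventually_mono[OF eventually_Im_gt[of 0]]) (simp add: eq)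
      finally show ?thesis .
    qed
  qed (use N h that in \<open>auto simp: cusp_fun_def\<close>)
  thus ?thesis using that[of a] by (simp add: h_def)
qed

text \<open>The version for forms that need not be cuspidal: finite limits give order 0 on all rows
  other than c = 0, so the order m at infinity alone has to exceed the bound. It turns the
  comparison of finitely many coefficients into an identity of forms.\<close>

theorem modular_fun_eq_0:
  assumes N: "N > 0" and holo: "f holomorphic_on upper_half_plane" and inv: "Gamma0_invariant k N f"
    and lim: "\<And>\<gamma>. \<gamma> \<in> SL2Z \<Longrightarrow> \<exists>L. (slash k \<gamma> f \<longlongrightarrow> L) at_i_infinity"
    and bigo: "f \<in> O[at_i_infinity](\<lambda>z. qe (of_nat m * z))"
    and ord: "10 * (\<Sum>(c, d)\<in>bottom_rows N. if c = 0 then int m else 0) > int (k * card (bottom_rows N))"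
    and z: "Im z > 0"
  shows "f z = 0"
proof (rule Gamma0_vanishing[where k = k and N = N and f = f and z = z and t = "\<lambda>c. of_int (if c = 0 then int m else 0)"])
  have "real_of_int (10 * (\<Sum>(c, d)\<in>bottom_rows N. if c = 0 then int m else 0)) > real_of_int (int (k * card (bottom_rows N)))"
    using ord unfolding of_int_less_iff .
  moreover have "(\<Sum>(c, d)\<in>bottom_rows N. of_int (if c = 0 then int m else 0)) = 
      real_of_int (\<Sum>(c, d)\<in>bottom_rows N. if c = 0 then int m else 0)"
    by (simp add: case_prod_unfold)
  ultimately show "real (k * card (bottom_rows N)) / 10 < (\<Sum>(c, d)\<in>bottom_rows N. of_int (if c = 0 then int m else 0))"
    by simp
  show "slash k (a, b, c, d) f \<in> O[at_i_infinity](\<lambda>z. qe (of_real (of_int (if c mod int N = 0 then int m else 0)) * z))"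
    if SL: "(a, b, c, d) \<in> SL2Z" for a b c d
  proof (cases "c mod int N = 0")
    case False
    obtain L where "(slash k (a, b, c, d) f \<longlongrightarrow> L) at_i_infinity" using lim[OF SL] by blast
    hence "slash k (a, b, c, d) f \<in> O[at_i_infinity](\<lambda>_. 1)" by (intro bigoI_tendsto) auto
    thus ?thesis using False by simp
  next
    case True
    hence "(a, b, c, d) \<in> Gamma0 N" using SL by (auto simp: Gamma0_iff SL2Z_iff)
    hence eq: "slash k (a, b, c, d) f z = f z" if "Im z > 0" for z
      using inv that by (auto simp: Gamma0_invariant_def in_H_iff)
    have "f \<in> O[at_i_infinity](\<lambda>z. qe (of_real (of_int (if c mod int N = 0 then int m else 0)) * z))"
      using bigo True by simp
    also have "?this \<longleftrightarrow> ?thesis"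
      by (intro landau_o.big.in_cong eventually_mono[OF eventually_Im_gt[of 0]]) (simp add: eq)
    finally show ?thesis .
  qed
qed (use N holo inv z in auto)

section \<open>Hecke operators preserve cusp forms\<close>

definition hecke_reps :: "nat \<Rightarrow> nat \<Rightarrow> imat set" where
  "hecke_reps N n = {(a, b, 0, d) | a b d. a > 0 \<and> a * d = int n \<and> coprime a (int N) \<and> 0 \<le> b \<and> b < d}"

lemma hecke_altdef: "hecke k N n f = (\<lambda>z. \<Sum>\<gamma>\<in>hecke_reps N n. slash k \<gamma> f z)"
  by (simp add: hecke_def hecke_reps_def fun_eq_iff)

lemma hecke_reps_det: "\<alpha> \<in> hecke_reps N n \<Longrightarrow> imat_det \<alpha> = int n"
  by (auto simp: hecke_reps_def)

lemma finite_hecke_reps: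
  assumes "n > 0"
  shows "finite (hecke_reps N n)"
proof (rule finite_subset)
  show "hecke_reps N n \<subseteq> (\<lambda>(a, b, d). (a, b, 0, d)) ` ({0..int n} \<times> {0..int n} \<times> {0..int n})"
  proof
    fix \<alpha> assume "\<alpha> \<in> hecke_reps N n"
    then obtain a b d where *: "\<alpha> = (a, b, 0, d)" "a > 0" "a * d = int n" "0 \<le> b" "b < d"
      by (auto simp: hecke_reps_def)
    have "a dvd int n" "d dvd int n" using *(3) by (metis dvd_triv_left, metis dvd_triv_right)
    hence "a \<le> int n" "d \<le> int n" using assms by (auto intro!: zdvd_imp_le)
    thus "\<alpha> \<in> (\<lambda>(a, b, d). (a, b, 0, d)) ` ({0..int n} \<times> {0..int n} \<times> {0..int n})"
      using * by (auto intro!: image_eqI[of _ _ "(a, b, d)"])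
  qed
qed auto

text \<open>Take the Hermite normal form. Its g = gcd a c divides a and so is coprime to N; hence N
  divides c / g and the unimodular factor lies in \<open>Gamma0 N\<close>. A translation then brings
  the upper right entry into the range from 0 to D - 1.\<close>

lemma hecke_reps_decompose:
  assumes "a * d - b * c = int n" "n > 0" "int N dvd c" "coprime a (int N)"
  obtains \<delta> \<alpha> where "\<delta> \<in> Gamma0 N" "\<alpha> \<in> hecke_reps N n" "(a, b, c, d) = imat_mult \<delta> \<alpha>"
proof -
  define g where "g = gcd a c"
  have det: "imat_det (a, b, c, d) = int n" using assms by simp
  have det_pos: "imat_det (a, b, c, d) > 0" using assms by simp
  obtain x y B where *: "(a div g, x, c div g, y) \<in> SL2Z"
    "(a, b, c, d) = imat_mult (a div g, x, c div g, y) (g, B, 0, int n div g)" "g dvd int n"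
    by (rule imat_upper_triangular[OF det_pos, unfolded det, folded g_def])
  have g: "g > 0" using assms unfolding g_def by (auto simp: gcd_pos_int)
  define D where "D = int n div g"
  have D: "D > 0" using assms(2) g *(3) unfolding D_def by (simp add: pos_imp_zdiv_pos_iff zdvd_imp_le)
  have gN: "coprime g (int N)"
    using assms(4) unfolding g_def by (meson coprime_divisors dvd_refl gcd_dvd1)
  have "int N dvd g * (c div g)" using assms(3) by (simp add: g_def)
  hence "int N dvd c div g" using gN by (simp add: coprime_commute coprime_dvd_mult_right_iff)
  hence \<delta>: "(a div g, x, c div g, y) \<in> Gamma0 N" using *(1) by (simp add: Gamma0_iff SL2Z_iff)
  define \<alpha> where "\<alpha> = (g, B mod D, 0 :: int, D)"
  define t where "t = B div D"
  have "(g, B, 0, D) = imat_mult (1, t, 0, 1) \<alpha>" by (simp add: \<alpha>_def t_def mult.commute)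
  hence "(a, b, c, d) = imat_mult (imat_mult (a div g, x, c div g, y) (1, t, 0, 1)) \<alpha>"
    using *(2) by (simp only: D_def imat_mult_assoc)
  moreover have "imat_mult (a div g, x, c div g, y) (1, t, 0, 1) \<in> Gamma0 N"
    by (intro Gamma0_mult \<delta>) (simp add: Gamma0_iff)
  moreover have "\<alpha> \<in> hecke_reps N n"
    using g D gN *(3) by (auto simp: hecke_reps_def \<alpha>_def D_def)
  ultimately show ?thesis using that by blast
qed

text \<open>Comparing entries shows that \<open>\<delta>\<close> is upper triangular with diagonal
  1, a translation, and the range prescribed for b leaves only the identity. This makes the map on
  representatives below injective.\<close>

lemma hecke_reps_unique:
  assumes "\<alpha> \<in> hecke_reps N n" "\<beta> \<in> hecke_reps N n" "\<delta> \<in> SL2Z" "\<alpha> = imat_mult \<delta> \<beta>"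
  shows "\<alpha> = \<beta>"
proof -
  obtain a b d where \<alpha>: "\<alpha> = (a, b, 0, d)" "a > 0" "0 \<le> b" "b < d" using assms(1) by (auto simp: hecke_reps_def)
  obtain a' b' d' where \<beta>: "\<beta> = (a', b', 0, d')" "a' > 0" "0 \<le> b'" "b' < d'" using assms(2) by (auto simp: hecke_reps_def)
  obtain p q r s where \<delta>: "\<delta> = (p, q, r, s)" by (cases \<delta>)
  have eqs: "a = p * a'" "b = p * b' + q * d'" "r * a' = 0" "d = r * b' + s * d'"
    using assms(4) by (auto simp: \<alpha>(1) \<beta>(1) \<delta>)
  have r: "r = 0" using eqs(3) \<beta> by simp
  hence ps: "p * s = 1" using assms(3) by (simp add: SL2Z_iff \<delta>)
  have "p > 0" using eqs(1) \<alpha>(2) \<beta>(2) by (simp add: zero_less_mult_iff)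
  hence "p = 1" "s = 1" using ps by (auto simp: zmult_eq_1_iff)
  hence "b = b' + q * d'" "d = d'" using eqs r by auto
  moreover from this have "b mod d' = b' mod d'" by simp
  hence "b = b'" using \<alpha> \<beta> \<open>d = d'\<close> by simp
  ultimately show ?thesis using \<alpha>(1) \<beta>(1) eqs(1) \<open>p = 1\<close> by simp
qed

text \<open>Right multiplication by \<open>\<gamma>\<close> sends each representative to a
  \<open>Gamma0 N\<close>-multiple of another one and so permutes the summands; invariance of f
  absorbs the multipliers.\<close>

lemma Gamma0_invariant_hecke:
  assumes inv: "Gamma0_invariant k N f" and n: "n > 0"
  shows "Gamma0_invariant k N (hecke k N n f)"
  unfolding Gamma0_invariant_def
proof (intro ballI)
  fix \<gamma> z assume \<gamma>: "\<gamma> \<in> Gamma0 N" and "z \<in> upper_half_plane"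
  hence z: "Im z > 0" by (simp add: in_H_iff)
  have \<gamma>': "\<gamma> \<in> SL2Z" using \<gamma> Gamma0_subset_SL2Z by blast
  have "\<exists>\<delta> \<beta>. \<delta> \<in> Gamma0 N \<and> \<beta> \<in> hecke_reps N n \<and> imat_mult \<alpha> \<gamma> = imat_mult \<delta> \<beta>" 
    if \<alpha>: "\<alpha> \<in> hecke_reps N n" for \<alpha>
  proof -
    obtain a b d where abd: "\<alpha> = (a, b, 0, d)" "coprime a (int N)" using \<alpha> by (auto simp: hecke_reps_def)
    obtain p q r s where pqrs: "\<gamma> = (p, q, r, s)" by (cases \<gamma>)
    have "p * s - q * r = 1" "int N dvd r" using \<gamma> by (auto simp: pqrs Gamma0_iff)
    have cop: "coprime p (int N)"
    proof (rule coprimeI)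
      fix x assume "x dvd p" "x dvd int N"
      hence "x dvd p * s - q * r" using \<open>int N dvd r\<close> by (meson dvd_diff dvd_mult dvd_mult2 dvd_trans)
      thus "is_unit x" using \<open>p * s - q * r = 1\<close> by simp
    qed
    have "coprime (a * p + b * r) (int N)"
    proof (rule coprimeI)
      fix x assume x: "x dvd a * p + b * r" "x dvd int N"
      hence "x dvd b * r" using \<open>int N dvd r\<close> by (meson dvd_mult dvd_trans)
      hence "x dvd a * p" using x(1) by (simp add: dvd_add_left_iff)
      moreover have "coprime (a * p) (int N)" using cop abd(2) by simp
      ultimately show "is_unit x" using x(2) by (meson coprime_common_divisor)
    qed
    moreover have "imat_det (imat_mult \<alpha> \<gamma>) = int n"
      using hecke_reps_det[OF \<alpha>] \<gamma>' by (simp add: imat_det_mult SL2Z_iff)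
    ultimately show ?thesis
      using hecke_reps_decompose[of "a * p + b * r" "d * s" "a * q + b * s" "d * r" n N] n \<open>int N dvd r\<close>
      unfolding abd(1) pqrs by auto metis
  qed
  then obtain \<delta> act where act: "\<And>\<alpha>. \<alpha> \<in> hecke_reps N n \<Longrightarrow> \<delta> \<alpha> \<in> Gamma0 N"
    "\<And>\<alpha>. \<alpha> \<in> hecke_reps N n \<Longrightarrow> act \<alpha> \<in> hecke_reps N n"
    "\<And>\<alpha>. \<alpha> \<in> hecke_reps N n \<Longrightarrow> imat_mult \<alpha> \<gamma> = imat_mult (\<delta> \<alpha>) (act \<alpha>)"
    by metis
  have act_SL: "\<delta> \<alpha> \<in> SL2Z" if "\<alpha> \<in> hecke_reps N n" for \<alpha>
    using act(1)[OF that] Gamma0_subset_SL2Z by blast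
  have "inj_on act (hecke_reps N n)"
  proof (rule inj_onI)
    fix \<alpha> \<beta> assume *: "\<alpha> \<in> hecke_reps N n" "\<beta> \<in> hecke_reps N n" "act \<alpha> = act \<beta>"
    have eq: "\<alpha> = imat_mult (\<delta> \<alpha>) (imat_mult (act \<alpha>) (imat_adj \<gamma>))" if "\<alpha> \<in> hecke_reps N n" for \<alpha>
    proof -
      have "\<alpha> = imat_mult (imat_mult \<alpha> \<gamma>) (imat_adj \<gamma>)"
        using \<gamma>' by (simp add: imat_mult_assoc imat_mult_adj SL2Z_iff)
      thus ?thesis using act(3)[OF that] by (simp add: imat_mult_assoc)
    qed
    have "imat_mult (act \<beta>) (imat_adj \<gamma>) = imat_mult (imat_adj (\<delta> \<beta>)) \<beta>"
      using eq[OF *(2)] act_SL[OF *(2)]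
      by (metis imat_mult_assoc imat_mult_adj(2) imat_mult_one(1) SL2Z_iff)
    hence "imat_mult (\<delta> \<alpha>) (imat_mult (act \<alpha>) (imat_adj \<gamma>)) = imat_mult (imat_mult (\<delta> \<alpha>) (imat_adj (\<delta> \<beta>))) \<beta>"
      by (simp add: imat_mult_assoc *(3))
    hence "\<alpha> = imat_mult (imat_mult (\<delta> \<alpha>) (imat_adj (\<delta> \<beta>))) \<beta>"
      using eq[OF *(1)] by (rule trans[rotated])
    moreover have "imat_mult (\<delta> \<alpha>) (imat_adj (\<delta> \<beta>)) \<in> SL2Z"
      by (intro SL2Z_mult SL2Z_adj act_SL *)
    ultimately show "\<alpha> = \<beta>" using hecke_reps_unique[OF *(1,2)] by blast
  qed
  hence bij: "bij_betw act (hecke_reps N n) (hecke_reps N n)"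
    using act(2) finite_hecke_reps[OF n] by (simp add: bij_betw_def endo_inj_surj image_subsetI)
  have "slash k \<gamma> (hecke k N n f) z = (\<Sum>\<alpha>\<in>hecke_reps N n. slash k \<gamma> (slash k \<alpha> f) z)"
    by (simp add: hecke_altdef slash_sum)
  also have "\<dots> = (\<Sum>\<alpha>\<in>hecke_reps N n. slash k (act \<alpha>) f z)"
  proof (rule sum.cong[OF refl])
    fix \<alpha> assume \<alpha>: "\<alpha> \<in> hecke_reps N n"
    have "slash k \<gamma> (slash k \<alpha> f) z = slash k (imat_mult \<alpha> \<gamma>) f z"
      using \<gamma>' z hecke_reps_det[OF \<alpha>] n by (subst slash_mult) (auto simp: SL2Z_iff)
    also have "\<dots> = slash k (act \<alpha>) (slash k (\<delta> \<alpha>) f) z"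
      using act_SL[OF \<alpha>] hecke_reps_det[OF act(2)[OF \<alpha>]] z n
      by (subst act(3)[OF \<alpha>], subst slash_mult) (auto simp: SL2Z_iff)
    also have "\<dots> = slash k (act \<alpha>) f z"
      using inv act(1)[OF \<alpha>] hecke_reps_det[OF act(2)[OF \<alpha>]] z n
      by (intro slash_cong_H) (auto simp: Gamma0_invariant_def in_H_iff)
    finally show "slash k \<gamma> (slash k \<alpha> f) z = slash k (act \<alpha>) f z" .
  qed
  also have "\<dots> = (\<Sum>\<alpha>\<in>hecke_reps N n. slash k \<alpha> f z)" by (rule sum.reindex_bij_betw[OF bij])
  finally show "slash k \<gamma> (hecke k N n f) z = hecke k N n f z" by (simp add: hecke_altdef)
qed

text \<open>For the cusps: \<open>imat_mult \<alpha> \<gamma>\<close> has determinant n > 0, so each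
  summand tends to 0 by \<open>tendsto_slash_det_pos\<close> with all cusp values 0.\<close>

lemma cusp_fun_hecke:
  assumes f: "cusp_fun k N f" and n: "n > 0"
  shows "cusp_fun k N (hecke k N n f)"
  unfolding cusp_fun_def
proof (intro conjI)
  show "hecke k N n f holomorphic_on upper_half_plane"
    unfolding hecke_altdef using f n
    by (intro holomorphic_on_sum holomorphic_slash) (auto simp: cusp_fun_def hecke_reps_det)
  show "Gamma0_invariant k N (hecke k N n f)"
    using f n by (intro Gamma0_invariant_hecke) (auto simp: cusp_fun_def)
  show "vanishes_at_cusps k (hecke k N n f)"
    unfolding vanishes_at_cusps_def
  proof
    fix \<gamma> assume \<gamma>: "\<gamma> \<in> SL2Z"
    have "((\<lambda>z. \<Sum>\<alpha>\<in>hecke_reps N n. slash k (imat_mult \<alpha> \<gamma>) f z) \<longlongrightarrow> (\<Sum>\<alpha>\<in>hecke_reps N n. 0)) at_i_infinity"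
    proof (intro tendsto_sum)
      fix \<alpha> assume "\<alpha> \<in> hecke_reps N n"
      hence det: "imat_det (imat_mult \<alpha> \<gamma>) > 0" using \<gamma> n by (simp add: imat_det_mult hecke_reps_det SL2Z_iff)
      obtain a b c d where eq: "imat_mult \<alpha> \<gamma> = (a, b, c, d)" by (cases "imat_mult \<alpha> \<gamma>")
      show "(slash k (imat_mult \<alpha> \<gamma>) f \<longlongrightarrow> 0) at_i_infinity"
        using tendsto_slash_det_pos[of k f "\<lambda>_ _. 0" a b c d] f det
        unfolding eq by (simp add: cusp_fun_def vanishes_at_cusps_def)
    qed
    also have "?this \<longleftrightarrow> (slash k \<gamma> (hecke k N n f) \<longlongrightarrow> (\<Sum>\<alpha>\<in>hecke_reps N n. 0)) at_i_infinity"
    proof (intro filterlim_cong refl eventually_mono[OF eventually_Im_gt[of 0]])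
      fix z assume "Im z > 0"
      thus "(\<Sum>\<alpha>\<in>hecke_reps N n. slash k (imat_mult \<alpha> \<gamma>) f z) = slash k \<gamma> (hecke k N n f) z"
        using \<gamma> n by (simp add: hecke_altdef slash_sum slash_mult hecke_reps_det SL2Z_iff)
    qed
    finally show "(slash k \<gamma> (hecke k N n f) \<longlongrightarrow> 0) at_i_infinity" by simp
  qed
qed

lemma hecke_eigenform_one_dim:
  assumes "N > 0" "cusp_fun k N f"
    and "(\<lambda>z. f z - qe z) \<in> O[at_i_infinity](\<lambda>z. qe (2 * z))"
    and "10 * (\<Sum>(c, d)\<in>bottom_rows N. gcd (c ^ 2) (int N) + (if c = 0 then int N else 0)) > int (k * N * card (bottom_rows N))"
  shows "hecke_eigenform k N f"
  unfolding hecke_eigenform_def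
proof (intro allI impI)
  fix n :: nat assume "n > 0"
  obtain a where "\<And>z. Im z > 0 \<Longrightarrow> hecke k N n f z = a * f z"
    using cusp_fun_one_dim[OF assms(1) cusp_fun_hecke[OF assms(2) \<open>n > 0\<close>] assms(2-4)] by blast
  thus "\<exists>c. \<forall>z\<in>upper_half_plane. hecke k N n f z = c * f z" by (auto simp: in_H_iff)
qed

section \<open>Power series as modular forms\<close>

definition qconv :: "complex fps \<Rightarrow> bool" where
  "qconv F \<longleftrightarrow> fps_conv_radius F \<ge> 1"

lemma qconvI:
  assumes "\<And>x. norm x < 1 \<Longrightarrow> summable (\<lambda>n. fps_nth F n * x ^ n)"
  shows "qconv F"
  unfolding qconv_def fps_conv_radius_def one_ereal_def
  by (rule conv_radius_geI_ex') (use assms in auto)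

lemma qconv_mult: "qconv F \<Longrightarrow> qconv G \<Longrightarrow> qconv (F * G)"
  using fps_conv_radius_mult[of F G] by (auto simp: qconv_def min_def split: if_splits)

lemma qconv_add: "qconv F \<Longrightarrow> qconv G \<Longrightarrow> qconv (F + G)"
  using fps_conv_radius_add[of F G] by (auto simp: qconv_def min_def split: if_splits)

lemma qconv_diff: "qconv F \<Longrightarrow> qconv G \<Longrightarrow> qconv (F - G)"
  using fps_conv_radius_diff[of F G] by (auto simp: qconv_def min_def split: if_splits)

lemma qconv_const [simp]: "qconv (fps_const c)"
  by (simp add: qconv_def)

lemma qconv_0 [simp]: "qconv 0"
  by (simp add: qconv_def)

lemma qconv_1 [simp]: "qconv 1"
  by (simp add: qconv_def)

lemma qconv_less_norm:
  assumes "qconv F" "norm x < 1"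
  shows "ereal (norm x) < fps_conv_radius F"
proof -
  have "ereal (norm x) < 1" using assms(2) by (simp add: one_ereal_def)
  also have "1 \<le> fps_conv_radius F" using assms(1) by (simp add: qconv_def)
  finally show ?thesis .
qed

lemma qconv_pos: "qconv F \<Longrightarrow> fps_conv_radius F > 0"
  using qconv_less_norm[of F 0] by (simp add: zero_ereal_def)

lemma qconv_less: "qconv F \<Longrightarrow> Im z > 0 \<Longrightarrow> ereal (norm (qe z)) < fps_conv_radius F"
  by (rule qconv_less_norm) auto

lemma fun_of_qexp_mult: "qconv F \<Longrightarrow> qconv G \<Longrightarrow> Im z > 0 \<Longrightarrow> 
    fun_of_qexp (F * G) z = fun_of_qexp F z * fun_of_qexp G z"
  unfolding fun_of_qexp_def by (intro eval_fps_mult qconv_less)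

lemma fun_of_qexp_add: "qconv F \<Longrightarrow> qconv G \<Longrightarrow> Im z > 0 \<Longrightarrow> 
    fun_of_qexp (F + G) z = fun_of_qexp F z + fun_of_qexp G z"
  unfolding fun_of_qexp_def by (intro eval_fps_add qconv_less)

lemma fun_of_qexp_diff: "qconv F \<Longrightarrow> qconv G \<Longrightarrow> Im z > 0 \<Longrightarrow> 
    fun_of_qexp (F - G) z = fun_of_qexp F z - fun_of_qexp G z"
  unfolding fun_of_qexp_def by (intro eval_fps_diff qconv_less)

lemma fun_of_qexp_const [simp]: "fun_of_qexp (fps_const c) z = c"
  by (simp add: fun_of_qexp_def)

lemma fun_of_qexp_0 [simp]: "fun_of_qexp 0 z = 0"
  by (simp add: fun_of_qexp_def)

lemma holomorphic_fun_of_qexp: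
  assumes "qconv F"
  shows "fun_of_qexp F holomorphic_on upper_half_plane"
proof -
  have "(eval_fps F \<circ> qe) holomorphic_on upper_half_plane"
  proof (rule holomorphic_on_compose_gen)
    show "eval_fps F holomorphic_on eball 0 (fps_conv_radius F)"
      by (rule holomorphic_on_eval_fps) auto
    show "qe ` upper_half_plane \<subseteq> eball 0 (fps_conv_radius F)"
      using qconv_less[OF assms] by (auto simp: in_H_iff in_eball_iff)
  qed (intro holomorphic_intros)
  thus ?thesis by (simp add: fun_of_qexp_def[abs_def] o_def)
qed

lemma qpow_nth:
  assumes "h > 0"
  shows "fps_nth (qpow F h) n = (if h dvd n then fps_nth F (n div h) else 0)"
proof -
  have "fps_nth (qpow F h) n = (\<Sum>i=0..n. fps_nth F i * fps_nth (fps_X ^ (h * i)) n)"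
    by (simp add: qpow_def fps_compose_nth power_mult)
  also have "\<dots> = (\<Sum>i\<in>{0..n}. if n = h * i then fps_nth F i else 0)"
    by (intro sum.cong) (auto simp: fps_X_power_nth)
  also have "\<dots> = (if h dvd n then fps_nth F (n div h) else 0)"
  proof (cases "h dvd n")
    case True
    then obtain m where m: "n = h * m" by (elim dvdE)
    have "(\<Sum>i\<in>{0..n}. if n = h * i then fps_nth F i else 0) = (\<Sum>i\<in>{0..n}. if i = m then fps_nth F i else 0)"
      using assms by (intro sum.cong) (auto simp: m)
    also have "\<dots> = fps_nth F m" using assms by (simp add: m)
    finally show ?thesis using assms m by simp
  qed (auto intro!: sum.neutral)
  finally show ?thesis .
qed

lemma sums_qpow:
  assumes "qconv F" "h > 0" "norm x < 1"
  shows "(\<lambda>n. fps_nth (qpow F h) n * x ^ n) sums eval_fps F (x ^ h)"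
proof -
  have "norm (x ^ h) < 1" using assms by (simp add: norm_power power_less_one_iff)
  hence "ereal (norm (x ^ h)) < fps_conv_radius F" using assms(1) by (intro qconv_less_norm)
  hence "(\<lambda>n. fps_nth F n * (x ^ h) ^ n) sums eval_fps F (x ^ h)" by (rule sums_eval_fps)
  also have "(\<lambda>n. fps_nth F n * (x ^ h) ^ n) = (\<lambda>n. (\<lambda>m. fps_nth (qpow F h) m * x ^ m) (h * n))"
    using assms(2) by (auto simp: qpow_nth power_mult)
  also have "\<dots> sums eval_fps F (x ^ h) \<longleftrightarrow> (\<lambda>m. fps_nth (qpow F h) m * x ^ m) sums eval_fps F (x ^ h)"
  proof (rule sums_mono_reindex)
    show "strict_mono (\<lambda>n. h * n)" using assms(2) by (auto simp: strict_mono_def)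
    show "fps_nth (qpow F h) n * x ^ n = 0" if "n \<notin> range (\<lambda>n. h * n)" for n
      using that assms(2) by (auto simp: qpow_nth elim!: dvdE)
  qed
  finally show ?thesis .
qed

lemma qconv_qpow: "qconv F \<Longrightarrow> h > 0 \<Longrightarrow> qconv (qpow F h)"
  using sums_qpow by (intro qconvI) (auto simp: sums_iff)

lemma fun_of_qexp_qpow:
  assumes "qconv F" "h > 0" "Im z > 0"
  shows "fun_of_qexp (qpow F h) z = fun_of_qexp F (of_nat h * z)"
proof -
  have "norm (qe z) < 1" using assms by simp
  hence "eval_fps (qpow F h) (qe z) = eval_fps F (qe z ^ h)"
    using sums_qpow[OF assms(1,2)] by (simp add: eval_fps_def sums_iff)
  also have "qe z ^ h = qe (of_nat h * z)" by (simp add: mult_ac flip: exp_of_nat_mult)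
  finally show ?thesis by (simp add: fun_of_qexp_def)
qed

lemma fun_of_qexp_tendsto:
  assumes "qconv F"
  shows "(fun_of_qexp F \<longlongrightarrow> fps_nth F 0) at_i_infinity"
proof -
  have "isCont (eval_fps F) 0" using assms
    by (intro continuous_eval_fps) (simp add: qconv_pos flip: zero_ereal_def)
  hence "((\<lambda>z. eval_fps F (qe (z / of_real 1))) \<longlongrightarrow> eval_fps F 0) at_i_infinity"
    by (intro isCont_tendsto_compose[of 0 "eval_fps F"] tendsto_qe_at_i_infinity) auto
  thus ?thesis by (simp add: fun_of_qexp_def[abs_def] eval_fps_at_0)
qed

lemma fun_of_qexp_bigo:
  assumes "qconv F" "\<And>i. i < m \<Longrightarrow> fps_nth F i = 0"
  shows "fun_of_qexp F \<in> O[at_i_infinity](\<lambda>z. qe (of_nat m * z))"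
proof -
  define G where "G = fps_shift m F"
  have G: "qconv G" using assms by (simp add: G_def qconv_def)
  have F: "F = G * fps_X ^ m"
  proof (rule fps_ext)
    fix n show "fps_nth F n = fps_nth (G * fps_X ^ m) n"
      using assms(2)[of n] by (simp add: G_def fps_X_power_mult_right_nth)
  qed
  have "fun_of_qexp F z = fun_of_qexp G z * qe (of_nat m * z)" if "Im z > 0" for z
  proof -
    have "fun_of_qexp (G * fps_X ^ m) z = fun_of_qexp G z * fun_of_qexp (fps_X ^ m) z"
      using that G by (intro fun_of_qexp_mult) (auto simp: qconv_def)
    also have "fun_of_qexp (fps_X ^ m) z = qe (of_nat m * z)"
      by (simp add: fun_of_qexp_def mult_ac flip: exp_of_nat_mult)
    finally show ?thesis by (simp add: F)
  qed
  hence "fun_of_qexp F \<in> O[at_i_infinity](\<lambda>z. qe (of_nat m * z)) \<longleftrightarrow>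
         (\<lambda>z. fun_of_qexp G z * qe (of_nat m * z)) \<in> O[at_i_infinity](\<lambda>z. qe (of_nat m * z))"
    by (intro landau_o.big.in_cong eventually_mono[OF eventually_Im_gt[of 0]])
  moreover have "fun_of_qexp G \<in> O[at_i_infinity](\<lambda>_. 1)"
    using fun_of_qexp_tendsto[OF G] by (intro bigoI_tendsto) auto
  hence "(\<lambda>z. fun_of_qexp G z * qe (of_nat m * z)) \<in> O[at_i_infinity](\<lambda>z. 1 * qe (of_nat m * z))"
    by (intro landau_o.big.mult) auto
  ultimately show ?thesis by simp
qed

text \<open>The values of \<open>qe\<close> on the upper half plane fill the punctured unit disc;
  continuity at 0 supplies the centre, and power series with equal sums near 0 coincide.\<close>

lemma fun_of_qexp_eqD:
  assumes "qconv F" "qconv G" "\<And>z. Im z > 0 \<Longrightarrow> fun_of_qexp F z = fun_of_qexp G z"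
  shows "F = G"
proof -
  have eq: "eval_fps F x = eval_fps G x" if "x \<in> ball 0 1 - {0}" for x
  proof -
    define z where "z = Ln x / (2 * of_real pi * \<i>)"
    have x: "qe z = x" using that by (simp add: z_def)
    have "norm (qe z) < 1" using that by (simp add: x)
    hence "Im z > 0" by (simp add: zero_less_mult_iff)
    from assms(3)[OF this] show ?thesis by (simp add: fun_of_qexp_def x)
  qed
  have pos: "fps_conv_radius F > 0" "fps_conv_radius G > 0"
    using assms by (auto intro: qconv_pos)
  have ev: "\<forall>\<^sub>F x in at 0. eval_fps F x = eval_fps G x"
    unfolding eventually_at by (intro exI[of _ 1]) (use eq in auto)
  have "(eval_fps F \<longlongrightarrow> fps_nth F 0) (at 0)" and lim: "(eval_fps G \<longlongrightarrow> fps_nth G 0) (at 0)"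
    using continuous_eval_fps[of 0 F UNIV] continuous_eval_fps[of 0 G UNIV] pos
    by (simp_all add: continuous_within eval_fps_at_0 zero_ereal_def)
  from this(1) ev have "(eval_fps G \<longlongrightarrow> fps_nth F 0) (at 0)" by (rule Lim_transform_eventually)
  hence "fps_nth F 0 = fps_nth G 0" using lim by (rule tendsto_unique[OF trivial_limit_at])
  hence "eval_fps F 0 = eval_fps G 0" by (simp add: eval_fps_at_0)
  hence "\<forall>\<^sub>F x in nhds 0. eval_fps F x = eval_fps G x"
    using ev by (auto simp: eventually_at_filter elim!: eventually_mono)
  hence "eval_fps G has_fps_expansion F" using pos by (simp add: has_fps_expansion_def)
  moreover have "eval_fps G has_fps_expansion G" using pos by (simp add: eval_fps_has_fps_expansion)
  ultimately show ?thesis by (rule fps_expansion_unique_complex)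
qed

section \<open>Modular forms with character and values at cusps\<close>

text \<open>
  \<open>\<psi>\<close> is the nebentypus. The value \<open>v a c\<close> is the constant term of \<open>F|\<gamma>\<close> for \<open>\<gamma>\<close> with first column
  \<open>(a, c)\<close>, i.e. the value of \<open>F\<close> at the cusp \<open>a/c\<close>.
\<close>

definition mform :: "nat \<Rightarrow> nat \<Rightarrow> (int \<Rightarrow> complex) \<Rightarrow> (int \<Rightarrow> int \<Rightarrow> complex) \<Rightarrow> complex fps \<Rightarrow> bool" where
  "mform k N \<psi> v F \<longleftrightarrow> qconv F \<and>
     (\<forall>a b c d z. (a, b, c, d) \<in> Gamma0 N \<longrightarrow> Im z > 0 \<longrightarrow> 
        slash k (a, b, c, d) (fun_of_qexp F) z = \<psi> d * fun_of_qexp F z) \<and>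
     (\<forall>a b c d. (a, b, c, d) \<in> SL2Z \<longrightarrow> (slash k (a, b, c, d) (fun_of_qexp F) \<longlongrightarrow> v a c) at_i_infinity)"

lemma mform_qconv: "mform k N \<psi> v F \<Longrightarrow> qconv F"
  by (simp add: mform_def)

lemma coprime_SL2Z_left: "(a, b, c, d) \<in> SL2Z \<Longrightarrow> coprime a c"
proof -
  assume "(a, b, c, d) \<in> SL2Z"
  hence "a * d - b * c = 1" by (simp add: SL2Z_iff)
  thus "coprime a c" unfolding coprime_iff_gcd_eq_1
    by (metis dvd_diff dvd_mult dvd_mult2 gcd_dvd1 gcd_dvd2 is_unit_gcd_iff)
qed

lemma coprime_Gamma0: "(a, b, c, d) \<in> Gamma0 N \<Longrightarrow> coprime d (int N)"
proof (rule coprimeI)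
  fix x assume "(a, b, c, d) \<in> Gamma0 N" "x dvd d" "x dvd int N"
  hence *: "x dvd a * d" "x dvd b * c" "a * d - b * c = 1"
    by (auto simp: Gamma0_iff intro: dvd_trans)
  from dvd_diff[OF *(1,2)] show "is_unit x" by (simp add: *(3))
qed

lemma mform_cong:
  assumes "mform k N \<psi> v F"
    and "\<And>d. coprime d (int N) \<Longrightarrow> \<psi> d = \<psi>' d"
    and "\<And>a c. coprime a c \<Longrightarrow> v a c = v' a c"
  shows "mform k N \<psi>' v' F"
  using assms coprime_SL2Z_left coprime_Gamma0 unfolding mform_def by metis

lemma mform_level:
  assumes "mform k N \<psi> v F" "N dvd M"
  shows "mform k M \<psi> v F"
proof -
  have "(a, b, c, d) \<in> Gamma0 N" if "(a, b, c, d) \<in> Gamma0 M" for a b c d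
    using that assms(2) by (auto simp: Gamma0_iff intro: dvd_trans)
  thus ?thesis using assms(1) by (auto simp: mform_def)
qed

lemma mform_mult:
  assumes "mform k N \<psi> v F" "mform l N \<psi>' v' G" "m = k + l"
  shows "mform m N (\<lambda>d. \<psi> d * \<psi>' d) (\<lambda>a c. v a c * v' a c) (F * G)"
proof -
  have conv: "qconv F" "qconv G" using assms mform_qconv by auto
  have eq: "slash m \<gamma> (fun_of_qexp (F * G)) z = slash k \<gamma> (fun_of_qexp F) z * slash l \<gamma> (fun_of_qexp G) z"
    if "\<gamma> \<in> SL2Z" "Im z > 0" for \<gamma> z
    unfolding assms(3)
    by (subst slash_mult_fun[symmetric]) (use that conv in \<open>auto simp: SL2Z_iff fun_of_qexp_mult intro!: slash_cong_H\<close>)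
  have "(slash m (a, b, c, d) (fun_of_qexp (F * G)) \<longlongrightarrow> v a c * v' a c) at_i_infinity" if "(a, b, c, d) \<in> SL2Z" for a b c d
  proof -
    have "((\<lambda>z. slash k (a, b, c, d) (fun_of_qexp F) z * slash l (a, b, c, d) (fun_of_qexp G) z) \<longlongrightarrow> v a c * v' a c) at_i_infinity"
      using assms that by (intro tendsto_intros) (auto simp: mform_def)
    also have "?this \<longleftrightarrow> ?thesis"
      by (intro filterlim_cong refl eventually_mono[OF eventually_Im_gt[of 0]]) (simp add: eq that)
    finally show ?thesis .
  qed
  moreover have "slash m (a, b, c, d) (fun_of_qexp (F * G)) z = \<psi> d * \<psi>' d * fun_of_qexp (F * G) z"
    if "(a, b, c, d) \<in> Gamma0 N" "Im z > 0" for a b c d z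
  proof -
    have "(a, b, c, d) \<in> SL2Z" using that Gamma0_subset_SL2Z by blast
    from eq[OF this that(2)] show ?thesis
      using assms(1,2) that conv by (simp add: mform_def fun_of_qexp_mult)
  qed
  ultimately show ?thesis using conv by (auto simp: mform_def qconv_mult)
qed

lemma mform_lin:
  assumes "mform k N \<psi> v F" "mform k N \<psi> v' G"
  shows "mform k N \<psi> (\<lambda>a c. x * v a c + y * v' a c) (fps_const x * F + fps_const y * G)"
proof -
  have conv: "qconv F" "qconv G" using assms mform_qconv by auto
  have eq0: "fun_of_qexp (fps_const x * F + fps_const y * G) z = x * fun_of_qexp F z + y * fun_of_qexp G z" if "Im z > 0" for z
    using conv that by (simp add: fun_of_qexp_add fun_of_qexp_mult qconv_mult)
  have eq: "slash k \<gamma> (fun_of_qexp (fps_const x * F + fps_const y * G)) z = x * slash k \<gamma> (fun_of_qexp F) z + y * slash k \<gamma> (fun_of_qexp G) z"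
    if "\<gamma> \<in> SL2Z" "Im z > 0" for \<gamma> z
    using slash_cong_H[of _ "\<lambda>z. x * fun_of_qexp F z + y * fun_of_qexp G z" z \<gamma> k] that eq0
    by (simp add: slash_lin SL2Z_iff)
  have "(slash k (a, b, c, d) (fun_of_qexp (fps_const x * F + fps_const y * G)) \<longlongrightarrow> x * v a c + y * v' a c) at_i_infinity" if "(a, b, c, d) \<in> SL2Z" for a b c d
  proof -
    have "((\<lambda>z. x * slash k (a, b, c, d) (fun_of_qexp F) z + y * slash k (a, b, c, d) (fun_of_qexp G) z) \<longlongrightarrow> x * v a c + y * v' a c) at_i_infinity"
      using assms that by (intro tendsto_intros) (auto simp: mform_def)
    also have "?this \<longleftrightarrow> ?thesis"
      by (intro filterlim_cong refl eventually_mono[OF eventually_Im_gt[of 0]]) (simp add: eq that)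
    finally show ?thesis .
  qed
  moreover have "slash k (a, b, c, d) (fun_of_qexp (fps_const x * F + fps_const y * G)) z = \<psi> d * fun_of_qexp (fps_const x * F + fps_const y * G) z"
    if "(a, b, c, d) \<in> Gamma0 N" "Im z > 0" for a b c d z
  proof -
    have "(a, b, c, d) \<in> SL2Z" using that Gamma0_subset_SL2Z by blast
    from eq[OF this that(2)] show ?thesis
      using assms(1,2) that eq0[OF that(2)] by (simp add: mform_def algebra_simps)
  qed
  ultimately show ?thesis using conv by (auto simp: mform_def qconv_mult qconv_add)
qed

lemma mform_scale:
  assumes "mform k N \<psi> v F"
  shows "mform k N \<psi> (\<lambda>a c. x * v a c) (fps_const x * F)"
  using mform_lin[OF assms assms, of x 0] by simp

lemma mform_add:
  assumes "mform k N \<psi> v F" "mform k N \<psi> v' G"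
  shows "mform k N \<psi> (\<lambda>a c. v a c + v' a c) (F + G)"
  using mform_lin[OF assms, of 1 1] by simp

lemma mform_diff:
  assumes "mform k N \<psi> v F" "mform k N \<psi> v' G"
  shows "mform k N \<psi> (\<lambda>a c. v a c - v' a c) (F - G)"
proof -
  have "fps_const (-1) * G = - G" by (simp flip: fps_const_neg)
  thus ?thesis using mform_lin[OF assms, of 1 "-1"] by simp
qed

text \<open>Up to a scalar, F(q^h) is F slashed by the diagonal matrix with entries h and 1, which
  sends the cusp a / c to h a / c. For coprime a and c this fraction is reduced by g = gcd(h, c),
  and the determinants combine to the factor (g / h)^k.\<close>

definition cusp_value_qpow :: "nat \<Rightarrow> nat \<Rightarrow> (int \<Rightarrow> int \<Rightarrow> complex) \<Rightarrow> int \<Rightarrow> int \<Rightarrow> complex" where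
  "cusp_value_qpow k h v a c = (of_int (gcd (int h) c) / of_nat h) ^ k * 
     v (int h * a div gcd (int h) c) (c div gcd (int h) c)"

lemma fun_of_qexp_qpow_slash:
  assumes "qconv F" "h > 0" "k > 0" "Im z > 0"
  shows "fun_of_qexp (qpow F h) z = of_nat h / of_nat h ^ k * slash k (int h, 0, 0, 1) (fun_of_qexp F) z"
proof -
  have "of_nat h * of_nat h ^ (k - 1) = (of_nat h ^ k :: complex)"
    using assms(3) by (simp flip: power_Suc)
  thus ?thesis using assms by (simp add: fun_of_qexp_qpow slash_altdef field_simps)
qed

lemma slash_qpow:
  assumes "qconv F" "h > 0" "k > 0" "\<gamma> \<in> SL2Z" "Im z > 0"
  shows "slash k \<gamma> (fun_of_qexp (qpow F h)) z = 
           of_nat h / of_nat h ^ k * slash k (imat_mult (int h, 0, 0, 1) \<gamma>) (fun_of_qexp F) z"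
proof -
  define \<eta> where "\<eta> = (int h, 0 :: int, 0 :: int, 1 :: int)"
  have det_\<eta>: "imat_det \<eta> = int h" by (simp add: \<eta>_def)
  have "slash k \<gamma> (fun_of_qexp (qpow F h)) z = slash k \<gamma> (\<lambda>z. of_nat h / of_nat h ^ k * slash k \<eta> (fun_of_qexp F) z + 0 * 0) z"
    using assms fun_of_qexp_qpow_slash[OF assms(1-3)] by (intro slash_cong_H) (auto simp: SL2Z_iff \<eta>_def)
  also have "\<dots> = of_nat h / of_nat h ^ k * slash k \<gamma> (slash k \<eta> (fun_of_qexp F)) z"
    by (subst slash_lin) simp
  also have "slash k \<gamma> (slash k \<eta> (fun_of_qexp F)) z = slash k (imat_mult \<eta> \<gamma>) (fun_of_qexp F) z"
    using assms by (subst slash_mult) (auto simp: SL2Z_iff det_\<eta>)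
  finally show ?thesis by (simp add: \<eta>_def)
qed

lemma tendsto_slash_qpow:
  assumes "qconv F" "h > 0" "k > 0" 
    and v: "\<And>a b c d. (a, b, c, d) \<in> SL2Z \<Longrightarrow> (slash k (a, b, c, d) (fun_of_qexp F) \<longlongrightarrow> v a c) at_i_infinity"
    and SL: "(a, b, c, d) \<in> SL2Z"
  shows "(slash k (a, b, c, d) (fun_of_qexp (qpow F h)) \<longlongrightarrow> cusp_value_qpow k h v a c) at_i_infinity"
proof -
  define g where "g = gcd (int h) c"
  have "coprime a c" using SL by (rule coprime_SL2Z_left)
  hence g: "gcd (int h * a) c = g" unfolding g_def
    by (intro gcd_mult_left_right_cancel) (simp add: coprime_commute)
  have mult: "imat_mult (int h, 0, 0, 1) (a, b, c, d) = (int h * a, int h * b, c, d)" by simp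
  have det: "imat_det (int h * a, int h * b, c, d) = int h"
    using imat_det_mult[of "(int h, 0, 0, 1)" "(a, b, c, d)"] SL unfolding mult by (simp add: SL2Z_iff)
  have "(slash k (int h * a, int h * b, c, d) (fun_of_qexp F) \<longlongrightarrow> 
          of_int (int h) ^ (k - 1) / of_int (int h div g) ^ k * v (int h * a div g) (c div g)) at_i_infinity"
    using tendsto_slash_det_pos[of k "fun_of_qexp F" v "int h * a" "int h * b" c d] assms(2) v
    unfolding det g by simp
  hence "((\<lambda>z. of_nat h / of_nat h ^ k * slash k (int h * a, int h * b, c, d) (fun_of_qexp F) z) \<longlongrightarrow> 
          of_nat h / of_nat h ^ k * (of_int (int h) ^ (k - 1) / of_int (int h div g) ^ k * v (int h * a div g) (c div g))) at_i_infinity"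
    by (rule tendsto_mult_left)
  also have "of_nat h / of_nat h ^ k * (of_int (int h) ^ (k - 1) / of_int (int h div g) ^ k * v (int h * a div g) (c div g))
     = cusp_value_qpow k h v a c"
  proof -
    have *: "of_nat h * of_nat h ^ (k - 1) = (of_nat h ^ k :: complex)"
      using assms(3) by (simp flip: power_Suc)
    have "g dvd int h" by (simp add: g_def)
    have "g > 0" using assms(2) by (auto simp: g_def)
    have "of_int (int h div g) = of_nat h / (of_int g :: complex)"
      using \<open>g dvd int h\<close> \<open>g > 0\<close> by (subst of_int_div) auto
    thus ?thesis using * assms(2) \<open>g > 0\<close>
      by (simp add: cusp_value_qpow_def flip: g_def) (simp add: field_simps power_divide)
  qed
  also have "((\<lambda>z. of_nat h / of_nat h ^ k * slash k (int h * a, int h * b, c, d) (fun_of_qexp F) z) \<longlongrightarrow> cusp_value_qpow k h v a c) at_i_infinity \<longleftrightarrow> ?thesis"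
    by (intro filterlim_cong refl eventually_mono[OF eventually_Im_gt[of 0]]) (simp add: slash_qpow assms SL mult del: imat_mult.simps)
  finally show ?thesis .
qed

text \<open>Write c = h c'. Moving the diagonal matrix past (a, b, c, d) turns it into (a, h b, c',
  d), which lies in \<open>Gamma0 N\<close> and has the same d, so the character is
  unchanged.\<close>

lemma mform_qpow:
  assumes "mform k N \<psi> v F" "h > 0" "k > 0" "M = h * N"
  shows "mform k M \<psi> (cusp_value_qpow k h v) (qpow F h)"
proof -
  have conv: "qconv F" using assms mform_qconv by auto
  define \<eta> where "\<eta> = (int h, 0 :: int, 0 :: int, 1 :: int)"
  have det_\<eta>: "imat_det \<eta> = int h" by (simp add: \<eta>_def)
  note qpow_eq = fun_of_qexp_qpow_slash[OF conv assms(2,3), folded \<eta>_def]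
  note eq = slash_qpow[OF conv assms(2,3), folded \<eta>_def]
  have lim: "(slash k (a, b, c, d) (fun_of_qexp (qpow F h)) \<longlongrightarrow> cusp_value_qpow k h v a c) at_i_infinity" 
    if "(a, b, c, d) \<in> SL2Z" for a b c d
    using assms(1-3) conv that by (intro tendsto_slash_qpow) (auto simp: mform_def)
  have inv: "slash k (a, b, c, d) (fun_of_qexp (qpow F h)) z = \<psi> d * fun_of_qexp (qpow F h) z"
    if \<gamma>: "(a, b, c, d) \<in> Gamma0 M" and z: "Im z > 0" for a b c d z
  proof -
    obtain x where "c = int h * int N * x"
      using \<gamma> by (auto simp: Gamma0_iff assms(4) elim!: dvdE)
    then obtain c' where c': "c = int h * c'" "int N dvd c'"
      by (metis dvd_triv_left mult.assoc)
    have SL: "(a, b, c, d) \<in> SL2Z" using \<gamma> Gamma0_subset_SL2Z by blast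
    have \<delta>: "(a, int h * b, c', d) \<in> Gamma0 N"
      using \<gamma> c' by (auto simp: Gamma0_iff mult_ac)
    hence \<delta>': "(a, int h * b, c', d) \<in> SL2Z" using Gamma0_subset_SL2Z by blast
    have "imat_mult \<eta> (a, b, c, d) = imat_mult (a, int h * b, c', d) \<eta>"
      using c' by (simp add: \<eta>_def)
    hence "slash k (imat_mult \<eta> (a, b, c, d)) (fun_of_qexp F) z = slash k \<eta> (slash k (a, int h * b, c', d) (fun_of_qexp F)) z"
      using \<delta>' z assms(2) slash_mult[of z \<eta> "(a, int h * b, c', d)" k "fun_of_qexp F"]
      by (simp add: SL2Z_iff det_\<eta> del: imat_mult.simps)
    also have "\<dots> = slash k \<eta> (\<lambda>z. \<psi> d * fun_of_qexp F z + 0 * 0) z"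
      using assms(1,2) \<delta> z by (intro slash_cong_H) (auto simp: mform_def det_\<eta>)
    also have "\<dots> = \<psi> d * slash k \<eta> (fun_of_qexp F) z" by (subst slash_lin) simp
    finally show ?thesis using eq[OF SL z] qpow_eq[OF z] by simp
  qed
  show ?thesis unfolding mform_def using conv lim inv assms(2) by (auto simp: qconv_qpow)
qed

lemma mform_1: "mform 0 N (\<lambda>_. 1) (\<lambda>_ _. 1) 1"
proof -
  have "fun_of_qexp 1 = (\<lambda>_. 1)" by (simp add: fun_of_qexp_def fun_eq_iff)
  moreover have "slash 0 (a, b, c, d) (\<lambda>_. 1) = (\<lambda>_. 1)" if "(a, b, c, d) \<in> SL2Z" for a b c d
    using that by (intro ext) (simp add: slash_altdef SL2Z_iff)
  ultimately show ?thesis using subsetD[OF Gamma0_subset_SL2Z] by (auto simp: mform_def)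
qed

lemma mform_power:
  assumes "mform k N \<psi> v F" "l = n * k"
  shows "mform l N (\<lambda>d. \<psi> d ^ n) (\<lambda>a c. v a c ^ n) (F ^ n)"
  unfolding assms(2)
proof (induction n)
  case 0
  show ?case using mform_1 by simp
next
  case (Suc n)
  show ?case using mform_mult[OF assms(1) Suc, of "Suc n * k"] by simp
qed

lemma mform_Gamma0_invariant: "mform k N (\<lambda>_. 1) v F \<Longrightarrow> Gamma0_invariant k N (fun_of_qexp F)"
  by (auto simp: mform_def Gamma0_invariant_def in_H_iff)

theorem mform_eq_0:
  assumes "mform k N (\<lambda>_. 1) v F" "N > 0"
    and "\<And>i. i < m \<Longrightarrow> fps_nth F i = 0"
    and "10 * (\<Sum>(c, d)\<in>bottom_rows N. if c = 0 then int m else 0) > int (k * card (bottom_rows N))"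
  shows "F = 0"
proof (rule fun_of_qexp_eqD)
  have conv: "qconv F" using assms mform_qconv by auto
  show "fun_of_qexp F z = fun_of_qexp 0 z" if "Im z > 0" for z
  proof -
    have "fun_of_qexp F z = 0"
    proof (rule modular_fun_eq_0[of N "fun_of_qexp F" k m])
      show "\<exists>L. (slash k \<gamma> (fun_of_qexp F) \<longlongrightarrow> L) at_i_infinity" if "\<gamma> \<in> SL2Z" for \<gamma>
        using assms(1) that by (cases \<gamma>) (unfold mform_def, blast)
    qed (use assms conv that in \<open>auto intro: holomorphic_fun_of_qexp mform_Gamma0_invariant fun_of_qexp_bigo\<close>)
    thus ?thesis by simp
  qed
qed (use assms mform_qconv in auto)

section \<open>Cusp forms, newforms and primitive forms\<close>

lemma Bfun_tendsto: "(f \<longlongrightarrow> L) F \<Longrightarrow> Bfun f F" for f :: "'a \<Rightarrow> 'b :: real_normed_vector"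
proof -
  assume "(f \<longlongrightarrow> L) F"
  hence "\<forall>\<^sub>F x in F. norm (f x) < norm L + 1" by (intro order_tendstoD(2)[OF tendsto_norm]) auto
  thus ?thesis by (intro BfunI[of _ "norm L + 1"]) (auto elim: eventually_mono)
qed

lemma cusp_forms_iff: "F \<in> cusp_forms k N \<longleftrightarrow> qconv F \<and> cusp_fun k N (fun_of_qexp F)"
  by (auto simp: cusp_forms_def modular_forms_def is_modular_form_def cusp_fun_def qconv_def
       Gamma0_invariant_def vanishes_at_cusps_def intro: Bfun_tendsto)

lemma mform_cusp_form:
  assumes "mform k N (\<lambda>_. 1) v F" "\<And>a c. coprime a c \<Longrightarrow> v a c = 0"
  shows "F \<in> cusp_forms k N"
proof -
  have "mform k N (\<lambda>_. 1) (\<lambda>_ _. 0) F" by (rule mform_cong[OF assms(1)]) (use assms(2) in auto)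
  thus ?thesis using mform_Gamma0_invariant[OF assms(1)] 
    by (auto simp: cusp_forms_iff cusp_fun_def mform_def vanishes_at_cusps_def intro: holomorphic_fun_of_qexp)
qed

lemma cusp_forms_trivial:
  assumes "N > 0" "10 * (\<Sum>(c, d)\<in>bottom_rows N. gcd (c ^ 2) (int N)) > int (k * N * card (bottom_rows N))"
  shows "cusp_forms k N \<subseteq> {0}"
proof
  fix F assume F: "F \<in> cusp_forms k N"
  have "F = 0"
    using F cusp_fun_eq_0[OF assms(1) _ assms(2), of "fun_of_qexp F"]
    by (intro fun_of_qexp_eqD) (auto simp: cusp_forms_iff)
  thus "F \<in> {0}" by simp
qed

lemma module_fps: "module (\<lambda>c F. fps_const c * F :: complex fps)"
  by unfold_locales (simp_all add: algebra_simps flip: fps_const_mult fps_const_add)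

lemma oldforms_trivial:
  assumes "\<And>M. M dvd N \<Longrightarrow> M \<noteq> N \<Longrightarrow> cusp_forms k M \<subseteq> {0}"
  shows "oldforms k N \<subseteq> {0}"
proof -
  interpret module "\<lambda>c F. fps_const c * F :: complex fps" by (rule module_fps)
  have "{qpow F h | F h M. M dvd N \<and> M \<noteq> N \<and> h * M dvd N \<and> F \<in> cusp_forms k M} \<subseteq> {0}"
  proof clarify
    fix F h M assume "M dvd N" "M \<noteq> N" "F \<in> cusp_forms k M"
    hence "F = 0" using assms[of M] by blast
    thus "qpow F h = 0" by (simp add: qpow_def)
  qed
  thus ?thesis unfolding oldforms_def by (rule span_minimal) (rule subspace_single_0)
qed

text \<open>Orthogonality is tested against 0 only, so no Petersson integral has to be
  evaluated.\<close>

lemma newforms_eq_cusp_forms: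
  assumes "\<And>M. M dvd N \<Longrightarrow> M \<noteq> N \<Longrightarrow> cusp_forms k M \<subseteq> {0}"
  shows "newforms k N = cusp_forms k N"
proof -
  have "fun_of_qexp 0 = (\<lambda>_. 0)" by (simp add: fun_eq_iff)
  hence "petersson k N f (fun_of_qexp 0) = 0" for f
    by (simp add: petersson_def slash_altdef)
  thus ?thesis using oldforms_trivial[OF assms] by (fastforce simp: newforms_def)
qed

theorem primitive_forms_singleton:
  assumes N: "N > 0" and F: "F \<in> cusp_forms k N" "fps_nth F 1 = 1"
    and ord: "10 * (\<Sum>(c, d)\<in>bottom_rows N. gcd (c ^ 2) (int N) + (if c = 0 then int N else 0)) > int (k * N * card (bottom_rows N))"
    and old: "\<And>M. M dvd N \<Longrightarrow> M \<noteq> N \<Longrightarrow> cusp_forms k M \<subseteq> {0}"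
  shows "primitive_forms k N = {F}"
proof -
  have conv: "qconv F" and cusp: "cusp_fun k N (fun_of_qexp F)" using F(1) by (auto simp: cusp_forms_iff)
  have "(1, 0, 0, 1) \<in> SL2Z" by (simp add: SL2Z_iff)
  hence "(slash k (1, 0, 0, 1) (fun_of_qexp F) \<longlongrightarrow> 0) at_i_infinity"
    using cusp by (auto simp: cusp_fun_def vanishes_at_cusps_def)
  moreover have "slash k (1, 0, 0, 1) (fun_of_qexp F) = fun_of_qexp F" by (rule ext) simp
  ultimately have "(fun_of_qexp F \<longlongrightarrow> 0) at_i_infinity" by simp
  hence F0: "fps_nth F 0 = 0"
    using tendsto_unique[OF at_i_infinity_neq_bot fun_of_qexp_tendsto[OF conv]] by blast
  have "fun_of_qexp (F - fps_X) \<in> O[at_i_infinity](\<lambda>z. qe (of_nat 2 * z))"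
  proof (rule fun_of_qexp_bigo)
    show "qconv (F - fps_X)" using conv by (intro qconv_diff) (auto simp: qconv_def)
    show "fps_nth (F - fps_X) i = 0" if "i < 2" for i using that F0 F(2) by (auto simp: less_2_cases_iff fps_X_def)
  qed
  also have "?this \<longleftrightarrow> (\<lambda>z. fun_of_qexp F z - qe z) \<in> O[at_i_infinity](\<lambda>z. qe (of_nat 2 * z))"
  proof (intro landau_o.big.in_cong eventually_mono[OF eventually_Im_gt[of 0]])
    fix z assume "Im z > 0"
    thus "fun_of_qexp (F - fps_X) z = fun_of_qexp F z - qe z"
      using conv by (subst fun_of_qexp_diff) (auto simp: qconv_def fun_of_qexp_def)
  qed
  finally have F1: "(\<lambda>z. fun_of_qexp F z - qe z) \<in> O[at_i_infinity](\<lambda>z. qe (2 * z))" by simp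
  have "hecke_eigenform k N (fun_of_qexp F)"
    by (rule hecke_eigenform_one_dim[OF N cusp F1 ord])
  hence "F \<in> primitive_forms k N"
    using F newforms_eq_cusp_forms[OF old] by (auto simp: primitive_forms_def)
  moreover have "G = F" if "G \<in> primitive_forms k N" for G
  proof -
    have G: "G \<in> cusp_forms k N" "fps_nth G 1 = 1"
      using that by (auto simp: primitive_forms_def newforms_def)
    obtain a where a: "\<And>z. Im z > 0 \<Longrightarrow> fun_of_qexp G z = a * fun_of_qexp F z"
      using cusp_fun_one_dim[OF N _ cusp F1 ord] G(1) by (auto simp: cusp_forms_iff)
    have eq: "G = fps_const a * F"
      using G(1) conv a by (intro fun_of_qexp_eqD) (auto simp: cusp_forms_iff qconv_mult fun_of_qexp_mult)
    hence "a = 1" using G(2) F(2) by simp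
    thus ?thesis using eq by simp
  qed
  ultimately show ?thesis by blast
qed

text \<open>An executable description, by which the numerical hypotheses of Sturm's bound are
  decided by evaluation.\<close>

lemma bottom_rows_code:
  "bottom_rows N = set (filter (\<lambda>(c, d). gcd (gcd c d) (int N) = 1) (List.product [0..int N - 1] [0..int N - 1]))"
  by (auto simp: bottom_rows_def)

section \<open>The logarithmic derivative of the theta function\<close>

definition lambert_fps :: "complex \<Rightarrow> complex fps" where
  "lambert_fps q = Abs_fps (\<lambda>m. if m = 0 then 0 else 1 / (1 - q ^ m))"

lemma norm_one_minus_power_ge:
  assumes "norm q < 1" "m > 0"
  shows "norm (1 - q ^ m :: complex) \<ge> 1 - norm q"
proof -
  have "norm (q ^ m) \<le> norm q" using assms power_decreasing[of 1 m "norm q"] by (simp add: norm_power)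
  moreover have "norm (1 :: complex) - norm (q ^ m) \<le> norm (1 - q ^ m)" by (rule norm_triangle_ineq2)
  ultimately show ?thesis by simp
qed

lemma norm_lambert_fps_nth_le:
  assumes "norm q < 1"
  shows "norm (fps_nth (lambert_fps q) m) \<le> 1 / (1 - norm q)"
proof (cases "m = 0")
  case False
  thus ?thesis using norm_one_minus_power_ge[of q m] assms
    by (auto simp: lambert_fps_def norm_divide intro!: divide_left_mono mult_pos_pos)
qed (use assms in \<open>auto simp: lambert_fps_def\<close>)

lemma qconv_bounded:
  assumes "\<And>n. norm (fps_nth F n) \<le> C"
  shows "qconv F"
proof (rule qconvI)
  fix x :: complex assume "norm x < 1"
  hence "summable (\<lambda>n. C * norm x ^ n)" by (intro summable_mult summable_geometric) auto
  thus "summable (\<lambda>n. fps_nth F n * x ^ n)"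
    by (rule summable_comparison_test'[where N = 0]) 
       (use assms in \<open>auto simp: norm_mult norm_power intro!: mult_right_mono\<close>)
qed

lemma qconv_lambert_fps: "norm q < 1 \<Longrightarrow> qconv (lambert_fps q)"
  using norm_lambert_fps_nth_le by (rule qconv_bounded)

lemma sums_qconv: "qconv F \<Longrightarrow> norm x < 1 \<Longrightarrow> (\<lambda>n. fps_nth F n * x ^ n) sums eval_fps F x"
  by (intro sums_eval_fps qconv_less_norm)

text \<open>Replacing x by q x multiplies the n-th coefficient by q^n, so in the difference the
  denominator 1 - q^n cancels and a geometric series remains.\<close>

lemma lambert_fps_functional:
  assumes "norm q < 1" "norm x < 1"
  shows "eval_fps (lambert_fps q) x = x / (1 - x) + eval_fps (lambert_fps q) (q * x)"
proof -
  have "norm (q * x) \<le> 1 * norm x" unfolding norm_mult using assms by (intro mult_right_mono) auto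
  hence qx: "norm (q * x) < 1" using assms by simp
  have x: "x \<noteq> 1" using assms by auto
  have "(\<lambda>n. fps_nth (lambert_fps q) n * x ^ n - fps_nth (lambert_fps q) n * (q * x) ^ n) sums
          (eval_fps (lambert_fps q) x - eval_fps (lambert_fps q) (q * x))"
    using assms qx qconv_lambert_fps by (intro sums_diff sums_qconv)
  also have "(\<lambda>n. fps_nth (lambert_fps q) n * x ^ n - fps_nth (lambert_fps q) n * (q * x) ^ n) = 
             (\<lambda>n. x ^ n - (if n = 0 then 1 else 0))"
  proof
    fix n show "fps_nth (lambert_fps q) n * x ^ n - fps_nth (lambert_fps q) n * (q * x) ^ n = 
             x ^ n - (if n = 0 then 1 else 0)"
    proof (cases "n = 0")
      case False
      hence "1 - q ^ n \<noteq> 0" using norm_one_minus_power_ge[of q n] assms by auto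
      hence "1 / (1 - q ^ n) * x ^ n - 1 / (1 - q ^ n) * (q ^ n * x ^ n) = x ^ n"
      proof -
        have "1 / (1 - a) * b - 1 / (1 - a) * (a * b) = ((1 - a) * b) / (1 - a)" for a b :: complex
          by (simp add: left_diff_distrib diff_divide_distrib)
        thus ?thesis using \<open>1 - q ^ n \<noteq> 0\<close> by simp
      qed
      thus ?thesis using False by (simp add: lambert_fps_def power_mult_distrib)
    qed (simp add: lambert_fps_def)
  qed
  finally have "(\<lambda>n. x ^ n - (if n = 0 then 1 else 0)) sums (eval_fps (lambert_fps q) x - eval_fps (lambert_fps q) (q * x))" .
  moreover have "(\<lambda>n. x ^ n - (if n = 0 then 1 else 0)) sums (1 / (1 - x) - 1)"
    using assms by (intro sums_diff geometric_sums sums_single[of 0 "\<lambda>_. 1", simplified])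
  ultimately have "eval_fps (lambert_fps q) x - eval_fps (lambert_fps q) (q * x) = 1 / (1 - x) - 1"
    by (rule sums_unique2)
  also have "\<dots> = x / (1 - x)" using x by (simp add: field_simps)
  finally show ?thesis by (simp add: algebra_simps)
qed

text \<open>The bound is explicit in q as well as in x, because towards i infinity both arguments
  tend to 0 simultaneously.\<close>

lemma norm_lambert_le:
  assumes "norm q < 1" "norm x < 1"
  shows "norm (eval_fps (lambert_fps q) x) \<le> norm x / ((1 - norm q) * (1 - norm x))"
proof -
  have "norm (\<Sum>n. fps_nth (lambert_fps q) n * x ^ n) \<le> (\<Sum>n. 1 / (1 - norm q) * (norm x ^ n - (if n = 0 then 1 else 0)))"
  proof (rule norm_suminf_le)
    fix n show "norm (fps_nth (lambert_fps q) n * x ^ n) \<le> 1 / (1 - norm q) * (norm x ^ n - (if n = 0 then 1 else 0))"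
    proof (cases "n = 0")
      case False
      have "norm (fps_nth (lambert_fps q) n) * norm x ^ n \<le> 1 / (1 - norm q) * norm x ^ n"
        using norm_lambert_fps_nth_le[OF assms(1)] by (intro mult_right_mono) auto
      thus ?thesis using False by (simp add: norm_mult norm_power)
    qed (simp add: lambert_fps_def)
  next
    show "summable (\<lambda>n. 1 / (1 - norm q) * (norm x ^ n - (if n = 0 then 1 else 0)))"
      using assms by (intro summable_mult summable_diff summable_geometric summable_single[of 0 "\<lambda>_. 1", simplified]) auto
  qed
  also have "(\<lambda>n. 1 / (1 - norm q) * (norm x ^ n - (if n = 0 then 1 else 0))) sums (1 / (1 - norm q) * (1 / (1 - norm x) - 1))"
    using assms by (intro sums_mult sums_diff geometric_sums sums_single[of 0 "\<lambda>_. 1", simplified]) auto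
  hence "(\<Sum>n. 1 / (1 - norm q) * (norm x ^ n - (if n = 0 then 1 else 0))) = 1 / (1 - norm q) * (1 / (1 - norm x) - 1)"
    by (rule sums_unique[symmetric])
  also have "\<dots> = norm x / ((1 - norm q) * (1 - norm x))" using assms by (simp add: field_simps)
  finally show ?thesis by (simp add: eval_fps_def)
qed

text \<open>
  The meromorphic continuation \<open>\<Sum>n\<ge>0. q\<^sup>n x / (1 - q\<^sup>n x)\<close> of the Lambert series
  \<open>\<Sum>m\<ge>1. x\<^sup>m / (1 - q\<^sup>m)\<close> to the whole plane.
\<close>

definition lambert :: "complex \<Rightarrow> complex \<Rightarrow> complex" where
  "lambert q x = (let N = LEAST N. norm (q ^ N * x) < 1 in
     (\<Sum>n<N. q ^ n * x / (1 - q ^ n * x)) + eval_fps (lambert_fps q) (q ^ N * x))"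

lemma power_mult_less_1:
  assumes "norm (q :: complex) < 1"
  shows "\<exists>N. norm (q ^ N * x) < 1"
proof -
  have "(\<lambda>N. q ^ N * x) \<longlonglongrightarrow> 0 * x" using assms by (intro tendsto_mult LIMSEQ_power_zero tendsto_const)
  hence "(\<lambda>N. norm (q ^ N * x)) \<longlonglongrightarrow> 0" using tendsto_norm_zero by fastforce
  hence "\<forall>\<^sub>F N in sequentially. norm (q ^ N * x) < 1" by (intro order_tendstoD(2)) auto
  thus ?thesis by (auto dest: eventually_happens)
qed

text \<open>Every admissible N gives the same value: raising N by one is a single use of the
  functional equation inside the disc. This frees the definition from its least N.\<close>

lemma lambert_eq:
  assumes "norm q < 1" "norm (q ^ N * x) < 1"
  shows "lambert q x = (\<Sum>n<N. q ^ n * x / (1 - q ^ n * x)) + eval_fps (lambert_fps q) (q ^ N * x)"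
proof -
  define N0 where "N0 = (LEAST N. norm (q ^ N * x) < 1)"
  have N0: "norm (q ^ N0 * x) < 1" unfolding N0_def by (rule LeastI) (rule assms(2))
  have "N0 \<le> N" unfolding N0_def by (rule Least_le) (rule assms(2))
  hence "lambert q x = (\<Sum>n<N. q ^ n * x / (1 - q ^ n * x)) + eval_fps (lambert_fps q) (q ^ N * x)"
  proof (induction N rule: dec_induct)
    case base
    show ?case by (simp add: lambert_def N0_def Let_def)
  next
    case (step n)
    have "norm (q ^ n * x) = norm (q ^ (n - N0)) * norm (q ^ N0 * x)"
      using step by (simp add: norm_mult norm_power flip: power_add mult.assoc)
    also have "\<dots> \<le> 1 * norm (q ^ N0 * x)"
      using assms(1) by (intro mult_right_mono) (auto simp: norm_power power_le_one)
    finally have "norm (q ^ n * x) < 1" using N0 by simp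
    from lambert_fps_functional[OF assms(1) this] step.IH show ?case
      by (simp add: mult.assoc)
  qed
  thus ?thesis .
qed

lemma lambert_eq_0: "norm q < 1 \<Longrightarrow> norm x < 1 \<Longrightarrow> lambert q x = eval_fps (lambert_fps q) x"
  using lambert_eq[of q 0 x] by simp

lemma lambert_functional:
  assumes "norm q < 1"
  shows "lambert q x = x / (1 - x) + lambert q (q * x)"
proof -
  obtain N where N: "norm (q ^ N * (q * x)) < 1" using power_mult_less_1[OF assms] by blast
  hence N': "norm (q ^ Suc N * x) < 1" by (simp add: mult_ac)
  show ?thesis
    unfolding lambert_eq[OF assms N] lambert_eq[OF assms N'] sum.lessThan_Suc_shift
    by (simp add: mult_ac)
qed

lemma lambert_differentiable:
  assumes "norm q < 1" "\<And>n. q ^ n * x \<noteq> 1"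
  shows "lambert q field_differentiable (at x)"
proof -
  obtain N where N: "norm (q ^ N * x) < 1" using power_mult_less_1[OF assms(1)] by blast
  define U where "U = (\<lambda>x. q ^ N * x) -` ball 0 1 \<inter> (\<Inter>n\<in>{..<N}. (\<lambda>x. q ^ n * x) -` (-{1}))"
  have "open U" unfolding U_def
    by (intro open_Int open_INT open_vimage continuous_intros ballI) auto
  have "(\<lambda>x. (\<Sum>n<N. q ^ n * x / (1 - q ^ n * x)) + eval_fps (lambert_fps q) (q ^ N * x)) holomorphic_on U"
  proof (intro holomorphic_intros)
    have "(eval_fps (lambert_fps q) \<circ> (\<lambda>x. q ^ N * x)) holomorphic_on U"
    proof (rule holomorphic_on_compose_gen)
      show "eval_fps (lambert_fps q) holomorphic_on ball 0 1"
        using qconv_less_norm[OF qconv_lambert_fps[OF assms(1)]]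
        by (intro holomorphic_on_eval_fps) (auto simp: in_eball_iff)
    qed (auto simp: U_def intro!: holomorphic_intros)
    thus "(\<lambda>x. eval_fps (lambert_fps q) (q ^ N * x)) holomorphic_on U" by (simp add: o_def)
  qed (auto simp: U_def)
  also have "?this \<longleftrightarrow> lambert q holomorphic_on U"
    using lambert_eq[OF assms(1), of N] by (intro holomorphic_cong) (auto simp: U_def)
  finally have "lambert q holomorphic_on U" .
  moreover have "x \<in> U" using N assms(2) by (auto simp: U_def)
  ultimately show ?thesis using \<open>open U\<close> holomorphic_on_imp_differentiable_at by blast
qed

text \<open>The logarithmic derivative in \<open>u\<close> of the Jacobi theta function \<open>\<theta>\<^sub>1(u|\<tau>)\<close>.\<close>

definition theta_ld :: "complex \<Rightarrow> complex \<Rightarrow> complex" where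
  "theta_ld \<tau> u = - (of_real pi * \<i>) - 2 * of_real pi * \<i> * lambert (qe \<tau>) (qe u) +
     2 * of_real pi * \<i> * lambert (qe \<tau>) (qe \<tau> / qe u)"

section \<open>Period lattice and quasi-periods\<close>

definition lattice :: "complex \<Rightarrow> complex set" where
  "lattice \<tau> = {of_int m * \<tau> + of_int n | m n. True}"

lemma qe_add: "qe (x + y) = qe x * qe y"
  by (simp add: ring_distribs exp_add)

lemma qe_minus: "qe (- x) = 1 / qe x"
  by (simp add: exp_minus field_simps)

lemma qe_of_int [simp]: "qe (of_int n) = 1"
  using exp_integer_2pi[of "of_int n"] by (simp add: mult_ac)

lemma qe_eq_1_iff: "qe x = 1 \<longleftrightarrow> (\<exists>n. x = of_int n)"
  using qe_eq_iff[of x 0] by simp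

lemma qe_power: "qe x ^ n = qe (of_nat n * x)"
  by (simp add: mult_ac flip: exp_of_nat_mult)

lemma lattice_0 [simp]: "0 \<in> lattice \<tau>"
  unfolding lattice_def by (intro CollectI exI[of _ 0]) simp

lemma lattice_int: "of_int n \<in> lattice \<tau>"
  unfolding lattice_def by (intro CollectI exI[of _ 0] exI[of _ n]) simp

lemma lattice_add: "x \<in> lattice \<tau> \<Longrightarrow> y \<in> lattice \<tau> \<Longrightarrow> x + y \<in> lattice \<tau>"
proof -
  assume "x \<in> lattice \<tau>" "y \<in> lattice \<tau>"
  then obtain m n m' n' where "x = of_int m * \<tau> + of_int n" "y = of_int m' * \<tau> + of_int n'"
    by (auto simp: lattice_def)
  hence "x + y = of_int (m + m') * \<tau> + of_int (n + n')" by (simp add: algebra_simps)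
  thus ?thesis unfolding lattice_def by blast
qed

lemma lattice_minus: "x \<in> lattice \<tau> \<Longrightarrow> - x \<in> lattice \<tau>"
proof -
  assume "x \<in> lattice \<tau>"
  then obtain m n where "x = of_int m * \<tau> + of_int n" by (auto simp: lattice_def)
  hence "- x = of_int (- m) * \<tau> + of_int (- n)" by simp
  thus ?thesis unfolding lattice_def by blast
qed

lemma lattice_add_iff: "y \<in> lattice \<tau> \<Longrightarrow> x + y \<in> lattice \<tau> \<longleftrightarrow> x \<in> lattice \<tau>"
  using lattice_add[of x \<tau> y] lattice_add[of "x + y" \<tau> "- y"] lattice_minus[of y \<tau>] by auto

lemma theta_ld_add_int: "theta_ld \<tau> (u + of_int n) = theta_ld \<tau> u"
  unfolding theta_ld_def qe_add by simp

lemma divide_one_minus: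
  assumes "(w :: complex) \<noteq> 1"
  shows "w / (1 - w) = - 1 - 1 / (w - 1)"
proof -
  have "w / (1 - w) = - (w / (w - 1))" by (metis minus_diff_eq minus_divide_right)
  also have "w / (w - 1) = 1 + 1 / (w - 1)" using assms by (simp add: field_simps)
  finally show ?thesis by simp
qed

text \<open>The shift multiplies w = \<open>qe u\<close> by q, which moves each Lambert sum by one
  term. The two terms w / (1 - w) and 1 / (w - 1) add up to -1, whence the quasi-period - 2 pi
  i.\<close>

lemma theta_ld_add_tau:
  assumes "Im \<tau> > 0" "u \<notin> lattice \<tau>"
  shows "theta_ld \<tau> (u + \<tau>) = theta_ld \<tau> u - 2 * of_real pi * \<i>"
proof -
  define q w where "q = qe \<tau>" and "w = qe u"
  have q: "norm q < 1" "q \<noteq> 0" using assms by (auto simp: q_def)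
  have w: "w \<noteq> 0" "w \<noteq> 1" using assms(2) lattice_int by (auto simp: w_def qe_eq_1_iff)
  have 1: "lambert q (q * w) = lambert q w - w / (1 - w)" 
    using lambert_functional[OF q(1), of w] by simp
  have 2: "lambert q (1 / w) = 1 / (w - 1) + lambert q (q / w)"
  proof -
    have "(1 / w) / (1 - 1 / w) = 1 / (w - 1)" using w by (simp add: field_simps)
    thus ?thesis using lambert_functional[OF q(1), of "1 / w"] by simp
  qed
  have 3: "w / (1 - w) = - 1 - 1 / (w - 1)" using w(2) by (rule divide_one_minus)
  have "theta_ld \<tau> (u + \<tau>) = - (of_real pi * \<i>) - 2 * of_real pi * \<i> * lambert q (q * w) + 2 * of_real pi * \<i> * lambert q (1 / w)"
    unfolding theta_ld_def qe_add q_def[symmetric] w_def[symmetric] using q(2) by (simp add: mult.commute)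
  also have "\<dots> = theta_ld \<tau> u - 2 * of_real pi * \<i>"
    unfolding 1 2 3 theta_ld_def q_def[symmetric] w_def[symmetric] by (simp add: algebra_simps)
  finally show ?thesis .
qed

lemma theta_ld_add_nat_tau:
  assumes "Im \<tau> > 0" "u \<notin> lattice \<tau>"
  shows "theta_ld \<tau> (u + of_nat m * \<tau>) = theta_ld \<tau> u - 2 * of_real pi * \<i> * of_nat m"
proof (induction m)
  case (Suc m)
  have "of_nat m * \<tau> \<in> lattice \<tau>" unfolding lattice_def by (intro CollectI exI[of _ "int m"] exI[of _ 0]) simp
  hence "u + of_nat m * \<tau> \<notin> lattice \<tau>" using assms(2) by (simp add: lattice_add_iff)
  from theta_ld_add_tau[OF assms(1) this]
  have "theta_ld \<tau> (u + of_nat m * \<tau> + \<tau>) = theta_ld \<tau> u - 2 * of_real pi * \<i> * of_nat (Suc m)"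
    unfolding Suc by (simp add: algebra_simps)
  thus ?case by (simp add: algebra_simps)
qed simp

lemma theta_ld_add_lattice:
  assumes "Im \<tau> > 0" "u \<notin> lattice \<tau>"
  shows "theta_ld \<tau> (u + of_int m * \<tau> + of_int n) = theta_ld \<tau> u - 2 * of_real pi * \<i> * of_int m"
proof (cases "m \<ge> 0")
  case True
  thus ?thesis using theta_ld_add_nat_tau[OF assms, of "nat m"] by (simp add: theta_ld_add_int)
next
  case False
  have "of_int m * \<tau> \<in> lattice \<tau>" unfolding lattice_def by (intro CollectI exI[of _ m] exI[of _ 0]) simp
  hence "u + of_int m * \<tau> \<notin> lattice \<tau>" using assms(2) by (simp add: lattice_add_iff)
  from theta_ld_add_nat_tau[OF assms(1) this, of "nat (- m)"] False
  show ?thesis by (simp add: theta_ld_add_int)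
qed

text \<open>Inverting w interchanges the two sums up to the same pair of boundary terms; their total
  -1 turns the constant - pi i into its negative.\<close>

lemma theta_ld_minus:
  assumes "Im \<tau> > 0" "u \<notin> lattice \<tau>"
  shows "theta_ld \<tau> (- u) = - theta_ld \<tau> u"
proof -
  define q w where "q = qe \<tau>" and "w = qe u"
  have q: "norm q < 1" "q \<noteq> 0" using assms by (auto simp: q_def)
  have w: "w \<noteq> 0" "w \<noteq> 1" using assms(2) lattice_int by (auto simp: w_def qe_eq_1_iff)
  have 1: "lambert q (q * w) = lambert q w - w / (1 - w)" 
    using lambert_functional[OF q(1), of w] by simp
  have 2: "lambert q (1 / w) = 1 / (w - 1) + lambert q (q / w)"
  proof -
    have "(1 / w) / (1 - 1 / w) = 1 / (w - 1)" using w by (simp add: field_simps)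
    thus ?thesis using lambert_functional[OF q(1), of "1 / w"] by simp
  qed
  have 3: "w / (1 - w) = - 1 - 1 / (w - 1)" using w(2) by (rule divide_one_minus)
  have "theta_ld \<tau> (- u) = - (of_real pi * \<i>) - 2 * of_real pi * \<i> * lambert q (1 / w) + 2 * of_real pi * \<i> * lambert q (q * w)"
    unfolding theta_ld_def qe_minus q_def[symmetric] w_def[symmetric] using q(2) by simp
  also have "\<dots> = - theta_ld \<tau> u"
    unfolding 1 2 3 theta_ld_def q_def[symmetric] w_def[symmetric] by (simp add: algebra_simps)
  finally show ?thesis .
qed

text \<open>A pole of the first sum means q^n w = 1, one of the second q^(n+1) = w; either equation
  puts u into the lattice.\<close>

lemma theta_ld_differentiable:
  assumes "Im \<tau> > 0" "u \<notin> lattice \<tau>"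
  shows "theta_ld \<tau> field_differentiable (at u)"
proof -
  define q where "q = qe \<tau>"
  have q: "norm q < 1" "q \<noteq> 0" using assms by (auto simp: q_def)
  have 1: "q ^ n * qe u \<noteq> 1" for n
  proof
    assume "q ^ n * qe u = 1"
    hence "qe (of_nat n * \<tau> + u) = 1" unfolding qe_add q_def by (simp only: qe_power)
    then obtain m where "of_nat n * \<tau> + u = of_int m" by (auto simp: qe_eq_1_iff)
    hence "u = of_int (- int n) * \<tau> + of_int m" by (simp add: algebra_simps)
    thus False using assms(2) unfolding lattice_def by blast
  qed
  have 2: "q ^ n * (q * qe (- u)) \<noteq> 1" for n
  proof
    assume "q ^ n * (q * qe (- u)) = 1"
    hence "q ^ Suc n * qe (- u) = 1" by (simp add: mult_ac)
    hence "qe (of_nat (Suc n) * \<tau> + (- u)) = 1" unfolding qe_add q_def by (simp only: qe_power)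
    then obtain m where "of_nat (Suc n) * \<tau> + (- u) = of_int m" by (auto simp: qe_eq_1_iff)
    hence "u = of_int (int (Suc n)) * \<tau> + of_int (- m)" by (simp add: algebra_simps)
    thus False using assms(2) unfolding lattice_def by blast
  qed
  have "(lambert q \<circ> qe) field_differentiable (at u)"
    by (intro field_differentiable_compose lambert_differentiable q 1 holomorphic_on_imp_differentiable_at[of _ UNIV])
       (auto intro!: holomorphic_intros)
  moreover have "(lambert q \<circ> (\<lambda>u. q * qe (- u))) field_differentiable (at u)"
    by (intro field_differentiable_compose lambert_differentiable q 2 holomorphic_on_imp_differentiable_at[of _ UNIV])
       (auto intro!: holomorphic_intros)
  ultimately have "(\<lambda>u. - (of_real pi * \<i>) - 2 * of_real pi * \<i> * (lambert q \<circ> qe) u +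
     2 * of_real pi * \<i> * (lambert q \<circ> (\<lambda>u. q * qe (- u))) u) field_differentiable (at u)"
    by (intro derivative_intros field_differentiable_add field_differentiable_diff field_differentiable_mult field_differentiable_const)
  also have "(\<lambda>u. - (of_real pi * \<i>) - 2 * of_real pi * \<i> * (lambert q \<circ> qe) u +
     2 * of_real pi * \<i> * (lambert q \<circ> (\<lambda>u. q * qe (- u))) u) = theta_ld \<tau>"
    unfolding o_def qe_minus by (simp add: fun_eq_iff theta_ld_def q_def)
  finally show ?thesis .
qed

section \<open>Behaviour near the origin\<close>

definition cot_reg :: "complex \<Rightarrow> complex" where
  "cot_reg u = (if u = 0 then 0 else of_real pi * cot (of_real pi * u) - 1 / u)"

definition lambert_odd :: "complex \<Rightarrow> complex \<Rightarrow> complex" where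
  "lambert_odd q w = eval_fps (lambert_fps q) (q * w) - eval_fps (lambert_fps q) (q / w)"

text \<open>The right side is the constant of \<open>theta_ld\<close> together with the n = 0 term
  of its first sum. Splitting off the cotangent isolates the pole at 0 from a part that is regular
  there.\<close>

lemma pi_cot_eq:
  assumes "qe u \<noteq> 1"
  shows "of_real pi * cot (of_real pi * u) = - (of_real pi * \<i>) - 2 * of_real pi * \<i> * (qe u / (1 - qe u))"
proof -
  define x where "x = exp (\<i> * (of_real pi * u))"
  have x: "x \<noteq> 0" "qe u = x * x" unfolding x_def by (simp_all flip: exp_add add: algebra_simps)
  have x2: "x * x \<noteq> 1" using assms x by simp
  have x': "exp (- (\<i> * (of_real pi * u))) = 1 / x" by (simp add: x_def exp_minus inverse_eq_divide)
  have "cot (of_real pi * u) = ((x + 1 / x) / 2) / ((x - 1 / x) / (2 * \<i>))"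
    unfolding cot_def cos_exp_eq sin_exp_eq x' by (simp only: x_def)
  also have "\<dots> = \<i> * (x + 1 / x) / (x - 1 / x)"
  proof -
    have "(a / 2) / (b / (2 * \<i>)) = \<i> * a / b" for a b
      by (cases "b = 0") (simp_all add: field_simps)
    thus ?thesis .
  qed
  also have "\<dots> = \<i> * (x * x + 1) / (x * x - 1)"
  proof -
    have "x + 1 / x = (x * x + 1) / x" "x - 1 / x = (x * x - 1) / x" using x by (simp_all add: field_simps)
    thus ?thesis using x by simp
  qed
  also have "of_real pi * (\<i> * (x * x + 1) / (x * x - 1)) = - (of_real pi * \<i>) - 2 * of_real pi * \<i> * (x * x / (1 - x * x))"
    using x2 by (simp add: divide_simps) (simp add: algebra_simps)
  finally show ?thesis by (simp only: x)
qed

text \<open>In this strip both q w and q / w lie in the unit disc, so once the n = 0 term has become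
  the cotangent the rest is given by the power series themselves.\<close>

lemma theta_ld_strip:
  assumes "Im \<tau> > 0" "\<bar>Im u\<bar> < Im \<tau>" "u \<notin> lattice \<tau>"
  shows "theta_ld \<tau> u = of_real pi * cot (of_real pi * u) - 2 * of_real pi * \<i> * lambert_odd (qe \<tau>) (qe u)"
proof -
  define q w where "q = qe \<tau>" and "w = qe u"
  have q: "norm q < 1" using assms by (auto simp: q_def)
  have "q * w = qe (\<tau> + u)" "q / w = qe (\<tau> - u)" 
    unfolding q_def w_def by (simp_all only: qe_add, simp add: ring_distribs exp_diff)
  hence *: "norm (q * w) < 1" "norm (q / w) < 1" using assms(2) by auto
  have "w \<noteq> 1" using assms(3) lattice_int by (auto simp: w_def qe_eq_1_iff)
  have "theta_ld \<tau> u = - (of_real pi * \<i>) - 2 * of_real pi * \<i> * (w / (1 - w)) - 2 * of_real pi * \<i> * lambert_odd q w"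
    unfolding theta_ld_def q_def[symmetric] w_def[symmetric] lambert_functional[OF q, of w] lambert_odd_def
    using * q by (simp add: lambert_eq_0 algebra_simps)
  thus ?thesis using pi_cot_eq[of u] \<open>w \<noteq> 1\<close> by (simp add: w_def q_def)
qed

lemma lambert_odd_tendsto_0:
  assumes "Im \<tau> > 0"
  shows "((\<lambda>u. lambert_odd (qe \<tau>) (qe u)) \<longlongrightarrow> 0) (at 0)"
proof -
  define q where "q = qe \<tau>"
  have q: "norm q < 1" using assms by (simp add: q_def)
  have cont: "isCont (eval_fps (lambert_fps q)) q"
    using qconv_less_norm[OF qconv_lambert_fps[OF q] q] by (intro continuous_eval_fps)
  have "((\<lambda>u. qe u) \<longlongrightarrow> qe 0) (at 0)" by (intro tendsto_intros)
  hence "((\<lambda>u. q * qe u) \<longlongrightarrow> q) (at 0)" "((\<lambda>u. q / qe u) \<longlongrightarrow> q) (at 0)"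
    by (auto intro!: tendsto_eq_intros)
  hence "((\<lambda>u. lambert_odd q (qe u)) \<longlongrightarrow> eval_fps (lambert_fps q) q - eval_fps (lambert_fps q) q) (at 0)"
    unfolding lambert_odd_def by (intro tendsto_diff isCont_tendsto_compose[OF cont])
  thus ?thesis by (simp add: q_def)
qed

text \<open>\<open>cot_reg\<close> is the quotient of pi u cos(pi u) - sin(pi u), of order 3 at 0,
  by u sin(pi u), of order 2. The expansion is characterised by the cleared product, from which its
  coefficients are solved for later.\<close>

lemma cot_reg_has_fps_expansion:
  obtains H where "cot_reg has_fps_expansion H" 
    "H * (fps_X * fps_sin (of_real pi)) = fps_const (of_real pi) * fps_X * fps_cos (of_real pi) - fps_sin (of_real pi)"
proof -
  define N where "N = fps_const (of_real pi) * fps_X * fps_cos (of_real pi) - fps_sin (of_real pi :: complex)"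
  define D where "D = fps_X * fps_sin (of_real pi :: complex)"
  have D2: "fps_nth D 2 = of_real pi" by (simp add: D_def numeral_2_eq_2 fps_sin_def)
  have D_small: "fps_nth D i = 0" if "i < 2" for i
    using that by (auto simp: D_def less_2_cases_iff fps_sin_def)
  have sub_D: "subdegree D = 2" by (rule subdegreeI) (use D2 D_small in auto)
  have N_small: "fps_nth N i = 0" if "i < 3" for i
  proof -
    have "i = 0 \<or> i = 1 \<or> i = 2" using that by auto
    thus ?thesis by (auto simp: N_def fps_sin_def fps_cos_def numeral_2_eq_2 mult.assoc)
  qed
  have N2: "N = 0 \<or> subdegree N \<ge> 2" using N_small by (auto intro!: subdegree_geI)
  have "N \<noteq> 0"
  proof
    assume "N = 0"
    hence "fps_nth N 3 = 0" by simp
    thus False by (simp add: N_def fps_sin_def fps_cos_def numeral_3_eq_3 mult.assoc fact_numeral)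
  qed
  have "(\<lambda>u. of_real pi * u * cos (of_real pi * u) - sin (of_real pi * u)) has_fps_expansion N"
    unfolding N_def by (intro fps_expansion_intros)
  moreover have "(\<lambda>u. u * sin (of_real pi * u)) has_fps_expansion D"
    unfolding D_def by (intro fps_expansion_intros)
  ultimately have *: "(\<lambda>u. if u = 0 then 0 else (of_real pi * u * cos (of_real pi * u) - sin (of_real pi * u)) / (u * sin (of_real pi * u))) 
     has_fps_expansion (N / D)"
    using N2 \<open>N \<noteq> 0\<close> N_small[of 2] sub_D D2 by (intro has_fps_expansion_divide) auto
  have "cot_reg has_fps_expansion (N / D)"
  proof (rule has_fps_expansion_cong[THEN iffD1, OF _ refl *])
    have "\<forall>\<^sub>F u in nhds (0::complex). u \<in> ball 0 1" by (intro eventually_nhds_in_open) auto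
    thus "\<forall>\<^sub>F u in nhds 0. (if u = 0 then 0 else (of_real pi * u * cos (of_real pi * u) - sin (of_real pi * u)) / (u * sin (of_real pi * u))) = cot_reg u"
    proof eventually_elim
      case (elim u)
      show ?case
      proof (cases "u = 0")
        case False
        have "sin (of_real pi * u) \<noteq> 0"
        proof
          assume "sin (of_real pi * u) = 0"
          then obtain n where "of_real pi * u = of_real (of_int n * pi)" by (auto simp: sin_eq_0)
          hence u: "u = of_int n" by (simp add: mult.commute)
          hence "\<bar>real_of_int n\<bar> < 1" using elim by simp
          hence "n = 0" by linarith
          thus False using u False by simp
        qed
        thus ?thesis using False by (simp add: cot_reg_def cot_def diff_divide_distrib)
      qed (simp add: cot_reg_def)
    qed
  qed
  moreover have "N / D * D = N" using N2 sub_D D2 \<open>N \<noteq> 0\<close> by (intro dvd_div_mult_self, subst fps_dvd_iff) auto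
  ultimately show ?thesis using that unfolding N_def D_def by blast
qed

text \<open>The imaginary part of a short lattice vector forces m = 0, and then its real part forces
  n = 0.\<close>

lemma lattice_discrete:
  assumes "Im \<tau> > 0" "x \<in> lattice \<tau>" "norm x < min 1 (Im \<tau>)"
  shows "x = 0"
proof -
  obtain m n where x: "x = of_int m * \<tau> + of_int n" using assms(2) by (auto simp: lattice_def)
  have "\<bar>Im x\<bar> < Im \<tau>" using abs_Im_le_cmod[of x] assms(3) by linarith
  hence "\<bar>real_of_int m\<bar> * Im \<tau> < 1 * Im \<tau>" using assms(1) by (simp add: x abs_mult)
  hence "\<bar>real_of_int m\<bar> < 1" using assms(1) by (subst (asm) mult_less_cancel_right_pos)
  hence m: "m = 0" by linarith
  have "\<bar>Re x\<bar> < 1" using abs_Re_le_cmod[of x] assms(3) by linarith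
  hence "\<bar>real_of_int n\<bar> < 1" by (simp add: x m)
  hence "n = 0" by linarith
  thus ?thesis by (simp add: x m)
qed

lemma closed_lattice:
  assumes "Im \<tau> > 0"
  shows "closed (lattice \<tau>)"
proof (rule discrete_imp_closed[of "min 1 (Im \<tau>)"])
  show "\<forall>x\<in>lattice \<tau>. \<forall>y\<in>lattice \<tau>. dist y x < min 1 (Im \<tau>) \<longrightarrow> y = x"
  proof (intro ballI impI)
    fix x y assume xy: "x \<in> lattice \<tau>" "y \<in> lattice \<tau>" "dist y x < min 1 (Im \<tau>)"
    have "y + (- x) \<in> lattice \<tau>" by (intro lattice_add lattice_minus xy)
    thus "y = x" using lattice_discrete[of \<tau> "y - x"] xy(3) assms by (simp add: dist_norm)
  qed
qed (use assms in auto)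

lemma theta_ld_near_0:
  assumes "Im \<tau> > 0" "u \<noteq> 0" "norm u < min 1 (Im \<tau>)"
  shows "u \<notin> lattice \<tau>" 
    "theta_ld \<tau> u = 1 / u + cot_reg u - 2 * of_real pi * \<i> * lambert_odd (qe \<tau>) (qe u)"
proof -
  show *: "u \<notin> lattice \<tau>" using lattice_discrete assms by blast
  have "\<bar>Im u\<bar> < Im \<tau>" using abs_Im_le_cmod[of u] assms(3) by linarith
  from theta_ld_strip[OF assms(1) this *] assms(2)
  show "theta_ld \<tau> u = 1 / u + cot_reg u - 2 * of_real pi * \<i> * lambert_odd (qe \<tau>) (qe u)"
    by (simp add: cot_reg_def)
qed

lemma theta_ld_regular_tendsto:
  assumes "Im \<tau> > 0"
  shows "((\<lambda>u. theta_ld \<tau> u - 1 / u) \<longlongrightarrow> 0) (at 0)"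
proof -
  obtain H where "cot_reg has_fps_expansion H" using cot_reg_has_fps_expansion by blast
  hence "isCont cot_reg 0" by (rule has_fps_expansion_imp_continuous)
  hence "(cot_reg \<longlongrightarrow> 0) (at 0)" by (simp add: isCont_def cot_reg_def)
  hence "((\<lambda>u. cot_reg u - 2 * of_real pi * \<i> * lambert_odd (qe \<tau>) (qe u)) \<longlongrightarrow> 0 - 2 * of_real pi * \<i> * 0) (at 0)"
    by (intro tendsto_intros lambert_odd_tendsto_0 assms)
  also have "?this \<longleftrightarrow> ((\<lambda>u. theta_ld \<tau> u - 1 / u) \<longlongrightarrow> 0 - 2 * of_real pi * \<i> * 0) (at 0)"
  proof (rule filterlim_cong[OF refl refl])
    have "\<forall>\<^sub>F u in at (0::complex). u \<noteq> 0 \<and> norm u < min 1 (Im \<tau>)"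
      unfolding eventually_at by (rule exI[of _ "min 1 (Im \<tau>)"]) (use assms in auto)
    thus "\<forall>\<^sub>F u in at 0. cot_reg u - 2 * of_real pi * \<i> * lambert_odd (qe \<tau>) (qe u) = theta_ld \<tau> u - 1 / u"
      by eventually_elim (simp add: theta_ld_near_0(2)[OF assms])
  qed
  finally show ?thesis by simp
qed

text \<open>
  The difference of the two sides is an entire elliptic function: the poles cancel and so do the
  quasi-periods. Hence it is constant, and its value at 0 is 0.
\<close>

theorem theta_ld_transform:
  assumes SL: "(a, b, c, d) \<in> SL2Z" and \<tau>: "Im \<tau> > 0" and u: "u \<notin> lattice \<tau>"
  defines "j \<equiv> of_int c * \<tau> + of_int d"
  shows "theta_ld (moebius_map (a, b, c, d) \<tau>) (u / j) = j * theta_ld \<tau> u + 2 * of_real pi * \<i> * of_int c * u"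
proof -
  define \<tau>' where "\<tau>' = moebius_map (a, b, c, d) \<tau>"
  have det: "a * d - b * c = 1" using SL by (simp add: SL2Z_iff)
  have det': "of_int a * of_int d - of_int b * of_int c = (1 :: complex)"
    using arg_cong[OF det, of of_int] by simp
  have j: "j \<noteq> 0" using aut_factor_nonzero[of \<tau> "(a, b, c, d)"] \<tau> det by (simp add: j_def)
  have \<tau>': "Im \<tau>' > 0" unfolding \<tau>'_def using \<tau> det by (intro moebius_in_H) auto
  have \<tau>'_eq: "\<tau>' = (of_int a * \<tau> + of_int b) / j" by (simp add: \<tau>'_def j_def)
  have tau'_j: "\<tau>' * j = of_int a * \<tau> + of_int b" using j by (simp add: \<tau>'_eq)
  \<comment> \<open>Together with \<open>tau_j\<close> this says that division by j maps the lattice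
    of \<tau> onto the lattice of \<tau>', with quasi-periods that can be read off from the
    coefficients of \<tau>'.\<close>
  have one_j: "1 / j = of_int (- c) * \<tau>' + of_int a"
  proof -
    have "(of_int (- c) * \<tau>' + of_int a) * j = of_int a * j - of_int c * (of_int a * \<tau> + of_int b)"
      by (simp add: ring_distribs mult.assoc tau'_j)
    also have "\<dots> = 1" using det' by (simp add: j_def algebra_simps)
    finally show ?thesis using j by (simp add: field_simps)
  qed
  have tau_j: "\<tau> / j = of_int d * \<tau>' + of_int (- b)"
  proof -
    have "(of_int d * \<tau>' + of_int (- b)) * j = of_int d * (of_int a * \<tau> + of_int b) - of_int b * j"
      by (simp add: ring_distribs mult.assoc tau'_j)
    also have "\<dots> = (of_int a * of_int d - of_int b * of_int c) * \<tau>" by (simp add: j_def algebra_simps)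
    finally show ?thesis using j det' by (simp add: field_simps)
  qed
  have lat: "v / j \<in> lattice \<tau>' \<longleftrightarrow> v \<in> lattice \<tau>" for v
  proof
    assume "v \<in> lattice \<tau>"
    then obtain m n where "v = of_int m * \<tau> + of_int n" by (auto simp: lattice_def)
    hence "v / j = of_int m * (\<tau> / j) + of_int n * (1 / j)" by (simp add: add_divide_distrib)
    also have "\<dots> = of_int (m * d - n * c) * \<tau>' + of_int (n * a - m * b)"
      unfolding one_j tau_j by (simp add: algebra_simps)
    finally show "v / j \<in> lattice \<tau>'" unfolding lattice_def by blast
  next
    assume "v / j \<in> lattice \<tau>'"
    then obtain m n where "v / j = of_int m * \<tau>' + of_int n" by (auto simp: lattice_def)
    hence "v = of_int m * (\<tau>' * j) + of_int n * j" using j by (simp add: field_simps)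
    also have "\<tau>' * j = of_int a * \<tau> + of_int b" using j by (simp add: \<tau>'_eq)
    also have "of_int m * (of_int a * \<tau> + of_int b) + of_int n * j = 
      of_int (m * a + n * c) * \<tau> + of_int (m * b + n * d)" by (simp add: j_def algebra_simps)
    finally show "v \<in> lattice \<tau>" unfolding lattice_def by blast
  qed
  \<comment> \<open>The value 0 on the lattice is the limit of the expression there, so it fills the
    singularities rather than creating a jump.\<close>
  define D where "D = (\<lambda>u. if u \<in> lattice \<tau> then 0 else theta_ld \<tau>' (u / j) / j - theta_ld \<tau> u - 2 * of_real pi * \<i> * of_int c * u / j)"
  have D_add_1: "D (u + 1) = D u" for u
  proof (cases "u \<in> lattice \<tau>")
    case False
    have "theta_ld \<tau>' ((u + 1) / j) = theta_ld \<tau>' (u / j + of_int (- c) * \<tau>' + of_int a)"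
      unfolding add_divide_distrib one_j by (simp only: add.assoc)
    also have "\<dots> = theta_ld \<tau>' (u / j) + 2 * of_real pi * \<i> * of_int c"
      using False lat[of u] by (subst theta_ld_add_lattice[OF \<tau>']) auto
    finally show ?thesis
      using theta_ld_add_int[of \<tau> u 1] lattice_add_iff[OF lattice_int[of 1 \<tau>], of u]
      by (simp add: D_def add_divide_distrib ring_distribs)
  next
    case True
    thus ?thesis using lattice_add_iff[OF lattice_int[of 1 \<tau>], of u] by (simp add: D_def)
  qed
  have tau_lat: "\<tau> \<in> lattice \<tau>" unfolding lattice_def by (intro CollectI exI[of _ 1] exI[of _ 0]) simp
  have D_add_tau: "D (u + \<tau>) = D u" for u
  proof (cases "u \<in> lattice \<tau>")
    case False
    have "theta_ld \<tau>' ((u + \<tau>) / j) = theta_ld \<tau>' (u / j + of_int d * \<tau>' + of_int (- b))"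
      unfolding add_divide_distrib tau_j by (simp only: add.assoc)
    also have "\<dots> = theta_ld \<tau>' (u / j) - 2 * of_real pi * \<i> * of_int d"
      using False lat[of u] by (subst theta_ld_add_lattice[OF \<tau>']) auto
    finally have eq: "theta_ld \<tau>' ((u + \<tau>) / j) = theta_ld \<tau>' (u / j) - 2 * of_real pi * \<i> * of_int d" .
    \<comment> \<open>The quasi-periods cancel because - d / j + 1 - c \<tau> / j = 0 for j = c
      \<tau> + d.\<close>
    have "- 2 * of_real pi * \<i> * of_int d / j + 2 * of_real pi * \<i> - 2 * of_real pi * \<i> * of_int c * \<tau> / j
       = 2 * of_real pi * \<i> * (1 - (of_int c * \<tau> + of_int d) / j)"
      by (simp add: add_divide_distrib algebra_simps)
    also have "\<dots> = 0" using j by (simp add: j_def)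
    finally have *: "- 2 * of_real pi * \<i> * of_int d / j + 2 * of_real pi * \<i> - 2 * of_real pi * \<i> * of_int c * \<tau> / j = 0" .
    have "D (u + \<tau>) = D u + (- 2 * of_real pi * \<i> * of_int d / j + 2 * of_real pi * \<i> - 2 * of_real pi * \<i> * of_int c * \<tau> / j)"
      using False lattice_add_iff[OF tau_lat, of u]
      by (simp add: D_def eq[unfolded add_divide_distrib] theta_ld_add_tau[OF \<tau>] add_divide_distrib diff_divide_distrib ring_distribs)
    thus ?thesis unfolding * by simp
  next
    case True
    thus ?thesis using lattice_add_iff[OF tau_lat, of u] by (simp add: D_def)
  qed
  have D_add_int: "D (u + of_int n) = D u" for u n
  proof (induction n)
    case (nonneg n)
    show ?case
    proof (induction n)
      case (Suc n)
      thus ?case using D_add_1[of "u + of_nat n"] by (simp add: add_ac)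
    qed auto
  next
    case (neg n)
    show ?case
    proof (induction n)
      case 0
      show ?case using D_add_1[of "u - 1"] by simp
    next
      case (Suc n)
      thus ?case using D_add_1[of "u - 1 - 1 - of_nat n"] by (simp add: algebra_simps)
    qed
  qed
  have D_add_int_tau: "D (u + of_int n * \<tau>) = D u" for u n
  proof (induction n)
    case (nonneg n)
    show ?case
    proof (induction n)
      case (Suc n)
      thus ?case using D_add_tau[of "u + of_nat n * \<tau>"] by (simp add: algebra_simps)
    qed auto
  next
    case (neg n)
    show ?case
    proof (induction n)
      case 0
      show ?case using D_add_tau[of "u - \<tau>"] by simp
    next
      case (Suc n)
      thus ?case using D_add_tau[of "u - \<tau> - \<tau> - of_nat n * \<tau>"] by (simp add: algebra_simps)
    qed
  qed
  have D_diff: "D (u - l) = D u" if l: "l \<in> lattice \<tau>" for u l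
  proof -
    obtain m n where mn: "- l = of_int m * \<tau> + of_int n"
      using lattice_minus[OF l] by (auto simp: lattice_def)
    have "u - l = u + of_int m * \<tau> + of_int n"
      unfolding diff_conv_add_uminus mn by (simp only: add.assoc)
    thus ?thesis by (simp only: D_add_int D_add_int_tau)
  qed
  \<comment> \<open>Both theta terms have principal part 1 / u at 0, and their regular parts tend to
    0.\<close>
  have D_lim_0: "(D \<longlongrightarrow> 0) (at 0)"
  proof -
    have ev: "\<forall>\<^sub>F u in at (0::complex). u \<noteq> 0 \<and> norm u < min 1 (Im \<tau>)"
      unfolding eventually_at by (rule exI[of _ "min 1 (Im \<tau>)"]) (use \<tau> in auto)
    have "filterlim (\<lambda>u. u / j) (at 0) (at 0)"
      unfolding filterlim_at using j by (auto intro!: tendsto_eq_intros simp: eventually_at_filter)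
    hence "((\<lambda>u. theta_ld \<tau>' (u / j) - 1 / (u / j)) \<longlongrightarrow> 0) (at 0)"
      using filterlim_compose[OF theta_ld_regular_tendsto[OF \<tau>']] by blast
    hence "((\<lambda>u. (theta_ld \<tau>' (u / j) - 1 / (u / j)) / j - (theta_ld \<tau> u - 1 / u) - 2 * of_real pi * \<i> * of_int c * u / j) \<longlongrightarrow> 
      0 / j - 0 - 2 * of_real pi * \<i> * of_int c * 0 / j) (at 0)"
      using j by (intro tendsto_intros theta_ld_regular_tendsto \<tau>)
    also have "?this \<longleftrightarrow> (D \<longlongrightarrow> 0 / j - 0 - 2 * of_real pi * \<i> * of_int c * 0 / j) (at 0)"
    proof (rule filterlim_cong[OF refl refl])
      show "\<forall>\<^sub>F u in at 0. (theta_ld \<tau>' (u / j) - 1 / (u / j)) / j - (theta_ld \<tau> u - 1 / u) - 2 * of_real pi * \<i> * of_int c * u / j = D u"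
        using ev
      proof eventually_elim
        case (elim u)
        thus ?case using theta_ld_near_0(1)[OF \<tau>, of u] j by (simp add: D_def diff_divide_distrib)
      qed
    qed
    finally show ?thesis by simp
  qed
  have D_diffable: "D field_differentiable (at u)" if "u \<notin> lattice \<tau>" for u
  proof -
    have op: "open (- lattice \<tau>)" using closed_lattice[OF \<tau>] by (simp add: open_Compl)
    have "(theta_ld \<tau>' \<circ> (\<lambda>u. u / j)) field_differentiable (at u)" if "u \<notin> lattice \<tau>" for u
      using that lat[of u] j
      by (intro field_differentiable_compose theta_ld_differentiable \<tau>' holomorphic_on_imp_differentiable_at[of _ UNIV])
         (auto intro!: holomorphic_intros)
    hence "(theta_ld \<tau>' \<circ> (\<lambda>u. u / j)) holomorphic_on (- lattice \<tau>)"
      unfolding holomorphic_on_def using field_differentiable_at_within by blast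
    moreover have "theta_ld \<tau> holomorphic_on (- lattice \<tau>)"
      unfolding holomorphic_on_def using field_differentiable_at_within theta_ld_differentiable[OF \<tau>] by blast
    ultimately have "(\<lambda>u. (theta_ld \<tau>' \<circ> (\<lambda>u. u / j)) u / j - theta_ld \<tau> u - 2 * of_real pi * \<i> * of_int c * u / j) holomorphic_on (- lattice \<tau>)"
      using j by (intro holomorphic_intros)
    hence "D holomorphic_on (- lattice \<tau>)"
      by (rule holomorphic_transform) (auto simp: D_def)
    thus ?thesis using op that holomorphic_on_imp_differentiable_at by blast
  qed
  have "D holomorphic_on UNIV"
  proof -
    \<comment> \<open>Invariance under the lattice carries the limit 0 at the origin to l, where the
      singularity is then removable.\<close>
    have "D field_differentiable (at l)" if l: "l \<in> lattice \<tau>" for l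
    proof -
      define r where "r = min 1 (Im \<tau>)"
      have r: "r > 0" using \<tau> by (simp add: r_def)
      have "D holomorphic_on ball l r"
      proof (rule no_isolated_singularity'[of "{l}"])
        fix z assume z: "z \<in> {l}"
        have "filterlim (\<lambda>u. u - l) (at 0) (at l)"
          unfolding filterlim_at by (auto intro!: tendsto_eq_intros simp: eventually_at_filter)
        hence "((\<lambda>u. D (u - l)) \<longlongrightarrow> 0) (at l)" by (rule filterlim_compose[OF D_lim_0])
        hence "(D \<longlongrightarrow> D l) (at l)" unfolding D_diff[OF l] using l by (simp add: D_def)
        thus "(D \<longlongrightarrow> D z) (at z within ball l r)" using z tendsto_within_subset by blast
      next
        have "u \<notin> lattice \<tau>" if "u \<in> ball l r - {l}" for u
        proof
          assume "u \<in> lattice \<tau>"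
          hence "u + (- l) \<in> lattice \<tau>" by (intro lattice_add lattice_minus l)
          thus False using lattice_discrete[OF \<tau>, of "u - l"] that 
            by (auto simp: r_def dist_norm norm_minus_commute)
        qed
        thus "D holomorphic_on ball l r - {l}" using D_diffable
          unfolding holomorphic_on_def by (blast intro: field_differentiable_at_within)
      qed auto
      moreover have "l \<in> ball l r" using r by simp
      ultimately show ?thesis using holomorphic_on_imp_differentiable_at open_ball by blast
    qed
    thus ?thesis using D_diffable by (auto simp: holomorphic_on_def)
  qed
  moreover have "bounded (range D)"
  proof -
    \<comment> \<open>A closed period parallelogram: it is compact and already takes all values of
      \<open>D\<close>.\<close>
    define K where "K = (\<lambda>(s, t). of_real s * \<tau> + of_real t) ` ({0..1} \<times> {0..1::real})"
    have "compact K" unfolding K_def case_prod_unfold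
      by (intro compact_continuous_image continuous_intros compact_Times compact_Icc)
    moreover have "continuous_on K D" using \<open>D holomorphic_on UNIV\<close>
      by (meson holomorphic_on_imp_continuous_on continuous_on_subset subset_UNIV)
    ultimately have "bounded (D ` K)" by (intro compact_imp_bounded compact_continuous_image)
    moreover have "range D \<subseteq> D ` K"
    proof safe
      fix u
      define s where "s = Im u / Im \<tau>"
      define t where "t = Re u - s * Re \<tau>"
      have u: "u = of_real s * \<tau> + of_real t" using \<tau> by (simp add: complex_eq_iff s_def t_def)
      have "D (of_real (frac s) * \<tau> + of_real (frac t)) = D (of_real (frac s) * \<tau> + of_real (frac t) + of_int \<lfloor>s\<rfloor> * \<tau> + of_int \<lfloor>t\<rfloor>)"
        by (simp only: D_add_int D_add_int_tau)
      also have "of_real (frac s) * \<tau> + of_real (frac t) + of_int \<lfloor>s\<rfloor> * \<tau> + of_int \<lfloor>t\<rfloor> = u"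
        by (simp add: u frac_def algebra_simps)
      finally have "D u = D (of_real (frac s) * \<tau> + of_real (frac t))" ..
      moreover have "of_real (frac s) * \<tau> + of_real (frac t) \<in> K"
        unfolding K_def by (rule image_eqI[of _ _ "(frac s, frac t)"]) (auto simp: less_imp_le frac_lt_1)
      ultimately show "D u \<in> D ` K" by blast
    qed
    ultimately show ?thesis using bounded_subset by blast
  qed
  ultimately have "D constant_on UNIV" by (rule Liouville_theorem)
  hence "D u = D 0" by (auto simp: constant_on_def)
  also have "D 0 = 0" by (simp add: D_def)
  finally have "theta_ld \<tau>' (u / j) / j = theta_ld \<tau> u + 2 * of_real pi * \<i> * of_int c * u / j"
    using u by (simp add: D_def diff_eq_eq add.commute)
  hence "j * (theta_ld \<tau>' (u / j) / j) = j * theta_ld \<tau> u + 2 * of_real pi * \<i> * of_int c * u"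
    using j by (simp add: distrib_left)
  thus ?thesis using j by (simp add: \<tau>'_def)
qed

section \<open>Divisor sums as Lambert series\<close>

lemma qconv_power_mult:
  assumes "qconv F"
  shows "qconv (Abs_fps (\<lambda>n. of_nat n ^ k * fps_nth F n))"
proof (induction k)
  case (Suc k)
  define G where "G = Abs_fps (\<lambda>n. of_nat n ^ k * fps_nth F n)"
  have "qconv (fps_deriv G)" using Suc fps_conv_radius_deriv[of G] 
    by (auto simp: qconv_def G_def intro: order_trans)
  hence "qconv (fps_X * fps_deriv G)" by (intro qconv_mult) (auto simp: qconv_def)
  also have "fps_X * fps_deriv G = Abs_fps (\<lambda>n. of_nat n ^ Suc k * fps_nth F n)"
    by (rule fps_ext) (auto simp: G_def mult_ac gr0_conv_Suc)
  finally show ?case .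
qed (use assms in \<open>simp add: fps_nth_inverse\<close>)

lemma qconv_coeff_bound:
  fixes x :: complex
  assumes "\<And>n. norm (fps_nth F n) \<le> C * of_nat n ^ k"
  shows "qconv F" "norm x < 1 \<Longrightarrow> summable (\<lambda>n. C * of_nat n ^ k * norm x ^ n)"
proof -
  have sum: "summable (\<lambda>n. C * of_nat n ^ k * norm x ^ n)" if x: "norm x < 1" for x :: complex
  proof -
    have "qconv (Abs_fps (\<lambda>n. of_nat n ^ k * fps_nth (Abs_fps (\<lambda>_. 1)) n))"
      by (rule qconv_power_mult) (auto intro: qconv_bounded[of _ 1])
    from qconv_less_norm[OF this x] have "summable (\<lambda>n. norm (of_nat n ^ k * x ^ n))"
      by (intro abs_summable_in_conv_radius) (simp add: fps_conv_radius_def)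
    hence "summable (\<lambda>n. C * norm (of_nat n ^ k * x ^ n))" by (rule summable_mult)
    thus ?thesis by (simp add: norm_mult norm_power mult_ac)
  qed
  show "norm x < 1 \<Longrightarrow> summable (\<lambda>n. C * of_nat n ^ k * norm x ^ n)" by (rule sum)
  show "qconv F"
  proof (rule qconvI)
    fix x :: complex assume "norm x < 1"
    from sum[OF this] show "summable (\<lambda>n. fps_nth F n * x ^ n)"
      by (rule summable_comparison_test'[where N = 0]) 
         (use assms in \<open>auto simp: norm_mult norm_power intro!: mult_right_mono\<close>)
  qed
qed

text \<open>Both sides rearrange the double series of g(m) q^(m n) over m, n \<ge> 1. Summing over n
  first gives geometric series, grouping by the product m n gives divisor sums.\<close>

theorem lambert_sums:
  assumes q: "norm q < 1" and g: "\<And>m. norm (g m) \<le> C * of_nat m ^ k"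
  shows "(\<lambda>m. g m * (q ^ m / (1 - q ^ m))) sums eval_fps (divisor_sum_series g) q"
    and "summable (\<lambda>n. fps_nth (divisor_sum_series g) n * q ^ n)"
proof -
  have C: "C * of_nat m ^ k \<ge> 0" for m using order_trans[OF norm_ge_zero g] .
  define A where "A = {1::nat..}"
  define f where "f = (\<lambda>(m, n). g m * q ^ (m * n))"
  \<comment> \<open>The majorant: its inner sums are geometric and its outer sum is dominated by C
    m^k |q|^m / (1 - |q|), which gives absolute summability of the double series.\<close>
  define f' where "f' = (\<lambda>(m, n). C * of_nat m ^ k * norm q ^ (m * n))"
  have qm: "norm (q ^ m) < 1" if "m \<in> A" for m
    using that q power_less_one_iff[of "norm q" m] by (auto simp: A_def norm_power)
  have inner: "((\<lambda>n. f (m, n)) has_sum g m * (q ^ m / (1 - q ^ m))) A" if "m \<in> A" for m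
    unfolding f_def A_def prod.case power_mult
    by (intro has_sum_cmult_right has_sum_geometric_from_1 qm that)
  have inner': "((\<lambda>n. f' (m, n)) has_sum C * of_nat m ^ k * (norm q ^ m / (1 - norm q ^ m))) A" if "m \<in> A" for m
    unfolding f'_def A_def prod.case power_mult
    using qm[OF that] by (intro has_sum_cmult_right has_sum_geometric_from_1) (simp add: norm_power)
  have "(\<lambda>m. C * of_nat m ^ k * (norm q ^ m / (1 - norm q ^ m))) summable_on A"
  proof -
    have "summable (\<lambda>m. C * of_nat m ^ k * norm q ^ m)"
      using qconv_coeff_bound(2)[of "Abs_fps g" C k q] g q by simp
    hence "summable (\<lambda>m. 1 / (1 - norm q) * (C * of_nat m ^ k * norm q ^ m))" by (rule summable_mult)
    hence "(\<lambda>m. 1 / (1 - norm q) * (C * of_nat m ^ k * norm q ^ m)) summable_on UNIV"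
      using C q by (intro summable_nonneg_imp_summable_on) (auto intro!: mult_nonneg_nonneg)
    hence "(\<lambda>m. 1 / (1 - norm q) * (C * of_nat m ^ k * norm q ^ m)) summable_on A"
      by (rule summable_on_subset_banach) auto
    hence "(\<lambda>m. norm (C * of_nat m ^ k * (norm q ^ m / (1 - norm q ^ m)))) summable_on A"
    proof (rule Infinite_Sum.abs_summable_on_comparison_test')
      fix m assume m: "m \<in> A"
      have "norm q ^ m \<le> norm q" using m q power_decreasing[of 1 m "norm q"] by (simp add: A_def)
      hence "norm q ^ m / (1 - norm q ^ m) \<le> norm q ^ m / (1 - norm q)"
        using q by (intro divide_left_mono mult_pos_pos) auto
      hence "C * of_nat m ^ k * (norm q ^ m / (1 - norm q ^ m)) \<le> C * of_nat m ^ k * (norm q ^ m / (1 - norm q))"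
        using C by (intro mult_left_mono) auto
      moreover have "norm q ^ m / (1 - norm q ^ m) \<ge> 0" using qm[OF m] by (simp add: norm_power)
      hence "C * of_nat m ^ k * (norm q ^ m / (1 - norm q ^ m)) \<ge> 0" using C by (rule mult_nonneg_nonneg[rotated])
      ultimately show "norm (C * of_nat m ^ k * (norm q ^ m / (1 - norm q ^ m))) \<le> 1 / (1 - norm q) * (C * of_nat m ^ k * norm q ^ m)"
        unfolding real_norm_def by (subst abs_of_nonneg) (simp_all add: mult_ac)
    qed
    thus ?thesis using summable_on_iff_abs_summable_on_real by fast
  qed
  hence "f' summable_on (A \<times> A)"
    using inner' C by (intro summable_on_SigmaI) (auto simp: f'_def)
  hence "(\<lambda>x. norm (f x)) summable_on (A \<times> A)"
    by (rule Infinite_Sum.abs_summable_on_comparison_test') 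
       (auto simp: f_def f'_def norm_mult norm_power intro!: mult_right_mono g)
  hence "f summable_on (A \<times> A)" by (rule abs_summable_summable)
  then obtain S where S: "(f has_sum S) (A \<times> A)" by (auto simp: summable_on_def)
  have "((\<lambda>m. g m * (q ^ m / (1 - q ^ m))) has_sum S) A"
    using S inner by (rule has_sum_SigmaD)
  \<comment> \<open>The term m = 0 is 0 by the convention x / 0 = 0, since 1 - q^0 = 0; so the sum
    over all naturals agrees with the one from 1 on.\<close>
  also have "?this \<longleftrightarrow> ((\<lambda>m. g m * (q ^ m / (1 - q ^ m))) has_sum S) UNIV"
    by (intro has_sum_cong_neutral) (auto simp: A_def not_le)
  finally have 1: "(\<lambda>m. g m * (q ^ m / (1 - q ^ m))) sums S" by (rule has_sum_imp_sums)
  define h where "h = (\<lambda>(N, d). g d * q ^ N)"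
  have "(f has_sum S) (A \<times> A) \<longleftrightarrow> (h has_sum S) (Sigma A (\<lambda>N. {d. d dvd N}))"
    by (rule has_sum_reindex_bij_witness[where j = "\<lambda>(m, n). (m * n, m)" and i = "\<lambda>(N, d). (d, N div d)"])
       (auto simp: A_def h_def f_def elim!: dvdE)
  with S have "(h has_sum S) (Sigma A (\<lambda>N. {d. d dvd N}))" by simp
  moreover have "((\<lambda>d. h (N, d)) has_sum (\<Sum>d | d dvd N. g d * q ^ N)) {d. d dvd N}" if "N \<in> A" for N
    using that by (intro has_sum_finiteI) (auto simp: h_def A_def)
  ultimately have "((\<lambda>N. \<Sum>d | d dvd N. g d * q ^ N) has_sum S) A" by (rule has_sum_SigmaD)
  also have "?this \<longleftrightarrow> ((\<lambda>N. fps_nth (divisor_sum_series g) N * q ^ N) has_sum S) UNIV"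
    by (intro has_sum_cong_neutral) (auto simp: A_def not_le divisor_sum_series_def sum_distrib_right)
  finally have 2: "(\<lambda>N. fps_nth (divisor_sum_series g) N * q ^ N) sums S" by (rule has_sum_imp_sums)
  thus "summable (\<lambda>n. fps_nth (divisor_sum_series g) n * q ^ n)" by (simp add: sums_iff)
  show "(\<lambda>m. g m * (q ^ m / (1 - q ^ m))) sums eval_fps (divisor_sum_series g) q"
    using 1 2 by (simp add: eval_fps_def sums_iff)
qed

lemma qconv_divisor_sum_series:
  assumes "\<And>m. norm (g m) \<le> C * of_nat m ^ k"
  shows "qconv (divisor_sum_series g)"
  using lambert_sums(2)[OF _ assms] by (intro qconvI)

section \<open>Eisenstein series of weights 2, 4 and 6\<close>

text \<open>These are - 2 \<zeta>(2), - 2 \<zeta>(4) and - 2 \<zeta>(6). Only even coefficients of u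
  sin(pi u) are nonzero, so comparing coefficients at the orders 3, 5 and 7 is a triangular system
  for the odd coefficients of \<open>H\<close>.\<close>

lemma cot_reg_coeffs:
  obtains H where "cot_reg has_fps_expansion H" "fps_nth H 0 = 0" "fps_nth H 1 = - (of_real pi ^ 2 / 3)"
    "fps_nth H 3 = - (of_real pi ^ 4 / 45)" "fps_nth H 5 = - (2 * of_real pi ^ 6 / 945)"
proof -
  define p where "p = complex_of_real pi"
  have p: "p \<noteq> 0" by (simp add: p_def)
  obtain H where H: "cot_reg has_fps_expansion H"
    "H * (fps_X * fps_sin p) = fps_const p * fps_X * fps_cos p - fps_sin p"
    using cot_reg_has_fps_expansion unfolding p_def by blast
  define D where "D = fps_X * fps_sin p"
  define N where "N = fps_const p * fps_X * fps_cos p - fps_sin p"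
  have D: "fps_nth D 0 = 0" "fps_nth D 1 = 0" "fps_nth D 2 = p" "fps_nth D 3 = 0" 
    "fps_nth D 4 = - (p ^ 3 / 6)" "fps_nth D 5 = 0" "fps_nth D 6 = p ^ 5 / 120" "fps_nth D 7 = 0"
  proof -
    have *: "fps_nth D n = (if n = 0 then 0 else fps_nth (fps_sin p) (n - 1))" for n by (simp add: D_def)
    show "fps_nth D 0 = 0" "fps_nth D 1 = 0" "fps_nth D 2 = p" "fps_nth D 3 = 0" 
      "fps_nth D 4 = - (p ^ 3 / 6)" "fps_nth D 5 = 0" "fps_nth D 6 = p ^ 5 / 120" "fps_nth D 7 = 0"
      unfolding * by (simp_all add: fps_sin_def fact_numeral)
  qed
  have N: "fps_nth N 3 = - (p ^ 3 / 3)" "fps_nth N 5 = p ^ 5 / 30" "fps_nth N 7 = - (p ^ 7 / 840)"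
  proof -
    have *: "fps_nth N n = p * (if n = 0 then 0 else fps_nth (fps_cos p) (n - 1)) - fps_nth (fps_sin p) n" for n
      by (simp add: N_def mult.assoc)
    show "fps_nth N 3 = - (p ^ 3 / 3)" "fps_nth N 5 = p ^ 5 / 30" "fps_nth N 7 = - (p ^ 7 / 840)"
      unfolding * by (simp_all add: fps_sin_def fps_cos_def fact_numeral power_numeral_reduce)
  qed
  have eq: "(\<Sum>i=0..n. fps_nth H i * fps_nth D (n - i)) = fps_nth N n" for n
    using H(2) unfolding D_def[symmetric] N_def[symmetric] by (simp flip: fps_mult_nth)
  have sum3: "(\<Sum>i=0..3. f i * g (3 - i)) = f 0 * g 3 + f 1 * g 2 + f 2 * g 1 + f 3 * g 0" for f g :: "nat \<Rightarrow> complex"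
    by (simp add: numeral_eq_Suc sum.atLeast0_atMost_Suc)
  have sum5: "(\<Sum>i=0..5. f i * g (5 - i)) = f 0 * g 5 + f 1 * g 4 + f 2 * g 3 + f 3 * g 2 + f 4 * g 1 + f 5 * g 0" for f g :: "nat \<Rightarrow> complex"
    by (simp add: numeral_eq_Suc sum.atLeast0_atMost_Suc)
  have sum7: "(\<Sum>i=0..7. f i * g (7 - i)) = f 0 * g 7 + f 1 * g 6 + f 2 * g 5 + f 3 * g 4 + f 4 * g 3 + f 5 * g 2 + f 6 * g 1 + f 7 * g 0" for f g :: "nat \<Rightarrow> complex"
    by (simp add: numeral_eq_Suc sum.atLeast0_atMost_Suc)
  have "fps_nth H 1 * p = - (p ^ 3 / 3)"
    using eq[of 3] unfolding sum3 N D by (simp add: algebra_simps)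
  hence "fps_nth H 1 * p = - (p ^ 2 / 3) * p" by (simp add: power_numeral_reduce)
  hence H1: "fps_nth H 1 = - (p ^ 2 / 3)" using p mult_right_cancel by blast
  have "fps_nth H 3 * p + fps_nth H 1 * (- (p ^ 3 / 6)) = p ^ 5 / 30"
    using eq[of 5] unfolding sum5 N D by (simp add: algebra_simps)
  hence "fps_nth H 3 * p = p ^ 5 / 30 - fps_nth H 1 * (- (p ^ 3 / 6))" by (simp only: eq_diff_eq)
  also have "\<dots> = - (p ^ 4 / 45) * p" unfolding H1 by (simp add: power_numeral_reduce field_simps)
  finally have "fps_nth H 3 * p = - (p ^ 4 / 45) * p" .
  hence H3: "fps_nth H 3 = - (p ^ 4 / 45)" using p mult_right_cancel by blast
  have "fps_nth H 5 * p + fps_nth H 3 * (- (p ^ 3 / 6)) + fps_nth H 1 * (p ^ 5 / 120) = - (p ^ 7 / 840)"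
    using eq[of 7] unfolding sum7 N D by (simp add: algebra_simps)
  hence "fps_nth H 5 * p = - (p ^ 7 / 840) - fps_nth H 1 * (p ^ 5 / 120) - fps_nth H 3 * (- (p ^ 3 / 6))"
    by (simp only: eq_diff_eq)
  also have "\<dots> = - (2 * p ^ 6 / 945) * p" unfolding H1 H3 by (simp add: power_numeral_reduce field_simps)
  finally have "fps_nth H 5 * p = - (2 * p ^ 6 / 945) * p" .
  hence H5: "fps_nth H 5 = - (2 * p ^ 6 / 945)" using p mult_right_cancel by blast
  have "eval_fps H 0 = cot_reg 0" using H(1) eventually_nhds_x_imp_x unfolding has_fps_expansion_def by fast
  hence H0: "fps_nth H 0 = 0" by (simp add: cot_reg_def eval_fps_at_0)
  from that[OF H(1) H0] H1 H3 H5 show ?thesis by (simp add: p_def)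
qed

lemma deriv_fun_of_qexp:
  assumes "qconv F" "Im z > 0"
  shows "deriv (fun_of_qexp F) z = fun_of_qexp (Abs_fps (\<lambda>n. (2 * of_real pi * \<i> * of_nat n) * fps_nth F n)) z"
proof -
  have "(qe has_field_derivative 2 * of_real pi * \<i> * qe z) (at z)"
    by (auto intro!: derivative_eq_intros)
  hence "(eval_fps F \<circ> qe has_field_derivative eval_fps (fps_deriv F) (qe z) * (2 * of_real pi * \<i> * qe z)) (at z)"
    by (intro DERIV_chain has_field_derivative_eval_fps qconv_less assms)
  hence "deriv (fun_of_qexp F) z = eval_fps (fps_deriv F) (qe z) * (2 * of_real pi * \<i> * qe z)"
    unfolding fun_of_qexp_def[abs_def] o_def by (rule DERIV_imp_deriv)
  also have "\<dots> = fun_of_qexp (fps_const (2 * of_real pi * \<i>) * (fps_X * fps_deriv F)) z"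
  proof -
    have conv: "qconv (fps_deriv F)" "qconv fps_X" using fps_conv_radius_deriv[of F] assms
      by (auto simp: qconv_def intro: order_trans)
    have "fun_of_qexp fps_X z = qe z" by (simp add: fun_of_qexp_def)
    moreover have "fun_of_qexp (fps_deriv F) z = eval_fps (fps_deriv F) (qe z)" by (simp add: fun_of_qexp_def)
    ultimately show ?thesis using conv assms(2) by (simp add: fun_of_qexp_mult qconv_mult)
  qed
  also have "fps_const (2 * of_real pi * \<i>) * (fps_X * fps_deriv F) = Abs_fps (\<lambda>n. (2 * of_real pi * \<i> * of_nat n) * fps_nth F n)"
    by (rule fps_ext) (auto simp: gr0_conv_Suc)
  finally show ?thesis .
qed

lemma higher_deriv_fun_of_qexp:
  assumes "qconv F" "Im z > 0"
  shows "(deriv ^^ k) (fun_of_qexp F) z = fun_of_qexp (Abs_fps (\<lambda>n. (2 * of_real pi * \<i> * of_nat n) ^ k * fps_nth F n)) z"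
  using assms(2)
proof (induction k arbitrary: z)
  case 0
  thus ?case by (simp add: fps_nth_inverse)
next
  case (Suc k)
  define G where "G = Abs_fps (\<lambda>n. (2 * of_real pi * \<i> * of_nat n) ^ k * fps_nth F n)"
  have "G = fps_const ((2 * of_real pi * \<i>) ^ k) * Abs_fps (\<lambda>n. of_nat n ^ k * fps_nth F n)"
    by (rule fps_ext) (simp add: G_def power_mult_distrib)
  hence G: "qconv G" using qconv_power_mult[OF assms(1), of k] by (simp add: qconv_mult)
  have "(deriv ^^ Suc k) (fun_of_qexp F) z = deriv ((deriv ^^ k) (fun_of_qexp F)) z" by simp
  also have "\<dots> = deriv (fun_of_qexp G) z"
  proof (rule deriv_cong_ev)
    have "\<forall>\<^sub>F w in nhds z. w \<in> upper_half_plane"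
      using Suc.prems by (intro eventually_nhds_in_open open_upper_half_plane) (simp add: in_H_iff)
    thus "\<forall>\<^sub>F w in nhds z. (deriv ^^ k) (fun_of_qexp F) w = fun_of_qexp G w"
      by eventually_elim (simp add: Suc.IH G_def in_H_iff)
  qed simp
  also have "\<dots> = fun_of_qexp (Abs_fps (\<lambda>n. (2 * of_real pi * \<i> * of_nat n) * fps_nth G n)) z"
    by (rule deriv_fun_of_qexp[OF G Suc.prems])
  also have "Abs_fps (\<lambda>n. (2 * of_real pi * \<i> * of_nat n) * fps_nth G n) = 
             Abs_fps (\<lambda>n. (2 * of_real pi * \<i> * of_nat n) ^ Suc k * fps_nth F n)"
    by (rule fps_ext) (simp add: G_def)
  finally show ?case .
qed

text \<open>The parameter \<open>qe \<tau>\<close> of the series stays fixed under differentiation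
  and is matched with the argument only afterwards. The m-th coefficient then becomes (2 pi i m)^n /
  (1 - q^m) at x = q, which is a Lambert series in q.\<close>

lemma higher_deriv_lambert:
  assumes \<tau>: "Im \<tau> > 0" and n: "n > 0"
  shows "(deriv ^^ n) (fun_of_qexp (lambert_fps (qe \<tau>))) \<tau> = 
           (2 * of_real pi * \<i>) ^ n * fun_of_qexp (divisor_sum_series (\<lambda>d. of_nat d ^ n)) \<tau>"
proof -
  define q where "q = qe \<tau>"
  have q: "norm q < 1" using \<tau> by (simp add: q_def)
  have "(\<lambda>m. of_nat m ^ n * (q ^ m / (1 - q ^ m))) sums eval_fps (divisor_sum_series (\<lambda>d. of_nat d ^ n)) q"
    by (rule lambert_sums(1)[OF q, of _ 1 n]) (simp add: norm_power)
  hence "(\<lambda>m. (2 * of_real pi * \<i>) ^ n * (of_nat m ^ n * (q ^ m / (1 - q ^ m)))) sums ((2 * of_real pi * \<i>) ^ n * eval_fps (divisor_sum_series (\<lambda>d. of_nat d ^ n)) q)"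
    by (rule sums_mult)
  also have "(\<lambda>m. (2 * of_real pi * \<i>) ^ n * (of_nat m ^ n * (q ^ m / (1 - q ^ m)))) = 
     (\<lambda>m. ((2 * of_real pi * \<i> * of_nat m) ^ n * fps_nth (lambert_fps q) m) * q ^ m)"
    using n by (auto simp: fun_eq_iff lambert_fps_def power_mult_distrib)
  finally have "eval_fps (Abs_fps (\<lambda>m. (2 * of_real pi * \<i> * of_nat m) ^ n * fps_nth (lambert_fps q) m)) q = 
     (2 * of_real pi * \<i>) ^ n * eval_fps (divisor_sum_series (\<lambda>d. of_nat d ^ n)) q"
    by (simp add: eval_fps_def sums_iff)
  thus ?thesis using higher_deriv_fun_of_qexp[OF qconv_lambert_fps[OF q] \<tau>, of n]
    by (simp add: fun_of_qexp_def q_def)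
qed

text \<open>The regular part of \<open>theta_ld \<tau>\<close> at 0, with the value at 0 included.
  It is written in the additive variables \<tau> + u and \<tau> - u so that its Taylor coefficients
  are derivatives of one function at \<tau>.\<close>

definition theta_reg :: "complex \<Rightarrow> complex \<Rightarrow> complex" where
  "theta_reg \<tau> u = cot_reg u - 2 * of_real pi * \<i> * 
     (fun_of_qexp (lambert_fps (qe \<tau>)) (\<tau> + u) - fun_of_qexp (lambert_fps (qe \<tau>)) (\<tau> - u))"

lemma lambert_odd_eq:
  "lambert_odd (qe \<tau>) (qe u) = fun_of_qexp (lambert_fps (qe \<tau>)) (\<tau> + u) - fun_of_qexp (lambert_fps (qe \<tau>)) (\<tau> - u)"
proof -
  have "qe \<tau> / qe u = qe (\<tau> - u)" by (simp add: ring_distribs exp_diff)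
  thus ?thesis unfolding lambert_odd_def fun_of_qexp_def qe_add by simp
qed

lemma theta_ld_eq_reg:
  assumes "Im \<tau> > 0" "u \<noteq> 0" "norm u < min 1 (Im \<tau>)"
  shows "theta_ld \<tau> u = 1 / u + theta_reg \<tau> u"
  using theta_ld_near_0(2)[OF assms] by (simp add: theta_reg_def lambert_odd_eq)

text \<open>For odd n the two Lambert parts add up instead of cancelling. The coefficients at 1, 3
  and 5 are - \<pi>^2/3 E_2, - \<pi>^4/45 E_4 and - 2 \<pi>^6/945 E_6: the cotangent supplies the
  constant terms and the Lambert series the divisor sums.\<close>

lemma theta_reg_has_fps_expansion:
  assumes \<tau>: "Im \<tau> > 0"
  obtains G where "theta_reg \<tau> has_fps_expansion G" "fps_nth G 0 = 0"
    "fps_nth G 1 = - (of_real pi ^ 2 / 3) + 8 * of_real pi ^ 2 * fun_of_qexp (divisor_sum_series (\<lambda>d. of_nat d ^ 1)) \<tau>"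
    "fps_nth G 3 = - (of_real pi ^ 4 / 45) - 16 / 3 * of_real pi ^ 4 * fun_of_qexp (divisor_sum_series (\<lambda>d. of_nat d ^ 3)) \<tau>"
    "fps_nth G 5 = - (2 * of_real pi ^ 6 / 945) + 16 / 15 * of_real pi ^ 6 * fun_of_qexp (divisor_sum_series (\<lambda>d. of_nat d ^ 5)) \<tau>"
proof -
  obtain H where H: "cot_reg has_fps_expansion H" "fps_nth H 0 = 0" "fps_nth H 1 = - (of_real pi ^ 2 / 3)"
    "fps_nth H 3 = - (of_real pi ^ 4 / 45)" "fps_nth H 5 = - (2 * of_real pi ^ 6 / 945)"
    using cot_reg_coeffs by blast
  define L where "L = fun_of_qexp (lambert_fps (qe \<tau>))"
  have holo: "L holomorphic_on upper_half_plane" unfolding L_def using \<tau>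
    by (intro holomorphic_fun_of_qexp qconv_lambert_fps) simp
  have analytic: "(\<lambda>u. L (x * u + \<tau>)) analytic_on {0}" and
    derivs: "(deriv ^^ n) (\<lambda>u. L (x * u + \<tau>)) 0 = x ^ n * (deriv ^^ n) L \<tau>" if x: "norm x = 1" for x n
  proof -
    have sub: "x * u + \<tau> \<in> upper_half_plane" if "u \<in> ball 0 (Im \<tau>)" for u
    proof -
      have "\<bar>Im (x * u)\<bar> \<le> norm (x * u)" by (rule abs_Im_le_cmod)
      also have "\<dots> < Im \<tau>" using that x by (simp add: norm_mult)
      finally show ?thesis by (simp add: in_H_iff)
    qed
    have "(L \<circ> (\<lambda>u. x * u + \<tau>)) holomorphic_on ball 0 (Im \<tau>)"
      using sub by (intro holomorphic_on_compose_gen[OF _ holo] holomorphic_intros) auto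
    thus "(\<lambda>u. L (x * u + \<tau>)) analytic_on {0}"
      unfolding o_def using \<tau> by (auto simp: analytic_at intro!: exI[of _ "ball 0 (Im \<tau>)"])
    show "(deriv ^^ n) (\<lambda>u. L (x * u + \<tau>)) 0 = x ^ n * (deriv ^^ n) L \<tau>"
      using higher_deriv_compose_linear'[OF holo open_ball open_upper_half_plane, of 0 0 "Im \<tau>" x \<tau> n] sub \<tau> by simp
  qed
  have exp: "(\<lambda>u. L (x * u + \<tau>)) has_fps_expansion fps_expansion (\<lambda>u. L (x * u + \<tau>)) 0" if "norm x = 1" for x
    by (rule analytic_at_imp_has_fps_expansion_0[OF analytic[OF that]])
  define A where "A = fps_expansion (\<lambda>u. L (1 * u + \<tau>)) 0"
  define B where "B = fps_expansion (\<lambda>u. L ((-1) * u + \<tau>)) 0"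
  have A_exp: "(\<lambda>u. L (1 * u + \<tau>)) has_fps_expansion A" unfolding A_def by (rule exp) simp
  have B_exp: "(\<lambda>u. L ((-1) * u + \<tau>)) has_fps_expansion B" unfolding B_def by (rule exp) simp
  have A: "fps_nth A n = (deriv ^^ n) L \<tau> / fact n" for n
    using derivs[of 1 n] by (simp add: A_def fps_expansion_def)
  have B: "fps_nth B n = (-1) ^ n * (deriv ^^ n) L \<tau> / fact n" for n
    using derivs[of "-1" n] by (simp add: B_def fps_expansion_def)
  define G where "G = H - fps_const (2 * of_real pi * \<i>) * (A - B)"
  have G: "(\<lambda>u. cot_reg u - 2 * of_real pi * \<i> * (L (1 * u + \<tau>) - L ((-1) * u + \<tau>))) has_fps_expansion G"
    unfolding G_def by (intro has_fps_expansion_diff has_fps_expansion_cmult_left H(1) A_exp B_exp)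
  have nth: "fps_nth G n = fps_nth H n - 2 * of_real pi * \<i> * (2 * ((2 * of_real pi * \<i>) ^ n * fun_of_qexp (divisor_sum_series (\<lambda>d. of_nat d ^ n)) \<tau>) / fact n)"
    if "odd n" for n
  proof -
    have "fps_nth G n = fps_nth H n - 2 * of_real pi * \<i> * (fps_nth A n - fps_nth B n)"
      by (simp add: G_def)
    also have "fps_nth A n - fps_nth B n = 2 * (deriv ^^ n) L \<tau> / fact n"
      using that by (simp add: A B)
    also have "(deriv ^^ n) L \<tau> = (2 * of_real pi * \<i>) ^ n * fun_of_qexp (divisor_sum_series (\<lambda>d. of_nat d ^ n)) \<tau>"
      unfolding L_def by (rule higher_deriv_lambert[OF \<tau>]) (use that in \<open>auto intro: odd_pos\<close>)
    finally show ?thesis .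
  qed
  show ?thesis
  proof (rule that[of G])
    show "theta_reg \<tau> has_fps_expansion G"
      using G by (simp add: theta_reg_def[abs_def] L_def add.commute)
    show "fps_nth G 0 = 0" by (simp add: G_def A B H(2))
    show "fps_nth G 1 = - (of_real pi ^ 2 / 3) + 8 * of_real pi ^ 2 * fun_of_qexp (divisor_sum_series (\<lambda>d. of_nat d ^ 1)) \<tau>"
      using nth[of 1] unfolding H(3) by (simp add: power2_eq_square algebra_simps)
    show "fps_nth G 3 = - (of_real pi ^ 4 / 45) - 16 / 3 * of_real pi ^ 4 * fun_of_qexp (divisor_sum_series (\<lambda>d. of_nat d ^ 3)) \<tau>"
      unfolding nth[of 3, simplified] H(4)[simplified] by (simp add: eval_nat_numeral fact_numeral algebra_simps power_mult_distrib)
    show "fps_nth G 5 = - (2 * of_real pi ^ 6 / 945) + 16 / 15 * of_real pi ^ 6 * fun_of_qexp (divisor_sum_series (\<lambda>d. of_nat d ^ 5)) \<tau>"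
      unfolding nth[of 5, simplified] H(5)[simplified] by (simp add: eval_nat_numeral fact_numeral algebra_simps power_mult_distrib)
  qed
qed

text \<open>Comparison of Taylor coefficients in u on both sides of
  \<open>theta_ld_transform\<close>. The substitution of u / j produces the weight n + 1, and the
  linear term 2 pi i c u touches n = 1 only, hence only E_2.\<close>

lemma theta_reg_transform:
  assumes SL: "(a, b, c, d) \<in> SL2Z" and \<tau>: "Im \<tau> > 0"
  defines "j \<equiv> of_int c * \<tau> + of_int d"
  assumes G: "theta_reg \<tau> has_fps_expansion G" "fps_nth G 0 = 0"
    and G': "theta_reg (moebius_map (a, b, c, d) \<tau>) has_fps_expansion G'" "fps_nth G' 0 = 0"
  shows "fps_nth G' n = j ^ (n + 1) * fps_nth G n + (if n = 1 then 2 * of_real pi * \<i> * of_int c * j else 0)"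
proof -
  define \<tau>' where "\<tau>' = moebius_map (a, b, c, d) \<tau>"
  have \<tau>': "Im \<tau>' > 0" unfolding \<tau>'_def using \<tau> SL by (intro moebius_in_H) (auto simp: SL2Z_iff)
  have j: "j \<noteq> 0" using aut_factor_nonzero[of \<tau> "(a, b, c, d)"] \<tau> SL by (simp add: j_def SL2Z_iff)
  define r where "r = min (min 1 (Im \<tau>)) (min 1 (Im \<tau>') * norm j)"
  have r: "r > 0" using \<tau> \<tau>' j by (simp add: r_def)
  have ev: "\<forall>\<^sub>F u in nhds 0. theta_reg \<tau>' (inverse j * u) = j * theta_reg \<tau> u + 2 * of_real pi * \<i> * of_int c * u"
  proof -
    have "\<forall>\<^sub>F u in nhds (0 :: complex). u \<in> ball 0 r" using r by (intro eventually_nhds_in_open) auto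
    thus ?thesis
    proof eventually_elim
      case (elim u)
      show ?case
      proof (cases "u = 0")
        case True
        have "theta_reg \<tau> 0 = 0" "theta_reg \<tau>' 0 = 0" by (simp_all add: theta_reg_def cot_reg_def)
        thus ?thesis using True by simp
      next
        case False
        have u: "norm u < min 1 (Im \<tau>)" and "norm u < min 1 (Im \<tau>') * norm j" using elim by (simp_all add: r_def)
        hence u': "norm (u / j) < min 1 (Im \<tau>')" 
          using j by (simp add: norm_divide pos_divide_less_eq del: min_less_iff_conj)
        have "theta_ld \<tau>' (u / j) = j * theta_ld \<tau> u + 2 * of_real pi * \<i> * of_int c * u"
          unfolding \<tau>'_def j_def by (rule theta_ld_transform[OF SL \<tau> theta_ld_near_0(1)[OF \<tau> False u]])
        also have "theta_ld \<tau>' (u / j) = j / u + theta_reg \<tau>' (u / j)"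
          using theta_ld_eq_reg[OF \<tau>' _ u'] False j by simp
        also have "theta_ld \<tau> u = 1 / u + theta_reg \<tau> u" by (rule theta_ld_eq_reg[OF \<tau> False u])
        finally show ?thesis by (simp add: field_simps)
      qed
    qed
  qed
  have "(\<lambda>u. j * theta_reg \<tau> u + 2 * of_real pi * \<i> * of_int c * u) has_fps_expansion 
          (fps_const j * G + fps_const (2 * of_real pi * \<i> * of_int c) * fps_X)"
    by (intro fps_expansion_intros G)
  hence "(deriv ^^ n) (\<lambda>u. j * theta_reg \<tau> u + 2 * of_real pi * \<i> * of_int c * u) 0 / fact n = 
           j * fps_nth G n + (if n = 1 then 2 * of_real pi * \<i> * of_int c else 0)"
    by (subst fps_nth_fps_expansion[symmetric]) (auto simp: fps_X_nth)
  also have "(deriv ^^ n) (\<lambda>u. j * theta_reg \<tau> u + 2 * of_real pi * \<i> * of_int c * u) 0 = 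
             (deriv ^^ n) (\<lambda>u. theta_reg \<tau>' (inverse j * u)) 0"
    using ev by (intro higher_deriv_cong_ev refl) (auto elim: eventually_mono)
  also have "\<dots> = inverse j ^ n * (deriv ^^ n) (theta_reg \<tau>') 0"
  proof -
    have "theta_reg \<tau>' analytic_on {0}" using G'(1) unfolding \<tau>'_def by (rule has_fps_expansion_imp_analytic_0)
    then obtain s where s: "s > 0" "theta_reg \<tau>' holomorphic_on ball 0 s" by (auto simp: analytic_on_def)
    have "inverse j * w \<in> ball 0 s" if "w \<in> ball 0 (s * norm j)" for w
    proof -
      have "norm (inverse j * w) = norm w / norm j" by (simp add: norm_mult norm_inverse divide_inverse)
      thus ?thesis using that j by (simp add: pos_divide_less_eq)
    qed
    moreover have "0 \<in> ball 0 (s * norm j)" using s(1) j by simp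
    ultimately show ?thesis
      using higher_deriv_compose_linear[OF s(2) open_ball open_ball, of 0 0 "s * norm j" "inverse j" n] by simp
  qed
  also have "(deriv ^^ n) (theta_reg \<tau>') 0 = fact n * fps_nth G' n"
    using fps_nth_fps_expansion[OF G'(1), of n] by (simp add: \<tau>'_def)
  finally have "fps_nth G' n = j ^ n * (j * fps_nth G n + (if n = 1 then 2 * of_real pi * \<i> * of_int c else 0))"
    using j by (simp add: field_simps power_inverse)
  thus ?thesis by (simp add: algebra_simps)
qed

lemma bernoulli_values: "bernoulli 2 = 1 / 6" "bernoulli 4 = - 1 / 30" "bernoulli 6 = 1 / 42"
proof -
  have b1: "bernoulli 1 = - 1 / 2" by (simp add: One_nat_def)
  have b2: "bernoulli 2 = 1 / 6" using b1 by (simp add: numeral_2_eq_2 atMost_Suc field_simps)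
  have b3: "bernoulli 3 = 0" using b1 b2 by (simp add: numeral_eq_Suc atMost_Suc binomial_eq_0)
  have b4: "bernoulli 4 = - 1 / 30" using b1 b2 b3 by (simp add: numeral_eq_Suc atMost_Suc binomial_eq_0)
  have b5: "bernoulli 5 = 0" using b1 b2 b3 b4 by (simp add: numeral_eq_Suc atMost_Suc binomial_eq_0)
  have b6: "bernoulli 6 = 1 / 42" using b1 b2 b3 b4 b5 by (simp add: numeral_eq_Suc atMost_Suc binomial_eq_0)
  show "bernoulli 2 = 1 / 6" "bernoulli 4 = - 1 / 30" "bernoulli 6 = 1 / 42" by (fact b2 b4 b6)+
qed


lemma qconv_Eisen_aux: "qconv (divisor_sum_series (\<lambda>d. of_nat d ^ k))"
  by (rule qconv_divisor_sum_series[of _ 1 k]) (simp add: norm_power)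

lemma qconv_Eisen: "qconv (Eisen k)"
  unfolding Eisen_def by (intro qconv_diff qconv_mult qconv_Eisen_aux) auto

lemma fun_of_qexp_Eisen:
  assumes "Im z > 0"
  shows "fun_of_qexp (Eisen k) z = 1 - 2 * of_nat k / bernoulli k * fun_of_qexp (divisor_sum_series (\<lambda>d. of_nat d ^ (k - 1))) z"
proof -
  have "fun_of_qexp 1 z = 1" by (simp add: fun_of_qexp_def)
  thus ?thesis unfolding Eisen_def using assms
    by (simp add: fun_of_qexp_diff fun_of_qexp_mult qconv_mult qconv_Eisen_aux)
qed

lemma Eisen_transform:
  assumes SL: "(a, b, c, d) \<in> SL2Z" and \<tau>: "Im \<tau> > 0"
  defines "j \<equiv> of_int c * \<tau> + of_int d" and "\<tau>' \<equiv> moebius_map (a, b, c, d) \<tau>"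
  shows "fun_of_qexp (Eisen 2) \<tau>' = j ^ 2 * fun_of_qexp (Eisen 2) \<tau> - 6 * \<i> / of_real pi * of_int c * j"
    and "fun_of_qexp (Eisen 4) \<tau>' = j ^ 4 * fun_of_qexp (Eisen 4) \<tau>"
    and "fun_of_qexp (Eisen 6) \<tau>' = j ^ 6 * fun_of_qexp (Eisen 6) \<tau>"
proof -
  have \<tau>': "Im \<tau>' > 0" unfolding \<tau>'_def using \<tau> SL by (intro moebius_in_H) (auto simp: SL2Z_iff)
  have pi0: "complex_of_real pi \<noteq> 0" by simp
  obtain G where G: "theta_reg \<tau> has_fps_expansion G" "fps_nth G 0 = 0"
    "fps_nth G 1 = - (of_real pi ^ 2 / 3) + 8 * of_real pi ^ 2 * fun_of_qexp (divisor_sum_series (\<lambda>d. of_nat d ^ 1)) \<tau>"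
    "fps_nth G 3 = - (of_real pi ^ 4 / 45) - 16 / 3 * of_real pi ^ 4 * fun_of_qexp (divisor_sum_series (\<lambda>d. of_nat d ^ 3)) \<tau>"
    "fps_nth G 5 = - (2 * of_real pi ^ 6 / 945) + 16 / 15 * of_real pi ^ 6 * fun_of_qexp (divisor_sum_series (\<lambda>d. of_nat d ^ 5)) \<tau>"
    using theta_reg_has_fps_expansion[OF \<tau>] by blast
  obtain G' where G': "theta_reg \<tau>' has_fps_expansion G'" "fps_nth G' 0 = 0"
    "fps_nth G' 1 = - (of_real pi ^ 2 / 3) + 8 * of_real pi ^ 2 * fun_of_qexp (divisor_sum_series (\<lambda>d. of_nat d ^ 1)) \<tau>'"
    "fps_nth G' 3 = - (of_real pi ^ 4 / 45) - 16 / 3 * of_real pi ^ 4 * fun_of_qexp (divisor_sum_series (\<lambda>d. of_nat d ^ 3)) \<tau>'"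
    "fps_nth G' 5 = - (2 * of_real pi ^ 6 / 945) + 16 / 15 * of_real pi ^ 6 * fun_of_qexp (divisor_sum_series (\<lambda>d. of_nat d ^ 5)) \<tau>'"
    using theta_reg_has_fps_expansion[OF \<tau>'] by blast
  have trans: "fps_nth G' n = j ^ (n + 1) * fps_nth G n + (if n = 1 then 2 * of_real pi * \<i> * of_int c * j else 0)" for n
    unfolding j_def by (rule theta_reg_transform[OF SL \<tau> G(1,2) G'(1,2)[unfolded \<tau>'_def]])
  have E2: "fun_of_qexp (Eisen 2) z = - 3 / of_real pi ^ 2 * (- (of_real pi ^ 2 / 3) + 8 * of_real pi ^ 2 * fun_of_qexp (divisor_sum_series (\<lambda>d. of_nat d ^ 1)) z)"
    if "Im z > 0" for z using pi0 that by (simp add: fun_of_qexp_Eisen bernoulli_values field_simps)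
  have E4: "fun_of_qexp (Eisen 4) z = - 45 / of_real pi ^ 4 * (- (of_real pi ^ 4 / 45) - 16 / 3 * of_real pi ^ 4 * fun_of_qexp (divisor_sum_series (\<lambda>d. of_nat d ^ 3)) z)"
    if "Im z > 0" for z using pi0 that by (simp add: fun_of_qexp_Eisen bernoulli_values field_simps)
  have E6: "fun_of_qexp (Eisen 6) z = - 945 / (2 * of_real pi ^ 6) * (- (2 * of_real pi ^ 6 / 945) + 16 / 15 * of_real pi ^ 6 * fun_of_qexp (divisor_sum_series (\<lambda>d. of_nat d ^ 5)) z)"
    if "Im z > 0" for z using pi0 that by (simp add: fun_of_qexp_Eisen bernoulli_values field_simps)
  show "fun_of_qexp (Eisen 2) \<tau>' = j ^ 2 * fun_of_qexp (Eisen 2) \<tau> - 6 * \<i> / of_real pi * of_int c * j"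
    unfolding E2[OF \<tau>] E2[OF \<tau>'] G(3)[symmetric] G'(3)[symmetric] trans[of 1]
    using pi0 by (simp add: power2_eq_square algebra_simps)
  show "fun_of_qexp (Eisen 4) \<tau>' = j ^ 4 * fun_of_qexp (Eisen 4) \<tau>"
    unfolding E4[OF \<tau>] E4[OF \<tau>'] G(4)[symmetric] G'(4)[symmetric] trans[of 3] by simp
  show "fun_of_qexp (Eisen 6) \<tau>' = j ^ 6 * fun_of_qexp (Eisen 6) \<tau>"
    unfolding E6[OF \<tau>] E6[OF \<tau>'] G(5)[symmetric] G'(5)[symmetric] trans[of 5] by simp
qed

lemma slash_Eisen:
  assumes SL: "(a, b, c, d) \<in> SL2Z" and z: "Im z > 0"
  shows "slash 2 (a, b, c, d) (fun_of_qexp (Eisen 2)) z = fun_of_qexp (Eisen 2) z - 6 * \<i> / of_real pi * of_int c / (of_int c * z + of_int d)"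
    and "slash 4 (a, b, c, d) (fun_of_qexp (Eisen 4)) z = fun_of_qexp (Eisen 4) z"
    and "slash 6 (a, b, c, d) (fun_of_qexp (Eisen 6)) z = fun_of_qexp (Eisen 6) z"
proof -
  define j where "j = of_int c * z + of_int d"
  have j: "j \<noteq> 0" using aut_factor_nonzero[of z "(a, b, c, d)"] z SL by (simp add: j_def SL2Z_iff)
  have det: "imat_det (a, b, c, d) = 1" using SL by (simp only: SL2Z_iff)
  have af: "aut_factor (a, b, c, d) z = j" by (simp add: j_def)
  note * = slash_altdef det af Eisen_transform[OF SL z, folded j_def]
  show "slash 2 (a, b, c, d) (fun_of_qexp (Eisen 2)) z = fun_of_qexp (Eisen 2) z - 6 * \<i> / of_real pi * of_int c / (of_int c * z + of_int d)"
    unfolding * using j by (simp add: diff_divide_distrib power2_eq_square flip: j_def)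
  show "slash 4 (a, b, c, d) (fun_of_qexp (Eisen 4)) z = fun_of_qexp (Eisen 4) z"
       "slash 6 (a, b, c, d) (fun_of_qexp (Eisen 6)) z = fun_of_qexp (Eisen 6) z"
    unfolding * using j by simp_all
qed

lemma Eisen_nth_0: "fps_nth (Eisen k) 0 = 1"
  by (simp add: Eisen_def divisor_sum_series_def)

lemma mform_Eisen_aux:
  assumes "qconv F" "fps_nth F 0 = 1"
    and "\<And>a b c d z. (a, b, c, d) \<in> SL2Z \<Longrightarrow> Im z > 0 \<Longrightarrow> slash k (a, b, c, d) (fun_of_qexp F) z = fun_of_qexp F z"
  shows "mform k 1 (\<lambda>_. 1) (\<lambda>_ _. 1) F"
proof -
  have "(slash k (a, b, c, d) (fun_of_qexp F) \<longlongrightarrow> 1) at_i_infinity" if "(a, b, c, d) \<in> SL2Z" for a b c d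
  proof -
    have "(fun_of_qexp F \<longlongrightarrow> 1) at_i_infinity" using fun_of_qexp_tendsto[OF assms(1)] by (simp add: assms(2))
    also have "?this \<longleftrightarrow> ?thesis"
      by (intro filterlim_cong refl eventually_mono[OF eventually_Im_gt[of 0]]) (simp add: assms(3) that)
    finally show ?thesis .
  qed
  thus ?thesis using assms subsetD[OF Gamma0_subset_SL2Z] by (auto simp: mform_def)
qed

lemma mform_Eisen_4: "mform 4 1 (\<lambda>_. 1) (\<lambda>_ _. 1) (Eisen 4)"
  and mform_Eisen_6: "mform 6 1 (\<lambda>_. 1) (\<lambda>_ _. 1) (Eisen 6)"
  by (intro mform_Eisen_aux qconv_Eisen Eisen_nth_0 slash_Eisen; assumption)+

text \<open>The correction term is a multiple of c / (c z + d) and decays like 1 / Im z, so E_2 has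
  the value 1 at every cusp although it is not modular.\<close>

lemma tendsto_slash_Eisen_2:
  assumes SL: "(a, b, c, d) \<in> SL2Z"
  shows "(slash 2 (a, b, c, d) (fun_of_qexp (Eisen 2)) \<longlongrightarrow> 1) at_i_infinity"
proof -
  have lim: "((\<lambda>z. of_int c / (of_int c * z + of_int d)) \<longlongrightarrow> 0) at_i_infinity"
  proof (cases "c = 0")
    case False
    have "filterlim (\<lambda>z. norm (of_int c * z + of_int d)) at_top at_i_infinity"
    proof (rule filterlim_at_top_mono)
      show "filterlim (\<lambda>z. \<bar>of_int c\<bar> * Im z) at_top at_i_infinity"
        using False by (intro filterlim_tendsto_pos_mult_at_top[OF tendsto_const] filterlim_Im_at_i_infinity) auto
      show "\<forall>\<^sub>F z in at_i_infinity. \<bar>of_int c\<bar> * Im z \<le> norm (of_int c * z + of_int d)"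
      proof (rule eventually_mono[OF eventually_Im_gt[of 0]])
        fix z assume "Im z > 0"
        hence "\<bar>of_int c\<bar> * Im z = \<bar>Im (of_int c * z + of_int d)\<bar>" by (simp add: abs_mult)
        thus "\<bar>of_int c\<bar> * Im z \<le> norm (of_int c * z + of_int d)" using abs_Im_le_cmod by presburger
      qed
    qed
    hence "filterlim (\<lambda>z. of_int c * z + of_int d :: complex) at_infinity at_i_infinity"
      by (rule filterlim_norm_at_top_imp_at_infinity)
    thus ?thesis by (intro tendsto_divide_0[OF tendsto_const])
  qed simp
  have "((\<lambda>z. fun_of_qexp (Eisen 2) z - 6 * \<i> / of_real pi * (of_int c / (of_int c * z + of_int d))) \<longlongrightarrow> 1 - 6 * \<i> / of_real pi * 0) at_i_infinity"
    using fun_of_qexp_tendsto[OF qconv_Eisen[of 2]] unfolding Eisen_nth_0 by (intro tendsto_intros lim)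
  also have "?this \<longleftrightarrow> (slash 2 (a, b, c, d) (fun_of_qexp (Eisen 2)) \<longlongrightarrow> 1 - 6 * \<i> / of_real pi * 0) at_i_infinity"
    by (intro filterlim_cong refl eventually_mono[OF eventually_Im_gt[of 0]]) (simp add: slash_Eisen SL)
  finally show ?thesis by simp
qed

text \<open>For c = N c', passing to N z turns the correction term of E_2 into one with c' / (c z +
  d). The factor N restores c, so the corrections of the two summands cancel.\<close>

lemma mform_Eisen_2_diff:
  assumes N: "N > 0"
  shows "mform 2 N (\<lambda>_. 1) (\<lambda>a c. of_nat N * cusp_value_qpow 2 N (\<lambda>_ _. 1) a c - 1) (of_nat N * qpow (Eisen 2) N - Eisen 2)"
proof -
  define F where "F = of_nat N * qpow (Eisen 2) N - Eisen 2"
  have conv: "qconv (Eisen 2)" "qconv (qpow (Eisen 2) N)" "qconv (of_nat N)"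
    using N qconv_Eisen qconv_qpow qconv_const[of "of_nat N"] by (auto simp: fps_of_nat)
  have eq0: "fun_of_qexp F z = of_nat N * fun_of_qexp (qpow (Eisen 2) N) z + (-1) * fun_of_qexp (Eisen 2) z" if "Im z > 0" for z
  proof -
    have "fun_of_qexp (of_nat N) z = of_nat N" by (simp flip: fps_of_nat)
    thus ?thesis using that conv unfolding F_def
      by (simp add: fun_of_qexp_diff fun_of_qexp_mult qconv_mult)
  qed
  have eq: "slash 2 \<gamma> (fun_of_qexp F) z = of_nat N * slash 2 \<gamma> (fun_of_qexp (qpow (Eisen 2) N)) z + (-1) * slash 2 \<gamma> (fun_of_qexp (Eisen 2)) z"
    if "\<gamma> \<in> SL2Z" "Im z > 0" for \<gamma> z
    using slash_cong_H[of "fun_of_qexp F" "\<lambda>z. of_nat N * fun_of_qexp (qpow (Eisen 2) N) z + (-1) * fun_of_qexp (Eisen 2) z" z \<gamma> 2] that eq0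
    by (simp only: slash_lin SL2Z_iff zero_less_one)
  have lim: "(slash 2 (a, b, c, d) (fun_of_qexp F) \<longlongrightarrow> of_nat N * cusp_value_qpow 2 N (\<lambda>_ _. 1) a c - 1) at_i_infinity"
    if SL: "(a, b, c, d) \<in> SL2Z" for a b c d
  proof -
    have "((\<lambda>z. of_nat N * slash 2 (a, b, c, d) (fun_of_qexp (qpow (Eisen 2) N)) z + (-1) * slash 2 (a, b, c, d) (fun_of_qexp (Eisen 2)) z)
      \<longlongrightarrow> of_nat N * cusp_value_qpow 2 N (\<lambda>_ _. 1) a c + (-1) * 1) at_i_infinity"
      by (intro tendsto_intros tendsto_slash_qpow tendsto_slash_Eisen_2 SL N conv) auto
    also have "?this \<longleftrightarrow> (slash 2 (a, b, c, d) (fun_of_qexp F) \<longlongrightarrow> of_nat N * cusp_value_qpow 2 N (\<lambda>_ _. 1) a c + (-1) * 1) at_i_infinity"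
      by (intro filterlim_cong refl eventually_mono[OF eventually_Im_gt[of 0]]) (simp add: eq SL)
    finally show ?thesis by simp
  qed
  have inv: "slash 2 (a, b, c, d) (fun_of_qexp F) z = fun_of_qexp F z" 
    if \<gamma>: "(a, b, c, d) \<in> Gamma0 N" and z: "Im z > 0" for a b c d z
  proof -
    obtain c' where c': "c = int N * c'" using \<gamma> by (auto simp: Gamma0_iff elim!: dvdE)
    have cN: "complex_of_int c = of_nat N * of_int c'" by (simp add: c')
    have SL: "(a, b, c, d) \<in> SL2Z" using \<gamma> Gamma0_subset_SL2Z by blast
    have \<delta>: "(a, int N * b, c', d) \<in> SL2Z" using SL by (simp add: SL2Z_iff c' mult_ac)
    define \<eta> where "\<eta> = (int N, 0 :: int, 0 :: int, 1 :: int)"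
    have det_\<eta>: "imat_det \<eta> = int N" by (simp add: \<eta>_def)
    have mult: "imat_mult \<eta> (a, b, c, d) = imat_mult (a, int N * b, c', d) \<eta>" by (simp add: \<eta>_def c')
    have Nz: "Im (of_nat N * z) > 0" using N z by simp
    have slash_\<eta>: "slash 2 \<eta> f z = of_nat N * f (of_nat N * z)" for f by (simp add: slash_altdef \<eta>_def)
    have "slash 2 (a, b, c, d) (fun_of_qexp (qpow (Eisen 2) N)) z = 
       of_nat N / of_nat N ^ 2 * slash 2 \<eta> (slash 2 (a, int N * b, c', d) (fun_of_qexp (Eisen 2))) z"
      using \<delta> z N SL slash_mult[of z \<eta> "(a, int N * b, c', d)" 2 "fun_of_qexp (Eisen 2)"]
      by (simp add: slash_qpow conv mult SL2Z_iff det_\<eta> flip: \<eta>_def del: imat_mult.simps)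
    also have "\<dots> = slash 2 (a, int N * b, c', d) (fun_of_qexp (Eisen 2)) (of_nat N * z)"
      using N by (simp add: slash_\<eta> power2_eq_square)
    also have "\<dots> = fun_of_qexp (Eisen 2) (of_nat N * z) - 6 * \<i> / of_real pi * of_int c' / (of_int c' * (of_nat N * z) + of_int d)"
      by (rule slash_Eisen(1)[OF \<delta> Nz])
    also have "fun_of_qexp (Eisen 2) (of_nat N * z) = fun_of_qexp (qpow (Eisen 2) N) z"
      using N z conv by (simp add: fun_of_qexp_qpow)
    also have "of_int c' * (of_nat N * z) + of_int d = of_int c * z + of_int d" by (simp add: cN)
    finally have *: "slash 2 (a, b, c, d) (fun_of_qexp (qpow (Eisen 2) N)) z = 
      fun_of_qexp (qpow (Eisen 2) N) z - 6 * \<i> / of_real pi * of_int c' / (of_int c * z + of_int d)" .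
    have "of_nat N * (6 * \<i> / of_real pi * of_int c' / (of_int c * z + of_int d)) = 6 * \<i> / of_real pi * of_int c / (of_int c * z + of_int d)"
      unfolding cN by simp
    thus ?thesis unfolding eq[OF SL z] eq0[OF z] * slash_Eisen(1)[OF SL z]
      by (simp add: right_diff_distrib cN)
  qed
  show ?thesis using lim inv conv unfolding mform_def F_def[symmetric]
    by (auto simp: F_def qconv_diff qconv_mult)
qed

lemma mform_C_form:
  assumes "N > 0"
  shows "mform 2 N (\<lambda>_. 1) (\<lambda>a c. 1 / of_nat (gcd (N - 1) 24) * ((of_int (gcd (int N) c)) ^ 2 / of_nat N - 1)) (C_form N)"
proof -
  have "of_nat N * cusp_value_qpow 2 N (\<lambda>_ _. 1) a c = of_int (gcd (int N) c) ^ 2 / of_nat N" for a c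
    using assms by (simp add: cusp_value_qpow_def power_divide power2_eq_square)
  thus ?thesis using mform_scale[OF mform_Eisen_2_diff[OF assms], of "1 / of_nat (gcd (N - 1) 24)"]
    by (simp add: C_form_def)
qed

section \<open>Eisenstein series of weight 1\<close>

text \<open>On the real line w has modulus 1, so the power series at q w and q / w become one
  Lambert series in q with the bounded coefficients w^m - w^(-m). At x = 1/3 and x = 1/4 these are
  multiples of \<open>rho3\<close> and \<open>rho4\<close>.\<close>

lemma theta_ld_real_qexp:
  assumes \<tau>: "Im \<tau> > 0" and x: "x \<notin> \<int>"
  shows "theta_ld \<tau> (of_real x) = of_real pi * cot (of_real pi * of_real x) - 2 * of_real pi * \<i> * 
     fun_of_qexp (divisor_sum_series (\<lambda>m. qe (of_real x) ^ m - qe (- of_real x) ^ m)) \<tau>"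
proof -
  define q w w' where "q = qe \<tau>" and "w = qe (of_real x)" and "w' = qe (- of_real x)"
  have q: "norm q < 1" using \<tau> by (simp add: q_def)
  have nw: "norm w = 1" "norm w' = 1" by (simp_all add: w_def w'_def)
  have notin: "of_real x \<notin> lattice \<tau>"
  proof
    assume "of_real x \<in> lattice \<tau>"
    then obtain m n where mn: "of_real x = of_int m * \<tau> + of_int n" by (auto simp: lattice_def)
    from arg_cong[OF this, of Im] have "m = 0" using \<tau> by simp
    with arg_cong[OF mn, of Re] have "x = of_int n" by simp
    thus False using x by simp
  qed
  have "(\<lambda>m. fps_nth (lambert_fps q) m * (q * w) ^ m - fps_nth (lambert_fps q) m * (q * w') ^ m) sums
          (eval_fps (lambert_fps q) (q * w) - eval_fps (lambert_fps q) (q * w'))"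
    using q nw by (intro sums_diff sums_qconv qconv_lambert_fps) (auto simp: norm_mult)
  also have "(\<lambda>m. fps_nth (lambert_fps q) m * (q * w) ^ m - fps_nth (lambert_fps q) m * (q * w') ^ m) =
             (\<lambda>m. (w ^ m - w' ^ m) * (q ^ m / (1 - q ^ m)))"
    by (auto simp: fun_eq_iff lambert_fps_def power_mult_distrib algebra_simps diff_divide_distrib)
  finally have 1: "(\<lambda>m. (w ^ m - w' ^ m) * (q ^ m / (1 - q ^ m))) sums
          (eval_fps (lambert_fps q) (q * w) - eval_fps (lambert_fps q) (q * w'))" .
  have "norm (w ^ m - w' ^ m) \<le> 2 * of_nat m ^ 0" for m
    using norm_triangle_ineq4[of "w ^ m" "w' ^ m"] nw by (simp add: norm_power)
  from lambert_sums(1)[OF q this] 1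
  have "eval_fps (lambert_fps q) (q * w) - eval_fps (lambert_fps q) (q * w') = eval_fps (divisor_sum_series (\<lambda>m. w ^ m - w' ^ m)) q"
    by (rule sums_unique2[rotated])
  hence "lambert_odd q w = fun_of_qexp (divisor_sum_series (\<lambda>m. w ^ m - w' ^ m)) \<tau>"
    unfolding lambert_odd_def fun_of_qexp_def w_def w'_def qe_minus by (simp add: q_def)
  thus ?thesis using theta_ld_strip[OF \<tau> _ notin] \<tau> by (simp add: q_def w_def w'_def)
qed

lemma power_mod_eq:
  fixes w :: "'a :: monoid_mult"
  assumes "w ^ N = 1"
  shows "w ^ m = w ^ (m mod N)"
proof -
  have "w ^ m = w ^ (N * (m div N) + m mod N)" by simp
  also have "\<dots> = w ^ (m mod N)" unfolding power_add power_mult assms by simp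
  finally show ?thesis .
qed

lemma divisor_sum_series_scale: "divisor_sum_series (\<lambda>m. c * g m) = fps_const c * divisor_sum_series g"
  by (rule fps_ext) (simp add: divisor_sum_series_def sum_distrib_left)

lemma qconv_divisor_rho: "qconv (divisor_sum_series rho3)" "qconv (divisor_sum_series rho4)"
  by (rule qconv_divisor_sum_series[of _ 1 0], simp add: rho3_def rho4_def)+

lemma qconv_F3: "qconv F3" and qconv_F4: "qconv F4"
  unfolding F3_def F4_def numeral_fps_const
  by (intro qconv_add qconv_mult qconv_divisor_rho qconv_1 qconv_const)+

text \<open>The factor normalises the constant term pi cot(pi/3) = pi / sqrt 3 to 1. The differences
  w^m - w^(-m) equal i sqrt 3 \<open>rho3 m\<close>, which produces the coefficient 2 pi sqrt 3
  times sqrt 3 / pi, that is 6.\<close>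

lemma fun_of_qexp_F3:
  assumes "Im \<tau> > 0"
  shows "fun_of_qexp F3 \<tau> = of_real (sqrt 3 / pi) * theta_ld \<tau> (1 / 3)"
proof -
  define w where "w = qe (1 / 3)"
  have w: "w = Complex (- 1 / 2) (sqrt 3 / 2)"
  proof -
    have "w = cis (2 * pi / 3)" by (simp add: w_def cis_conv_exp mult_ac)
    thus ?thesis by (simp add: complex_eq_iff cos_120 sin_120)
  qed
  have w': "qe (- (1 / 3)) = Complex (- 1 / 2) (- sqrt 3 / 2)"
  proof -
    have "qe (- (1 / 3)) = cis (- (2 * pi / 3))" by (simp add: cis_conv_exp mult_ac)
    thus ?thesis by (simp add: complex_eq_iff cos_120 sin_120)
  qed
  have w3: "w ^ 3 = 1" "qe (- (1 / 3)) ^ 3 = 1"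
    unfolding w_def qe_power using qe_of_int[of 1] qe_of_int[of "-1"] by simp_all
  have g: "qe (1 / 3) ^ m - qe (- (1 / 3)) ^ m = (\<i> * of_real (sqrt 3)) * rho3 m" for m
  proof -
    have "w ^ m - qe (- (1 / 3)) ^ m = w ^ (m mod 3) - qe (- (1 / 3)) ^ (m mod 3)"
      using power_mod_eq[OF w3(1)] power_mod_eq[OF w3(2)] by simp
    moreover have "m mod 3 = 0 \<or> m mod 3 = 1 \<or> m mod 3 = 2" by auto
    ultimately show ?thesis unfolding w_def[symmetric] w w'
      by (auto simp: rho3_def complex_eq_iff power2_eq_square)
  qed
  have cot: "cot (of_real pi * of_real (1 / 3)) = complex_of_real (1 / sqrt 3)"
  proof -
    have "cot (of_real pi * of_real (1 / 3)) = complex_of_real (cot (pi / 3))"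
      by (simp add: cot_def sin_of_real[symmetric] cos_of_real[symmetric] del: sin_of_real cos_of_real)
    thus ?thesis by (simp add: cot_def cos_60 sin_60)
  qed
  have "(1 / 3 :: real) \<notin> \<int>"
  proof
    assume "(1 / 3 :: real) \<in> \<int>"
    then obtain n where "1 / 3 = real_of_int n" by (elim Ints_cases)
    hence "3 * n = 1" by linarith
    thus False by presburger
  qed
  moreover have "fun_of_qexp (divisor_sum_series (\<lambda>m. qe (1 / 3) ^ m - qe (- (1 / 3)) ^ m)) \<tau> = (\<i> * of_real (sqrt 3)) * fun_of_qexp (divisor_sum_series rho3) \<tau>"
    unfolding g divisor_sum_series_scale using assms by (subst fun_of_qexp_mult) (auto simp: qconv_divisor_rho)
  ultimately   have "theta_ld \<tau> (1 / 3) = of_real pi * of_real (1 / sqrt 3) - 2 * of_real pi * \<i> * 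
     ((\<i> * of_real (sqrt 3)) * fun_of_qexp (divisor_sum_series rho3) \<tau>)"
    using theta_ld_real_qexp[OF assms, of "1 / 3"] unfolding cot by simp
  moreover have "complex_of_real (sqrt 3) * complex_of_real (sqrt 3) = 3"
    by (simp flip: of_real_mult)
  moreover have "fun_of_qexp F3 \<tau> = 1 + 6 * fun_of_qexp (divisor_sum_series rho3) \<tau>"
  proof -
    have "fun_of_qexp 1 \<tau> = 1" by (simp add: fun_of_qexp_def)
    thus ?thesis unfolding F3_def numeral_fps_const using assms
      by (simp add: fun_of_qexp_add fun_of_qexp_mult qconv_divisor_rho qconv_mult)
  qed
  ultimately show ?thesis by (simp add: algebra_simps)
qed

text \<open>Here the constant term is pi cot(pi/4) = pi and w^m - w^(-m) = 2 i
  \<open>rho4 m\<close>, which gives the coefficient 4.\<close>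

lemma fun_of_qexp_F4:
  assumes "Im \<tau> > 0"
  shows "fun_of_qexp F4 \<tau> = of_real (1 / pi) * theta_ld \<tau> (1 / 4)"
proof -
  define w where "w = qe (1 / 4)"
  have w: "w = \<i>"
  proof -
    have "w = cis (pi / 2)" by (simp add: w_def cis_conv_exp mult_ac)
    thus ?thesis by simp
  qed
  have w': "qe (- (1 / 4)) = - \<i>" using w unfolding w_def qe_minus by simp
  have w4: "w ^ 4 = 1" "qe (- (1 / 4)) ^ 4 = 1" unfolding w w' by (simp_all add: power4_eq_xxxx)
  have g: "qe (1 / 4) ^ m - qe (- (1 / 4)) ^ m = (2 * \<i>) * rho4 m" for m
  proof -
    have "w ^ m - qe (- (1 / 4)) ^ m = w ^ (m mod 4) - qe (- (1 / 4)) ^ (m mod 4)"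
      using power_mod_eq[OF w4(1)] power_mod_eq[OF w4(2)] by simp
    moreover have "m mod 4 = 0 \<or> m mod 4 = 1 \<or> m mod 4 = 2 \<or> m mod 4 = 3" by presburger
    ultimately show ?thesis unfolding w_def[symmetric] w w'
      by (auto simp: rho4_def power3_eq_cube)
  qed
  have cot: "cot (of_real pi * of_real (1 / 4)) = (1 :: complex)"
  proof -
    have "cot (of_real pi * of_real (1 / 4)) = complex_of_real (cot (pi / 4))"
      by (simp add: cot_def sin_of_real[symmetric] cos_of_real[symmetric] del: sin_of_real cos_of_real)
    thus ?thesis by (simp add: cot_def cos_45 sin_45)
  qed
  have "(1 / 4 :: real) \<notin> \<int>"
  proof
    assume "(1 / 4 :: real) \<in> \<int>"
    then obtain n where "1 / 4 = real_of_int n" by (elim Ints_cases)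
    hence "4 * n = 1" by linarith
    thus False by presburger
  qed
  moreover have "fun_of_qexp (divisor_sum_series (\<lambda>m. qe (1 / 4) ^ m - qe (- (1 / 4)) ^ m)) \<tau> = (2 * \<i>) * fun_of_qexp (divisor_sum_series rho4) \<tau>"
    unfolding g divisor_sum_series_scale using assms by (subst fun_of_qexp_mult) (auto simp: qconv_divisor_rho)
  ultimately   have "theta_ld \<tau> (1 / 4) = of_real pi - 2 * of_real pi * \<i> * 
     ((2 * \<i>) * fun_of_qexp (divisor_sum_series rho4) \<tau>)"
    using theta_ld_real_qexp[OF assms, of "1 / 4"] unfolding cot by simp
  moreover have "fun_of_qexp F4 \<tau> = 1 + 4 * fun_of_qexp (divisor_sum_series rho4) \<tau>"
  proof -
    have "fun_of_qexp 1 \<tau> = 1" by (simp add: fun_of_qexp_def)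
    thus ?thesis unfolding F4_def numeral_fps_const using assms
      by (simp add: fun_of_qexp_add fun_of_qexp_mult qconv_divisor_rho qconv_mult)
  qed
  ultimately show ?thesis by (simp add: algebra_simps)
qed

lemma torsion_notin_lattice:
  assumes "Im \<tau> > 0" "N > 0" "\<not> (int N dvd c \<and> int N dvd d)"
  shows "(of_int c * \<tau> + of_int d) / of_nat N \<notin> lattice \<tau>"
proof
  assume "(of_int c * \<tau> + of_int d) / of_nat N \<in> lattice \<tau>"
  then obtain m n where "(of_int c * \<tau> + of_int d) / of_nat N = of_int m * \<tau> + of_int n" by (auto simp: lattice_def)
  hence mn: "of_int c * \<tau> + of_int d = of_nat N * (of_int m * \<tau> + of_int n)"
    using assms(2) by (simp add: field_simps)
  from arg_cong[OF mn, of Im] have "real_of_int c * Im \<tau> = real_of_int (int N * m) * Im \<tau>" by simp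
  hence "real_of_int c = real_of_int (int N * m)" using assms(1) by (simp only: mult_right_cancel less_irrefl)
  hence c: "c = int N * m" by (simp only: of_int_eq_iff)
  with arg_cong[OF mn, of Re] have "real_of_int d = real_of_int (int N * n)" by (simp add: algebra_simps)
  hence "d = int N * n" by (simp only: of_int_eq_iff)
  with c assms(3) show False by simp
qed

text \<open>The transformation law moves the torsion point 1/N to (c \<tau> + d) / N. Reducing c
  modulo N costs multiples of the quasi-period, which the linear term absorbs exactly. Afterwards
  the point has imaginary part between 0 and Im \<tau>, where the limit is easy to take.\<close>

lemma slash_theta_ld_torsion:
  assumes SL: "(a, b, c, d) \<in> SL2Z" and \<tau>: "Im \<tau> > 0" and N: "N > 1"
  shows "slash 1 (a, b, c, d) (\<lambda>\<tau>. theta_ld \<tau> (1 / of_nat N)) \<tau> = 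
     theta_ld \<tau> ((of_int (c mod int N) * \<tau> + of_int d) / of_nat N) + 2 * of_real pi * \<i> * of_int (c mod int N) / of_nat N"
proof -
  define j where "j = of_int c * \<tau> + of_int d"
  define r where "r = c mod int N"
  have j: "j \<noteq> 0" using aut_factor_nonzero[of \<tau> "(a, b, c, d)"] \<tau> SL by (simp add: j_def SL2Z_iff)
  have ndvd: "\<not> (int N dvd c \<and> int N dvd d)"
  proof
    assume "int N dvd c \<and> int N dvd d"
    hence "int N dvd 1" using coprime_SL2Z_bottom[OF SL] by (meson coprime_common_divisor)
    thus False using N by simp
  qed
  hence ndvd': "\<not> (int N dvd r \<and> int N dvd d)" by (simp add: r_def dvd_mod_iff)
  have notin: "j / of_nat N \<notin> lattice \<tau>" "(of_int r * \<tau> + of_int d) / of_nat N \<notin> lattice \<tau>"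
    unfolding j_def using \<tau> N ndvd ndvd' by (intro torsion_notin_lattice; simp)+
  have "slash 1 (a, b, c, d) (\<lambda>\<tau>. theta_ld \<tau> (1 / of_nat N)) \<tau> = 
          1 / j * theta_ld (moebius_map (a, b, c, d) \<tau>) ((j / of_nat N) / j)"
    using SL j by (simp add: slash_altdef SL2Z_iff j_def)
  also have "theta_ld (moebius_map (a, b, c, d) \<tau>) ((j / of_nat N) / j) = 
          j * theta_ld \<tau> (j / of_nat N) + 2 * of_real pi * \<i> * of_int c * (j / of_nat N)"
    unfolding j_def by (rule theta_ld_transform[OF SL \<tau>]) (use notin(1) in \<open>simp add: j_def\<close>)
  also have "1 / j * \<dots> = theta_ld \<tau> (j / of_nat N) + 2 * of_real pi * \<i> * of_int c / of_nat N"
    using j by (simp add: field_simps)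
  finally have eq: "slash 1 (a, b, c, d) (\<lambda>\<tau>. theta_ld \<tau> (1 / of_nat N)) \<tau> =
    theta_ld \<tau> (j / of_nat N) + 2 * of_real pi * \<i> * of_int c / of_nat N" .
  have c: "complex_of_int c = of_int r + of_nat N * of_int (c div int N)"
    unfolding r_def by (metis mod_mult_div_eq of_int_add of_int_mult of_int_of_nat_eq)
  have "j / of_nat N = (of_int r * \<tau> + of_int d) / of_nat N + of_int (c div int N) * \<tau> + of_int 0"
    unfolding j_def c using N by (simp add: field_simps)
  hence "theta_ld \<tau> (j / of_nat N) = theta_ld \<tau> ((of_int r * \<tau> + of_int d) / of_nat N) - 2 * of_real pi * \<i> * of_int (c div int N)"
    using theta_ld_add_lattice[OF \<tau> notin(2)] by (simp only:)
  moreover have "2 * of_real pi * \<i> * of_int c / of_nat N = 2 * of_real pi * \<i> * of_int (c div int N) + 2 * of_real pi * \<i> * of_int r / of_nat N"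
    unfolding c using N by (simp add: field_simps)
  ultimately show ?thesis unfolding eq by (simp add: r_def)
qed

lemma lambert_tendsto_0:
  assumes "(q \<longlongrightarrow> 0) F" "(x \<longlongrightarrow> 0) F"
  shows "((\<lambda>t. lambert (q t) (x t)) \<longlongrightarrow> 0) F"
proof (rule Lim_null_comparison)
  have "\<forall>\<^sub>F t in F. norm (q t) < 1 / 2" "\<forall>\<^sub>F t in F. norm (x t) < 1 / 2"
    using order_tendstoD(2)[OF tendsto_norm_zero[OF assms(1)], of "1 / 2"]
      order_tendstoD(2)[OF tendsto_norm_zero[OF assms(2)], of "1 / 2"] by simp_all
  thus "\<forall>\<^sub>F t in F. norm (lambert (q t) (x t)) \<le> 4 * norm (x t)"
  proof eventually_elim
    case (elim t)
    have "norm (lambert (q t) (x t)) \<le> norm (x t) / ((1 - norm (q t)) * (1 - norm (x t)))"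
      using norm_lambert_le[of "q t" "x t"] elim by (simp add: lambert_eq_0)
    also have "\<dots> \<le> norm (x t) / (1 / 2 * (1 / 2))"
      using elim by (intro divide_left_mono mult_mono) auto
    finally show ?case by simp
  qed
  show "((\<lambda>t. 4 * norm (x t)) \<longlongrightarrow> 0) F"
    using tendsto_mult_right_zero[OF tendsto_norm_zero[OF assms(2)]] by simp
qed

lemma tendsto_qe_linear:
  assumes "r > 0" "N > 0"
  shows "((\<lambda>\<tau>. qe ((of_int r * \<tau> + of_int d) / of_nat N)) \<longlongrightarrow> 0) at_i_infinity"
proof -
  have "((\<lambda>\<tau>. qe (\<tau> / of_real (of_nat N / of_int r)) * qe (of_int d / of_nat N)) \<longlongrightarrow> 0) at_i_infinity"
    using assms by (intro tendsto_mult_left_zero tendsto_qe_at_i_infinity) auto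
  also have "(\<lambda>\<tau>. qe (\<tau> / of_real (of_nat N / of_int r)) * qe (of_int d / of_nat N)) = 
             (\<lambda>\<tau>. qe ((of_int r * \<tau> + of_int d) / of_nat N))"
    unfolding add_divide_distrib qe_add by (simp add: mult_ac)
  finally show ?thesis .
qed

text \<open>For 0 < r < N both \<open>qe u\<close> and \<open>qe \<tau> / qe u\<close> tend to 0 at
  the torsion point u, so only the constant of \<open>theta_ld\<close> survives.\<close>

lemma theta_ld_torsion_tendsto:
  assumes "0 < r" "r < int N"
  shows "((\<lambda>\<tau>. theta_ld \<tau> ((of_int r * \<tau> + of_int d) / of_nat N)) \<longlongrightarrow> - (of_real pi * \<i>)) at_i_infinity"
proof -
  have N: "N > 0" using assms by auto
  have 1: "((\<lambda>\<tau>. qe ((of_int r * \<tau> + of_int d) / of_nat N)) \<longlongrightarrow> 0) at_i_infinity"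
    using assms N by (intro tendsto_qe_linear) auto
  have "((\<lambda>\<tau>. qe ((of_int (int N - r) * \<tau> + of_int (- d)) / of_nat N)) \<longlongrightarrow> 0) at_i_infinity"
    using assms N by (intro tendsto_qe_linear) auto
  also have "(\<lambda>\<tau>. qe ((of_int (int N - r) * \<tau> + of_int (- d)) / of_nat N)) = 
             (\<lambda>\<tau>. qe \<tau> / qe ((of_int r * \<tau> + of_int d) / of_nat N))"
  proof
    fix \<tau> :: complex
    have "(of_int (int N - r) * \<tau> + of_int (- d)) / of_nat N = \<tau> + (- ((of_int r * \<tau> + of_int d) / of_nat N))"
    proof -
      have "of_int (int N - r) * \<tau> + of_int (- d) = of_nat N * \<tau> - (of_int r * \<tau> + of_int d)"
        by (simp add: algebra_simps)
      moreover have "(of_nat N * \<tau> - x) / of_nat N = \<tau> + (- (x / of_nat N))" for x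
        using N by (simp add: diff_divide_distrib)
      ultimately show ?thesis by (simp only:)
    qed
    thus "qe ((of_int (int N - r) * \<tau> + of_int (- d)) / of_nat N) = qe \<tau> / qe ((of_int r * \<tau> + of_int d) / of_nat N)"
      by (simp only: qe_add qe_minus) simp
  qed
  finally have 2: "((\<lambda>\<tau>. qe \<tau> / qe ((of_int r * \<tau> + of_int d) / of_nat N)) \<longlongrightarrow> 0) at_i_infinity" .
  have 3: "(qe \<longlongrightarrow> 0) at_i_infinity" using tendsto_qe_at_i_infinity[of 1] by simp
  have "((\<lambda>\<tau>. theta_ld \<tau> ((of_int r * \<tau> + of_int d) / of_nat N)) \<longlongrightarrow> 
          - (of_real pi * \<i>) - 2 * of_real pi * \<i> * 0 + 2 * of_real pi * \<i> * 0) at_i_infinity"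
    unfolding theta_ld_def by (intro tendsto_intros lambert_tendsto_0 1 2 3)
  thus ?thesis by simp
qed

text \<open>The limit is 2 pi i times the first Bernoulli polynomial x - 1/2 at the fractional part
  of c / N, as usual for Eisenstein series of weight 1.\<close>

lemma slash_theta_ld_torsion_tendsto:
  assumes SL: "(a, b, c, d) \<in> SL2Z" and N: "N > 1" and c: "\<not> int N dvd c"
  shows "(slash 1 (a, b, c, d) (\<lambda>\<tau>. theta_ld \<tau> (1 / of_nat N)) \<longlongrightarrow> 
           2 * of_real pi * \<i> * (of_int (c mod int N) / of_nat N - 1 / 2)) at_i_infinity"
proof -
  have r: "0 < c mod int N" "c mod int N < int N"
    using c N pos_mod_sign[of "int N" c] by (auto simp: dvd_eq_mod_eq_0 order.strict_iff_order[of 0])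
  have "((\<lambda>\<tau>. theta_ld \<tau> ((of_int (c mod int N) * \<tau> + of_int d) / of_nat N) + 2 * of_real pi * \<i> * of_int (c mod int N) / of_nat N)
    \<longlongrightarrow> - (of_real pi * \<i>) + 2 * of_real pi * \<i> * of_int (c mod int N) / of_nat N) at_i_infinity"
    by (intro tendsto_intros theta_ld_torsion_tendsto r)
  also have "?this \<longleftrightarrow> (slash 1 (a, b, c, d) (\<lambda>\<tau>. theta_ld \<tau> (1 / of_nat N)) \<longlongrightarrow> - (of_real pi * \<i>) + 2 * of_real pi * \<i> * of_int (c mod int N) / of_nat N) at_i_infinity"
    by (intro filterlim_cong refl eventually_mono[OF eventually_Im_gt[of 0]]) (rule slash_theta_ld_torsion[OF SL _ N, symmetric])
  also have "- (of_real pi * \<i>) + 2 * of_real pi * \<i> * of_int (c mod int N) / of_nat N = 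
     2 * of_real pi * \<i> * (of_int (c mod int N) / of_nat N - 1 / 2)"
    by (simp add: algebra_simps)
  finally show ?thesis .
qed

definition chi3 :: "int \<Rightarrow> complex" where
  "chi3 d = (if d mod 3 = 1 then 1 else if d mod 3 = 2 then - 1 else 0)"

definition chi4 :: "int \<Rightarrow> complex" where
  "chi4 d = (if d mod 4 = 1 then 1 else if d mod 4 = 3 then - 1 else 0)"

text \<open>For c = 1 modulo 3 the constant is sqrt 3 / pi times 2 pi i (1/3 - 1/2), and for c = 2
  it changes sign. In the same way \<open>cusp_F4\<close> has 2 i (1/4 - 1/2) = - i / 2, with value
  0 for c = 2 modulo 4.\<close>

definition cusp_F3 :: "int \<Rightarrow> int \<Rightarrow> complex" where
  "cusp_F3 a c = (if 3 dvd c then chi3 a else - (\<i> * of_real (sqrt 3) / 3) * chi3 c)"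

definition cusp_F4 :: "int \<Rightarrow> int \<Rightarrow> complex" where
  "cusp_F4 a c = (if 4 dvd c then chi4 a else - (\<i> / 2) * chi4 c)"

lemma theta_ld_third:
  assumes "Im \<tau> > 0" "\<not> 3 dvd d"
  shows "theta_ld \<tau> (of_int d / 3) = chi3 d * theta_ld \<tau> (1 / 3)"
proof -
  have notin: "1 / 3 \<notin> lattice \<tau>" using torsion_notin_lattice[of \<tau> 3 0 1] assms(1) by simp
  have "d mod 3 = 1 \<or> d mod 3 = 2" using assms(2) by presburger
  thus ?thesis
  proof
    assume "d mod 3 = 1"
    hence "d = 3 * (d div 3) + 1" by presburger
    hence "of_int d = 3 * of_int (d div 3) + (1 :: complex)"
      by (metis of_int_1 of_int_add of_int_mult of_int_numeral)
    hence "of_int d / 3 = 1 / 3 + complex_of_int (d div 3)" by (simp add: field_simps)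
    thus ?thesis using \<open>d mod 3 = 1\<close> by (simp only: theta_ld_add_int) (simp add: chi3_def)
  next
    assume "d mod 3 = 2"
    hence "d = 3 * (d div 3 + 1) - 1" by presburger
    hence "of_int d = 3 * of_int (d div 3 + 1) - (1 :: complex)"
      by (metis of_int_1 of_int_diff of_int_mult of_int_numeral)
    hence "of_int d / 3 = - (1 / 3) + complex_of_int (d div 3 + 1)" by (simp add: field_simps)
    thus ?thesis using \<open>d mod 3 = 2\<close> theta_ld_minus[OF assms(1) notin]
      by (simp only: theta_ld_add_int) (simp add: chi3_def)
  qed
qed

lemma theta_ld_fourth:
  assumes "Im \<tau> > 0" "odd d"
  shows "theta_ld \<tau> (of_int d / 4) = chi4 d * theta_ld \<tau> (1 / 4)"
proof -
  have notin: "1 / 4 \<notin> lattice \<tau>" using torsion_notin_lattice[of \<tau> 4 0 1] assms(1) by simp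
  have "d mod 4 = 1 \<or> d mod 4 = 3" using assms(2) by presburger
  thus ?thesis
  proof
    assume "d mod 4 = 1"
    hence "d = 4 * (d div 4) + 1" by presburger
    hence "of_int d = 4 * of_int (d div 4) + (1 :: complex)"
      by (metis of_int_1 of_int_add of_int_mult of_int_numeral)
    hence "of_int d / 4 = 1 / 4 + complex_of_int (d div 4)" by (simp add: field_simps)
    thus ?thesis using \<open>d mod 4 = 1\<close> by (simp only: theta_ld_add_int) (simp add: chi4_def)
  next
    assume "d mod 4 = 3"
    hence "d = 4 * (d div 4 + 1) - 1" by presburger
    hence "of_int d = 4 * of_int (d div 4 + 1) - (1 :: complex)"
      by (metis of_int_1 of_int_diff of_int_mult of_int_numeral)
    hence "of_int d / 4 = - (1 / 4) + complex_of_int (d div 4 + 1)" by (simp add: field_simps)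
    thus ?thesis using \<open>d mod 4 = 3\<close> theta_ld_minus[OF assms(1) notin]
      by (simp only: theta_ld_add_int) (simp add: chi4_def)
  qed
qed

text \<open>If N divides c, the matrix moves the torsion point 1/N to d/N up to periods, so the
  character is whatever relates the values of \<open>theta_ld\<close> at these two points. At such a
  cusp the constant term is \<psi> d, which is rewritten as \<psi> a because a and d are inverse
  modulo N.\<close>

lemma mform_weight_one_aux:
  assumes N: "N > 1" and conv: "qconv F" and F0: "fps_nth F 0 = 1"
    and F: "\<And>\<tau>. Im \<tau> > 0 \<Longrightarrow> fun_of_qexp F \<tau> = x * theta_ld \<tau> (1 / of_nat N)"
    and \<psi>: "\<And>d \<tau>. coprime d (int N) \<Longrightarrow> Im \<tau> > 0 \<Longrightarrow> theta_ld \<tau> (of_int d / of_nat N) = \<psi> d * theta_ld \<tau> (1 / of_nat N)"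
    and \<psi>': "\<And>a d. a * d mod int N = 1 \<Longrightarrow> \<psi> a = \<psi> d"
  shows "mform 1 N \<psi> (\<lambda>a c. if int N dvd c then \<psi> a else x * (2 * of_real pi * \<i> * (of_int (c mod int N) / of_nat N - 1 / 2))) F"
proof -
  have eq: "slash 1 (a, b, c, d) (fun_of_qexp F) z = x * slash 1 (a, b, c, d) (\<lambda>\<tau>. theta_ld \<tau> (1 / of_nat N)) z"
    if "(a, b, c, d) \<in> SL2Z" "Im z > 0" for a b c d z
    using moebius_in_H[of z "(a, b, c, d)"] that by (simp add: slash_altdef SL2Z_iff F)
  have inv: "slash 1 (a, b, c, d) (fun_of_qexp F) z = \<psi> d * fun_of_qexp F z"
    if SL: "(a, b, c, d) \<in> SL2Z" and c: "int N dvd c" and z: "Im z > 0" for a b c d z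
  proof -
    have "(a, b, c, d) \<in> Gamma0 N" using SL c by (simp add: Gamma0_iff SL2Z_iff)
    hence "coprime d (int N)" by (rule coprime_Gamma0)
    thus ?thesis using c unfolding eq[OF SL z] slash_theta_ld_torsion[OF SL z N] F[OF z] by (simp add: \<psi> z)
  qed
  have "(slash 1 (a, b, c, d) (fun_of_qexp F) \<longlongrightarrow> (if int N dvd c then \<psi> a else x * (2 * of_real pi * \<i> * (of_int (c mod int N) / of_nat N - 1 / 2)))) at_i_infinity"
    if SL: "(a, b, c, d) \<in> SL2Z" for a b c d
  proof (cases "int N dvd c")
    case True
    have "a * d = 1 + b * c" using SL by (simp add: SL2Z_iff algebra_simps)
    hence "a * d mod int N = 1" using True N by (simp add: mod_add_eq[symmetric])
    hence "\<psi> a = \<psi> d" by (rule \<psi>')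
    have "((\<lambda>z. \<psi> d * fun_of_qexp F z) \<longlongrightarrow> \<psi> d * 1) at_i_infinity"
      using fun_of_qexp_tendsto[OF conv] unfolding F0 by (intro tendsto_intros)
    also have "?this \<longleftrightarrow> (slash 1 (a, b, c, d) (fun_of_qexp F) \<longlongrightarrow> \<psi> d * 1) at_i_infinity"
      by (intro filterlim_cong refl eventually_mono[OF eventually_Im_gt[of 0]]) (rule inv[OF SL True, symmetric])
    finally show ?thesis using True \<open>\<psi> a = \<psi> d\<close> by simp
  next
    case False
    have "((\<lambda>z. x * slash 1 (a, b, c, d) (\<lambda>\<tau>. theta_ld \<tau> (1 / of_nat N)) z) \<longlongrightarrow> x * (2 * of_real pi * \<i> * (of_int (c mod int N) / of_nat N - 1 / 2))) at_i_infinity"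
      by (intro tendsto_intros slash_theta_ld_torsion_tendsto SL N False)
    also have "?this \<longleftrightarrow> (slash 1 (a, b, c, d) (fun_of_qexp F) \<longlongrightarrow> x * (2 * of_real pi * \<i> * (of_int (c mod int N) / of_nat N - 1 / 2))) at_i_infinity"
      by (intro filterlim_cong refl eventually_mono[OF eventually_Im_gt[of 0]]) (rule eq[OF SL, symmetric])
    finally show ?thesis using False by simp
  qed
  moreover have "slash 1 (a, b, c, d) (fun_of_qexp F) z = \<psi> d * fun_of_qexp F z"
    if "(a, b, c, d) \<in> Gamma0 N" "Im z > 0" for a b c d z
    using that by (intro inv) (auto simp: Gamma0_iff SL2Z_iff)
  ultimately show ?thesis using conv by (auto simp: mform_def)
qed

lemma mform_F3: "mform 1 3 chi3 cusp_F3 F3"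
proof -
  have "mform 1 3 chi3 (\<lambda>a c. if int 3 dvd c then chi3 a else of_real (sqrt 3 / pi) * (2 * of_real pi * \<i> * (of_int (c mod int 3) / of_nat 3 - 1 / 2))) F3"
  proof (rule mform_weight_one_aux)
    show "fps_nth F3 0 = 1" by (simp add: F3_def divisor_sum_series_def numeral_fps_const)
    show "theta_ld \<tau> (of_int d / of_nat 3) = chi3 d * theta_ld \<tau> (1 / of_nat 3)" if "coprime d (int 3)" "Im \<tau> > 0" for d \<tau>
    proof -
      have "\<not> 3 dvd d"
      proof
        assume "3 dvd d"
        hence "is_unit (3 :: int)" using that(1) by (auto intro: coprime_common_divisor)
        thus False by simp
      qed
      thus ?thesis using theta_ld_third[OF that(2)] by simp
    qed
    show "chi3 a = chi3 d" if "a * d mod int 3 = 1" for a d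
    proof -
      have *: "(a mod 3) * (d mod 3) mod 3 = 1" using that by (simp add: mod_mult_eq)
      have "a mod 3 = 0 \<or> a mod 3 = 1 \<or> a mod 3 = 2" "d mod 3 = 0 \<or> d mod 3 = 1 \<or> d mod 3 = 2" by presburger+
      thus ?thesis using * by (auto simp: chi3_def)
    qed
  qed (auto simp: qconv_F3 fun_of_qexp_F3)
  thus ?thesis
  proof (rule mform_cong)
    show "(if int 3 dvd c then chi3 a else of_real (sqrt 3 / pi) * (2 * of_real pi * \<i> * (of_int (c mod int 3) / of_nat 3 - 1 / 2))) = cusp_F3 a c" for a c
    proof (cases "3 dvd c")
      case False
      hence "c mod 3 = 1 \<or> c mod 3 = 2" by presburger
      thus ?thesis using False by (auto simp: cusp_F3_def chi3_def field_simps)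
    qed (simp add: cusp_F3_def)
  qed auto
qed

lemma mform_F4: "mform 1 4 chi4 cusp_F4 F4"
proof -
  have "mform 1 4 chi4 (\<lambda>a c. if int 4 dvd c then chi4 a else of_real (1 / pi) * (2 * of_real pi * \<i> * (of_int (c mod int 4) / of_nat 4 - 1 / 2))) F4"
  proof (rule mform_weight_one_aux)
    show "fps_nth F4 0 = 1" by (simp add: F4_def divisor_sum_series_def numeral_fps_const)
    show "theta_ld \<tau> (of_int d / of_nat 4) = chi4 d * theta_ld \<tau> (1 / of_nat 4)" if "coprime d (int 4)" "Im \<tau> > 0" for d \<tau>
    proof -
      have "odd d"
      proof
        assume "even d"
        hence "is_unit (2 :: int)" using that(1) by (auto intro: coprime_common_divisor[of d 4])
        thus False by simp
      qed
      thus ?thesis using theta_ld_fourth[OF that(2)] by simp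
    qed
    show "chi4 a = chi4 d" if "a * d mod int 4 = 1" for a d
    proof -
      have *: "(a mod 4) * (d mod 4) mod 4 = 1" using that by (simp add: mod_mult_eq)
      have "a mod 4 = 0 \<or> a mod 4 = 1 \<or> a mod 4 = 2 \<or> a mod 4 = 3" "d mod 4 = 0 \<or> d mod 4 = 1 \<or> d mod 4 = 2 \<or> d mod 4 = 3" by presburger+
      thus ?thesis using * by (auto simp: chi4_def)
    qed
  qed (auto simp: qconv_F4 fun_of_qexp_F4)
  thus ?thesis
  proof (rule mform_cong)
    show "(if int 4 dvd c then chi4 a else of_real (1 / pi) * (2 * of_real pi * \<i> * (of_int (c mod int 4) / of_nat 4 - 1 / 2))) = cusp_F4 a c" for a c
    proof (cases "4 dvd c")
      case False
      hence "c mod 4 = 1 \<or> c mod 4 = 2 \<or> c mod 4 = 3" by presburger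
      thus ?thesis using False by (auto simp: cusp_F4_def chi4_def field_simps)
    qed (simp add: cusp_F4_def)
  qed auto
qed

section \<open>Coefficients\<close>

definition list_conv :: "int list \<Rightarrow> int list \<Rightarrow> int list" where
  "list_conv xs ys = map (\<lambda>n. \<Sum>i\<leftarrow>[0..<Suc n]. xs ! i * ys ! (n - i)) [0..<min (length xs) (length ys)]"

text \<open>Records an initial segment only, and with integer entries, so that list arithmetic can
  be evaluated; coefficients beyond the list are left open.\<close>

definition has_coeffs :: "complex fps \<Rightarrow> int list \<Rightarrow> bool" where
  "has_coeffs F xs \<longleftrightarrow> (\<forall>i<length xs. fps_nth F i = of_int (xs ! i))"

lemma has_coeffs_nth: "has_coeffs F xs \<Longrightarrow> i < length xs \<Longrightarrow> fps_nth F i = of_int (xs ! i)"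
  by (simp add: has_coeffs_def)

lemma has_coeffs_cong: "has_coeffs F xs \<Longrightarrow> xs = ys \<Longrightarrow> has_coeffs F ys"
  by simp

lemma has_coeffs_mult:
  assumes "has_coeffs F xs" "has_coeffs G ys"
  shows "has_coeffs (F * G) (list_conv xs ys)"
  unfolding has_coeffs_def
proof (intro allI impI)
  fix n assume "n < length (list_conv xs ys)"
  hence n: "n < length xs" "n < length ys" by (simp_all add: list_conv_def)
  have "fps_nth (F * G) n = (\<Sum>i\<in>{0..<Suc n}. fps_nth F i * fps_nth G (n - i))"
    by (simp only: fps_mult_nth atLeastLessThanSuc_atLeastAtMost)
  also have "\<dots> = (\<Sum>i\<in>{0..<Suc n}. of_int (xs ! i * ys ! (n - i)))"
    using assms n by (intro sum.cong) (auto simp: has_coeffs_def)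
  also have "\<dots> = of_int (list_conv xs ys ! n)"
    using n by (simp add: list_conv_def interv_sum_list_conv_sum_set_nat del: upt_Suc)
  finally show "fps_nth (F * G) n = of_int (list_conv xs ys ! n)" .
qed

lemma has_coeffs_power:
  assumes "has_coeffs F xs" "n > 0"
  shows "has_coeffs (F ^ n) ((list_conv xs ^^ (n - 1)) xs)"
proof -
  have "has_coeffs (F ^ Suc m) ((list_conv xs ^^ m) xs)" for m
    by (induction m) (use assms(1) has_coeffs_mult in auto)
  from this[of "n - 1"] show ?thesis using assms(2) by simp
qed

lemma has_coeffs_add: "has_coeffs F xs \<Longrightarrow> has_coeffs G ys \<Longrightarrow> has_coeffs (F + G) (map2 (+) xs ys)"
  by (simp add: has_coeffs_def)

lemma has_coeffs_diff: "has_coeffs F xs \<Longrightarrow> has_coeffs G ys \<Longrightarrow> has_coeffs (F - G) (map2 (-) xs ys)"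
  by (simp add: has_coeffs_def)

lemma has_coeffs_scale: "has_coeffs F xs \<Longrightarrow> has_coeffs (fps_const (of_int c) * F) (map ((*) c) xs)"
  by (simp add: has_coeffs_def)

lemma has_coeffs_scale_numeral: "has_coeffs F xs \<Longrightarrow> has_coeffs (numeral c * F) (map ((*) (numeral c)) xs)"
  using has_coeffs_scale[of F xs "numeral c"] by (simp add: numeral_fps_const)

lemma has_coeffs_divide:
  assumes "has_coeffs F xs" "\<forall>x\<in>set xs. numeral c dvd x"
  shows "has_coeffs (fps_const (1 / numeral c) * F) (map (\<lambda>x. x div numeral c) xs)"
  unfolding has_coeffs_def
proof (intro allI impI)
  fix i assume "i < length (map (\<lambda>x. x div numeral c) xs)"
  hence i: "i < length xs" by simp
  hence "numeral c dvd xs ! i" using assms(2) by simp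
  hence "(of_int (xs ! i div numeral c) :: complex) = of_int (xs ! i) / numeral c" by (simp add: of_int_div)
  thus "fps_nth (fps_const (1 / numeral c) * F) i = of_int (map (\<lambda>x. x div numeral c) xs ! i)"
    using assms(1) i by (simp add: has_coeffs_def)
qed

lemma has_coeffs_qpow:
  assumes "has_coeffs F xs" "h > 0"
  shows "has_coeffs (qpow F h) (map (\<lambda>n. if h dvd n then xs ! (n div h) else 0) [0..<length xs])"
proof -
  have "n div h < length xs" if "n < length xs" for n
    using that by (meson div_le_dividend le_less_trans)
  thus ?thesis using assms unfolding has_coeffs_def by (auto simp: qpow_nth)
qed

lemma has_coeffs_1: "has_coeffs 1 [1, 0, 0, 0, 0, 0, 0, 0]"
  by (auto simp: has_coeffs_def nth_Cons split: nat.splits)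

lemma has_coeffs_divisor_sum_series:
  assumes "\<And>d. g d = of_int (h d)"
  shows "has_coeffs (divisor_sum_series g) (map (\<lambda>n. \<Sum>d\<leftarrow>filter (\<lambda>d. d dvd n) [1..<Suc n]. h d) [0..<m])"
proof -
  have "fps_nth (divisor_sum_series g) n = of_int (\<Sum>d\<leftarrow>filter (\<lambda>d. d dvd n) [1..<Suc n]. h d)" for n
  proof (cases "n = 0")
    case False
    hence "{d. d dvd n} = set (filter (\<lambda>d. d dvd n) [1..<Suc n])"
      by (auto dest: dvd_imp_le intro: Suc_leI dvd_pos_nat)
    hence "(\<Sum>d | d dvd n. h d) = (\<Sum>d\<leftarrow>filter (\<lambda>d. d dvd n) [1..<Suc n]. h d)"
      by (simp only: sum_list_distinct_conv_sum_set distinct_filter distinct_upt)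
    thus ?thesis using False by (simp add: divisor_sum_series_def assms(1) flip: of_int_sum del: upt_Suc)
  qed (simp add: divisor_sum_series_def)
  thus ?thesis unfolding has_coeffs_def by (simp del: upt_Suc)
qed

definition rho3_int :: "nat \<Rightarrow> int" where
  "rho3_int n = (if n mod 3 = 1 then 1 else if n mod 3 = 2 then - 1 else 0)"

definition rho4_int :: "nat \<Rightarrow> int" where
  "rho4_int n = (if n mod 4 = 1 then 1 else if n mod 4 = 3 then - 1 else 0)"

lemma has_coeffs_rho3: "has_coeffs (divisor_sum_series rho3) [0, 1, 0, 1, 1, 0, 0, 2]"
  by (rule has_coeffs_cong[OF has_coeffs_divisor_sum_series[of _ rho3_int 8]])
     (simp add: rho3_def rho3_int_def, code_simp)

lemma has_coeffs_rho4: "has_coeffs (divisor_sum_series rho4) [0, 1, 1, 0, 1, 2, 0, 0]"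
  by (rule has_coeffs_cong[OF has_coeffs_divisor_sum_series[of _ rho4_int 8]])
     (simp add: rho4_def rho4_int_def, code_simp)

lemmas has_coeffs_intros = has_coeffs_1 has_coeffs_divide has_coeffs_scale_numeral has_coeffs_add
  has_coeffs_diff has_coeffs_mult has_coeffs_power has_coeffs_qpow

text \<open>The introduction rules follow the definition and build an unevaluated list in a
  schematic variable; \<open>code_simp\<close> settles the side conditions and the final equality
  with the displayed list. The later coefficient lists of composite forms are obtained in the same
  way.\<close>

lemma has_coeffs_F3: "has_coeffs F3 [1, 6, 0, 6, 6, 0, 0, 12]"
  unfolding F3_def by (rule has_coeffs_cong, (rule has_coeffs_rho3 has_coeffs_intros | code_simp)+)

lemma has_coeffs_F4: "has_coeffs F4 [1, 4, 4, 0, 4, 8, 0, 0]"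
  unfolding F4_def by (rule has_coeffs_cong, (rule has_coeffs_rho4 has_coeffs_intros | code_simp)+)

lemma has_coeffs_Eisen:
  assumes "2 * of_nat k / bernoulli k = of_int c"
  shows "has_coeffs (Eisen k) (map2 (-) [1, 0, 0, 0, 0, 0, 0, 0] (map ((*) c) 
           (map (\<lambda>n. \<Sum>d\<leftarrow>filter (\<lambda>d. d dvd n) [1..<Suc n]. int d ^ (k - 1)) [0..<8])))"
  unfolding Eisen_def assms
  by (intro has_coeffs_diff has_coeffs_1 has_coeffs_scale has_coeffs_divisor_sum_series) simp

lemma has_coeffs_Eisen_2: "has_coeffs (Eisen 2) [1, - 24, - 72, - 96, - 168, - 144, - 288, - 192]"
  by (rule has_coeffs_cong[OF has_coeffs_Eisen[of _ 24]]) (simp add: bernoulli_values, code_simp)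

lemma has_coeffs_Eisen_4: "has_coeffs (Eisen 4) [1, 240, 2160, 6720, 17520, 30240, 60480, 82560]"
  by (rule has_coeffs_cong[OF has_coeffs_Eisen[of _ "- 240"]]) (simp add: bernoulli_values, code_simp)

lemma has_coeffs_Eisen_6: "has_coeffs (Eisen 6) [1, - 504, - 16632, - 122976, - 532728, - 1575504, - 4058208, - 8471232]"
  by (rule has_coeffs_cong[OF has_coeffs_Eisen[of _ 504]]) (simp add: bernoulli_values, code_simp)

lemma C_form_eqs:
  "C_form 2 = 2 * qpow (Eisen 2) 2 - Eisen 2"
  "C_form 4 = fps_const (1 / 3) * (4 * qpow (Eisen 2) 4 - Eisen 2)"
  "C_form 9 = fps_const (1 / 8) * (9 * qpow (Eisen 2) 9 - Eisen 2)"
proof -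
  have "gcd (4 - 1) 24 = (3 :: nat)" "gcd (9 - 1) 24 = (8 :: nat)" by code_simp+
  thus "C_form 2 = 2 * qpow (Eisen 2) 2 - Eisen 2"
    "C_form 4 = fps_const (1 / 3) * (4 * qpow (Eisen 2) 4 - Eisen 2)"
    "C_form 9 = fps_const (1 / 8) * (9 * qpow (Eisen 2) 9 - Eisen 2)"
    by (simp_all add: C_form_def)
qed

lemma has_coeffs_C_form_2: "has_coeffs (C_form 2) [1, 24, 24, 96, 24, 144, 96, 192]"
  unfolding C_form_eqs by (rule has_coeffs_cong, (rule has_coeffs_Eisen_2 has_coeffs_intros | code_simp)+)

lemma has_coeffs_C_form_4: "has_coeffs (C_form 4) [1, 8, 24, 32, 24, 48, 96, 64]"
  unfolding C_form_eqs by (rule has_coeffs_cong, (rule has_coeffs_Eisen_2 has_coeffs_intros | code_simp)+)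

lemma has_coeffs_C_form_9: "has_coeffs (C_form 9) [1, 3, 9, 12, 21, 18, 36, 24]"
  unfolding C_form_eqs by (rule has_coeffs_cong, (rule has_coeffs_Eisen_2 has_coeffs_intros | code_simp)+)

lemma has_coeffs_alpha6: "has_coeffs alpha6 [0, 1, - 1, 1, 1, 0, - 1, 2]"
  unfolding alpha6_def by (rule has_coeffs_cong, (rule has_coeffs_F3 has_coeffs_intros | code_simp)+)

lemma has_coeffs_alpha8: "has_coeffs alpha8 [0, 1, 0, 0, 0, 2, 0, 0]"
  unfolding alpha8_def by (rule has_coeffs_cong, (rule has_coeffs_F4 has_coeffs_intros | code_simp)+)

lemma has_coeffs_alpha9: "has_coeffs alpha9 [0, 1, 0, 0, 1, 0, 0, 2]"
  unfolding alpha9_def by (rule has_coeffs_cong, (rule has_coeffs_F3 has_coeffs_intros | code_simp)+)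

lemma has_coeffs_alpha4: "has_coeffs alpha4 [0, 1, 0, 4, 0, 6, 0, 8]"
  unfolding alpha4_def by (rule has_coeffs_cong, (rule has_coeffs_F4 has_coeffs_alpha8 has_coeffs_intros | code_simp)+)

lemma has_coeffs_alpha2: "has_coeffs alpha2 [0, 1, 8, 28, 64, 126, 224, 344]"
  unfolding alpha2_def by (rule has_coeffs_cong, (rule has_coeffs_C_form_4 has_coeffs_alpha4 has_coeffs_intros | code_simp)+)

lemma has_coeffs_alpha3: "has_coeffs alpha3 [0, 1, 3, 9, 13, 24, 27, 50]"
  unfolding alpha3_def by (rule has_coeffs_cong, (rule has_coeffs_C_form_9 has_coeffs_alpha9 has_coeffs_intros | code_simp)+)

lemma has_coeffs_Delta1: "has_coeffs Delta1 [0, 1, - 24, 252, - 1472, 4830, - 6048, - 16744]"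
proof -
  have eq: "Delta1 = fps_const (1 / 1728) * (Eisen 4 ^ 3 - Eisen 6 ^ 2)" by (simp add: Delta1_def)
  show ?thesis unfolding eq
    by (rule has_coeffs_cong, (rule has_coeffs_Eisen_4 has_coeffs_Eisen_6 has_coeffs_intros | code_simp)+)
qed

lemma has_coeffs_Delta2: "has_coeffs Delta2 [0, 1, - 8, 12, 64, - 210, - 96, 1016]"
  unfolding Delta2_def by (rule has_coeffs_cong, (rule has_coeffs_alpha2 has_coeffs_C_form_2 has_coeffs_intros | code_simp)+)

lemma has_coeffs_Delta3: "has_coeffs Delta3 [0, 1, - 6, 9, 4, 6, - 54, - 40]"
  unfolding Delta3_def by (rule has_coeffs_cong, (rule has_coeffs_alpha3 has_coeffs_F3 has_coeffs_intros | code_simp)+)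

lemma has_coeffs_Delta4: "has_coeffs Delta4 [0, 1, 0, - 12, 0, 54, 0, - 88]"
  unfolding Delta4_def by (rule has_coeffs_cong, (rule has_coeffs_alpha2 has_coeffs_alpha4 has_coeffs_C_form_4 has_coeffs_intros | code_simp)+)

lemma has_coeffs_Delta6: "has_coeffs Delta6 [0, 1, - 2, - 3, 4, 6, 6, - 16]"
  unfolding Delta6_def by (rule has_coeffs_cong, (rule has_coeffs_alpha6 has_coeffs_F3 has_coeffs_intros | code_simp)+)

lemma has_coeffs_Delta8: "has_coeffs Delta8 [0, 1, 0, - 4, 0, - 2, 0, 24]"
  unfolding Delta8_def by (rule has_coeffs_cong, (rule has_coeffs_alpha4 has_coeffs_alpha8 has_coeffs_F4 has_coeffs_intros | code_simp)+)

lemma has_coeffs_Delta9: "has_coeffs Delta9 [0, 1, 0, 0, - 8, 0, 0, 20]"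
  unfolding Delta9_def by (rule has_coeffs_cong, (rule has_coeffs_alpha3 has_coeffs_alpha9 has_coeffs_F3 has_coeffs_intros | code_simp)+)

section \<open>The forms \<open>\<Delta>\<^sub>N\<close>\<close>

lemma has_coeffs_eqD:
  assumes "has_coeffs F xs" "has_coeffs G xs" "m \<le> length xs" "i < m"
  shows "fps_nth (F - G) i = 0"
  using assms by (simp add: has_coeffs_def)

lemma mform_eqI:
  assumes "mform k N (\<lambda>_. 1) v F" "mform k N (\<lambda>_. 1) v' G" "has_coeffs F xs" "has_coeffs G xs"
    and "m \<le> length xs" "N > 0"
    and "10 * (\<Sum>(c, d)\<in>bottom_rows N. if c = 0 then int m else 0) > int (k * card (bottom_rows N))"
  shows "F = G"
proof -
  have "F - G = 0"
    by (rule mform_eq_0[OF mform_diff[OF assms(1,2)] assms(6) _ assms(7)])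
       (rule has_coeffs_eqD[OF assms(3-5)])
  thus ?thesis by simp
qed

lemma chi3_square: "\<not> 3 dvd d \<Longrightarrow> chi3 d * chi3 d = 1"
proof -
  assume "\<not> 3 dvd d"
  hence "d mod 3 = 1 \<or> d mod 3 = 2" by presburger
  thus ?thesis by (auto simp: chi3_def)
qed

lemma chi4_square: "odd d \<Longrightarrow> chi4 d * chi4 d = 1"
proof -
  assume "odd d"
  hence "d mod 4 = 1 \<or> d mod 4 = 3" by presburger
  thus ?thesis by (auto simp: chi4_def)
qed

lemma coprime_not_dvd:
  assumes "coprime d n" "p dvd n" "\<not> is_unit (p :: int)"
  shows "\<not> p dvd d"
  using assms coprime_common_divisor by blast

lemma chi3_double: "chi3 (2 * d) = - chi3 d"
proof -
  have "d mod 3 = 0 \<or> d mod 3 = 1 \<or> d mod 3 = 2" by presburger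
  moreover have "(2 * d) mod 3 = (2 * (d mod 3)) mod 3" by (simp add: mod_mult_right_eq)
  ultimately show ?thesis by (auto simp: chi3_def)
qed

lemma gcd_int_cases:
  fixes c :: int
  shows "gcd 2 c = (if even c then 2 else 1)" "gcd 3 c = (if 3 dvd c then 3 else 1)"
    "gcd 4 c = (if 4 dvd c then 4 else if even c then 2 else 1)"
    "gcd 9 c = (if 9 dvd c then 9 else if 3 dvd c then 3 else 1)"
proof -
  have red: "gcd k c = gcd k (c mod k)" for k using gcd_red_int[of c k] by (simp add: gcd.commute)
  show "gcd 2 c = (if even c then 2 else 1)"
  proof -
    have "c mod 2 = 0 \<and> even c \<or> c mod 2 = 1 \<and> odd c" by presburger
    thus ?thesis by (subst red) auto
  qed
  show "gcd 3 c = (if 3 dvd c then 3 else 1)"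
  proof -
    have "c mod 3 = 0 \<and> 3 dvd c \<or> c mod 3 = 1 \<and> \<not> 3 dvd c \<or> c mod 3 = 2 \<and> \<not> 3 dvd c" by presburger
    moreover have "gcd 3 (0 :: int) = 3" "gcd 3 (1 :: int) = 1" "gcd 3 (2 :: int) = 1" by code_simp+
    ultimately show ?thesis by (elim disjE conjE) (subst red, simp only: if_True if_False)+
  qed
  show "gcd 4 c = (if 4 dvd c then 4 else if even c then 2 else 1)"
  proof -
    have "c mod 4 = 0 \<and> 4 dvd c \<or> c mod 4 = 1 \<and> \<not> 4 dvd c \<and> odd c \<or> c mod 4 = 2 \<and> \<not> 4 dvd c \<and> even c \<or>
      c mod 4 = 3 \<and> \<not> 4 dvd c \<and> odd c"
      by presburger
    moreover have "gcd 4 (0 :: int) = 4" "gcd 4 (1 :: int) = 1" "gcd 4 (2 :: int) = 2" "gcd 4 (3 :: int) = 1"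
      by code_simp+
    ultimately show ?thesis by (elim disjE conjE) (subst red, simp only: if_True if_False)+
  qed
  show "gcd 9 c = (if 9 dvd c then 9 else if 3 dvd c then 3 else 1)"
  proof -
    have "c mod 9 = 0 \<and> 9 dvd c \<or> c mod 9 = 1 \<and> \<not> 9 dvd c \<and> \<not> 3 dvd c \<or> c mod 9 = 2 \<and> \<not> 9 dvd c \<and> \<not> 3 dvd c \<or>
      c mod 9 = 3 \<and> \<not> 9 dvd c \<and> 3 dvd c \<or> c mod 9 = 4 \<and> \<not> 9 dvd c \<and> \<not> 3 dvd c \<or> c mod 9 = 5 \<and> \<not> 9 dvd c \<and> \<not> 3 dvd c \<or>
      c mod 9 = 6 \<and> \<not> 9 dvd c \<and> 3 dvd c \<or> c mod 9 = 7 \<and> \<not> 9 dvd c \<and> \<not> 3 dvd c \<or> c mod 9 = 8 \<and> \<not> 9 dvd c \<and> \<not> 3 dvd c"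
      by presburger
    moreover have "gcd 9 (0 :: int) = 9" "gcd 9 (1 :: int) = 1" "gcd 9 (2 :: int) = 1" "gcd 9 (3 :: int) = 3" "gcd 9 (4 :: int) = 1" "gcd 9 (5 :: int) = 1" "gcd 9 (6 :: int) = 3" "gcd 9 (7 :: int) = 1" "gcd 9 (8 :: int) = 1"
      by code_simp+
    ultimately show ?thesis by (elim disjE conjE) (subst red, simp only: if_True if_False)+
  qed
qed

text \<open>The signs come from 2 being -1 modulo 3, and the factor 1/2 from gcd(2, c) / 2 for odd
  c. The four cases are the four cusps of level 6.\<close>

lemma cusp_F3_qpow_2:
  "cusp_value_qpow 1 2 cusp_F3 a c = (if even c then if 3 dvd c then cusp_F3 a c else - cusp_F3 a c
     else if 3 dvd c then - cusp_F3 a c / 2 else cusp_F3 a c / 2)"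
proof (cases "even c")
  case True
  then obtain c' where c': "c = 2 * c'" by (elim evenE)
  have "3 dvd c \<longleftrightarrow> 3 dvd c'" using c' by presburger
  thus ?thesis using True by (simp add: cusp_value_qpow_def gcd_int_cases cusp_F3_def c' chi3_double)
next
  case False
  thus ?thesis by (simp add: cusp_value_qpow_def gcd_int_cases cusp_F3_def chi3_double)
qed

lemma cusp_F3_qpow_3:
  "\<not> 3 dvd c \<Longrightarrow> cusp_value_qpow 1 3 cusp_F3 a c = cusp_F3 a c / 3"
  "9 dvd c \<Longrightarrow> cusp_value_qpow 1 3 cusp_F3 a c = cusp_F3 a c"
proof -
  show "cusp_value_qpow 1 3 cusp_F3 a c = cusp_F3 a c / 3" if "\<not> 3 dvd c"
    using that by (simp add: cusp_value_qpow_def gcd_int_cases cusp_F3_def)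
  show "cusp_value_qpow 1 3 cusp_F3 a c = cusp_F3 a c" if "9 dvd c"
  proof -
    have "3 dvd c" "3 dvd c div 3" using that by presburger+
    thus ?thesis by (simp add: cusp_value_qpow_def gcd_int_cases cusp_F3_def)
  qed
qed

lemma cusp_F4_qpow_2: "odd c \<Longrightarrow> cusp_value_qpow 1 2 cusp_F4 a c = cusp_F4 a c / 2"
proof -
  assume "odd c"
  moreover from this have "\<not> 4 dvd c" by presburger
  ultimately show ?thesis by (simp add: cusp_value_qpow_def gcd_int_cases cusp_F4_def)
qed

definition cusp_C2 :: "int \<Rightarrow> int \<Rightarrow> complex" where
  "cusp_C2 a c = (if even c then 1 else - 1 / 2)"

definition cusp_C4 :: "int \<Rightarrow> int \<Rightarrow> complex" where
  "cusp_C4 a c = (if 4 dvd c then 1 else if even c then 0 else - 1 / 4)"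

lemma mform_C2: "mform 2 2 (\<lambda>_. 1) cusp_C2 (C_form 2)"
proof (rule mform_cong[OF mform_C_form[of 2]])
  show "1 / of_nat (gcd (2 - 1) 24) * (of_int (gcd (int 2) c) ^ 2 / of_nat 2 - 1) = cusp_C2 a c" for a c
    by (simp add: gcd_int_cases cusp_C2_def)
qed auto

lemma mform_C4: "mform 2 4 (\<lambda>_. 1) cusp_C4 (C_form 4)"
proof (rule mform_cong[OF mform_C_form[of 4]])
  have "gcd (4 - 1) 24 = (3 :: nat)" by code_simp
  thus "1 / of_nat (gcd (4 - 1) 24) * (of_int (gcd (int 4) c) ^ 2 / of_nat 4 - 1) = cusp_C4 a c" for a c
    by (auto simp add: gcd_int_cases cusp_C4_def elim: dvd_trans[rotated])
qed auto

section \<open>Forms whose level is lower than their definition shows\<close>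

lemma mform_alpha8: "mform 1 8 chi4 (\<lambda>a c. 1 / 4 * (cusp_F4 a c - cusp_value_qpow 1 2 cusp_F4 a c)) alpha8"
  unfolding alpha8_def
  by (intro mform_scale mform_diff mform_level[OF mform_F4] mform_qpow[OF mform_F4]) auto

definition cusp_alpha4 :: "int \<Rightarrow> int \<Rightarrow> complex" where
  "cusp_alpha4 a c = (if 4 dvd c then 0 else if even c then 1 / 16 else - 1 / 64)"

lemma mform_alpha4: "mform 2 4 (\<lambda>_. 1) cusp_alpha4 alpha4"
proof -
  \<comment> \<open>By its definition \<open>alpha4\<close> has level 8, whereas this candidate
    visibly has level 4; 24 is the coefficient of q in \<open>C_form 2\<close>. At level 8, of index
    12, three coefficients suffice since 3 > 2 * 12 / 10.\<close>
  define G where "G = fps_const (1 / 24) * (C_form 2 - qpow (C_form 2) 2)"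
  have "mform 2 4 (\<lambda>_. 1) (\<lambda>a c. 1 / 24 * (cusp_C2 a c - cusp_value_qpow 2 2 cusp_C2 a c)) G"
    unfolding G_def
    by (intro mform_scale mform_diff mform_level[OF mform_C2] mform_qpow[OF mform_C2]) auto
  hence G: "mform 2 4 (\<lambda>_. 1) cusp_alpha4 G"
  proof (rule mform_cong)
    show "1 / 24 * (cusp_C2 a c - cusp_value_qpow 2 2 cusp_C2 a c) = cusp_alpha4 a c" for a c
    proof (cases "even c")
      case True
      then obtain c' where c': "c = 2 * c'" by (elim evenE)
      have "4 dvd c \<longleftrightarrow> even c'" using c' by presburger
      thus ?thesis using c' by (simp add: cusp_value_qpow_def gcd_int_cases cusp_C2_def cusp_alpha4_def)
    next
      case False
      hence "\<not> 4 dvd c" by presburger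
      thus ?thesis using False by (simp add: cusp_value_qpow_def gcd_int_cases cusp_C2_def cusp_alpha4_def power2_eq_square)
    qed
  qed auto
  have "mform 1 8 chi4 (cusp_value_qpow 1 2 cusp_F4) (qpow F4 2)"
    by (rule mform_qpow[OF mform_F4]) auto
  from mform_mult[OF this mform_alpha8, of 2]
  have "mform 2 8 (\<lambda>d. chi4 d * chi4 d) (\<lambda>a c. cusp_value_qpow 1 2 cusp_F4 a c * (1 / 4 * (cusp_F4 a c - cusp_value_qpow 1 2 cusp_F4 a c))) alpha4"
    by (simp add: alpha4_def)
  hence "mform 2 8 (\<lambda>_. 1) (\<lambda>a c. cusp_value_qpow 1 2 cusp_F4 a c * (1 / 4 * (cusp_F4 a c - cusp_value_qpow 1 2 cusp_F4 a c))) alpha4"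
  proof (rule mform_cong)
    show "chi4 d * chi4 d = 1" if "coprime d (int 8)" for d
      using coprime_not_dvd[OF that, of 2] by (intro chi4_square) auto
  qed auto
  moreover have "mform 2 8 (\<lambda>_. 1) cusp_alpha4 G" by (rule mform_level[OF G]) auto
  moreover note has_coeffs_alpha4
  moreover have "has_coeffs G [0, 1, 0, 4, 0, 6, 0, 8]"
    unfolding G_def by (rule has_coeffs_cong, (rule has_coeffs_C_form_2 has_coeffs_intros | code_simp)+)
  ultimately have "alpha4 = G"
  proof (rule mform_eqI[where m = 3])
    show "10 * (\<Sum>(c, d)\<in>bottom_rows 8. if c = 0 then int 3 else 0) > int (2 * card (bottom_rows 8))"
      unfolding bottom_rows_code sum.set_conv_list card_set by code_simp
  qed auto
  thus ?thesis using G by simp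
qed

definition cusp_alpha2 :: "int \<Rightarrow> int \<Rightarrow> complex" where
  "cusp_alpha2 a c = (if even c then 0 else 1 / 256)"

lemma mform_alpha2: "mform 4 2 (\<lambda>_. 1) cusp_alpha2 alpha2"
proof -
  \<comment> \<open>A candidate of level 2, where 240 is the coefficient of q in E_4. The comparison
    takes place at level 4, to which both forms belong.\<close>
  define G where "G = fps_const (1 / 240) * (Eisen 4 - qpow (Eisen 4) 2)"
  have "mform 4 2 (\<lambda>_. 1) (\<lambda>a c. 1 / 240 * (1 - cusp_value_qpow 4 2 (\<lambda>_ _. 1) a c)) G"
    unfolding G_def
    by (intro mform_scale mform_diff mform_level[OF mform_Eisen_4] mform_qpow[OF mform_Eisen_4]) auto
  hence G: "mform 4 2 (\<lambda>_. 1) cusp_alpha2 G"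
    by (rule mform_cong) (auto simp: cusp_value_qpow_def gcd_int_cases cusp_alpha2_def power_divide)
  have "mform 4 4 (\<lambda>_. 1) (\<lambda>a c. cusp_C4 a c * cusp_alpha4 a c) alpha2"
    using mform_mult[OF mform_C4 mform_alpha4, of 4] by (simp add: alpha2_def)
  moreover have "mform 4 4 (\<lambda>_. 1) cusp_alpha2 G" by (rule mform_level[OF G]) auto
  moreover note has_coeffs_alpha2
  moreover have "has_coeffs G [0, 1, 8, 28, 64, 126, 224, 344]"
    unfolding G_def by (rule has_coeffs_cong, (rule has_coeffs_Eisen_4 has_coeffs_intros | code_simp)+)
  ultimately have "alpha2 = G"
  proof (rule mform_eqI[where m = 3])
    show "10 * (\<Sum>(c, d)\<in>bottom_rows 4. if c = 0 then int 3 else 0) > int (4 * card (bottom_rows 4))"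
      unfolding bottom_rows_code sum.set_conv_list card_set by code_simp
  qed auto
  thus ?thesis using G by simp
qed

section \<open>Cuspidality\<close>

lemma Delta1_cusp_form: "Delta1 \<in> cusp_forms 12 1"
proof (rule mform_cusp_form)
  have "mform 12 1 (\<lambda>d. 1 ^ 3) (\<lambda>a c. 1 ^ 3) (Eisen 4 ^ 3)" "mform 12 1 (\<lambda>d. 1 ^ 2) (\<lambda>a c. 1 ^ 2) (Eisen 6 ^ 2)"
    by (intro mform_power[OF mform_Eisen_4] mform_power[OF mform_Eisen_6]; simp)+
  hence "mform 12 1 (\<lambda>_. 1) (\<lambda>_ _. 1 / 12 ^ 3 * (1 - 1)) Delta1"
    unfolding Delta1_def by (intro mform_scale mform_diff) simp_all
  thus "mform 12 1 (\<lambda>_. 1) (\<lambda>_ _. 1 / 12 ^ 3 * (1 - 1)) Delta1" .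
qed simp

lemma mform_power_trivial: 
  assumes "mform k N (\<lambda>_. 1) v F" "l = n * k"
  shows "mform l N (\<lambda>_. 1) (\<lambda>a c. v a c ^ n) (F ^ n)"
  using mform_power[OF assms] by simp

lemma mform_mult_trivial:
  assumes "mform k N (\<lambda>_. 1) v F" "mform l N (\<lambda>_. 1) v' G" "m = k + l"
  shows "mform m N (\<lambda>_. 1) (\<lambda>a c. v a c * v' a c) (F * G)"
  using mform_mult[OF assms] by simp

lemma mform_scale_numeral:
  assumes "mform k N \<psi> v F"
  shows "mform k N \<psi> (\<lambda>a c. numeral x * v a c) (numeral x * F)"
  using mform_scale[OF assms, of "numeral x"] by (simp add: numeral_fps_const)

text \<open>\<open>alpha2\<close> vanishes at infinity. At the cusp 0 the second factor does, as
  (-1/2)^2 = 64 / 256.\<close>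

lemma Delta2_cusp_form: "Delta2 \<in> cusp_forms 8 2"
proof (rule mform_cusp_form)
  show "mform 8 2 (\<lambda>_. 1) (\<lambda>a c. cusp_alpha2 a c * (cusp_C2 a c ^ 2 - 64 * cusp_alpha2 a c)) Delta2"
    unfolding Delta2_def
    by (rule mform_mult_trivial[OF mform_alpha2 mform_diff[OF mform_power_trivial[OF mform_C2] mform_scale_numeral[OF mform_alpha2]]]) auto
  show "cusp_alpha2 a c * (cusp_C2 a c ^ 2 - 64 * cusp_alpha2 a c) = 0" for a c
    by (simp add: cusp_alpha2_def cusp_C2_def power2_eq_square)
qed

text \<open>\<open>alpha2\<close> vanishes at the cusps with even c. For odd c the second factor
  does, as - 1/4 = 16 (- 1/64).\<close>

lemma Delta4_cusp_form: "Delta4 \<in> cusp_forms 6 4"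
proof (rule mform_cusp_form)
  have "mform 4 4 (\<lambda>_. 1) cusp_alpha2 alpha2" by (rule mform_level[OF mform_alpha2]) auto
  thus "mform 6 4 (\<lambda>_. 1) (\<lambda>a c. cusp_alpha2 a c * (cusp_C4 a c - 16 * cusp_alpha4 a c)) Delta4"
    unfolding Delta4_def
    by (rule mform_mult_trivial[OF _ mform_diff[OF mform_C4 mform_scale_numeral[OF mform_alpha4]]]) auto
  show "cusp_alpha2 a c * (cusp_C4 a c - 16 * cusp_alpha4 a c) = 0" for a c
  proof (cases "even c")
    case False
    hence "\<not> 4 dvd c" by presburger
    thus ?thesis using False by (simp add: cusp_alpha4_def cusp_C4_def)
  qed (simp add: cusp_alpha2_def)
qed

text \<open>The three factors divide the cusps among themselves: \<open>alpha4\<close> vanishes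
  where 4 divides c, \<open>F4\<close> where c is 2 modulo 4, and the last factor for odd c, where
  \<open>F4\<close> at q^2 takes half the value of \<open>F4\<close>.\<close>

lemma Delta8_cusp_form: "Delta8 \<in> cusp_forms 4 8"
proof (rule mform_cusp_form)
  let ?w = "\<lambda>a c. cusp_F4 a c - 8 * (1 / 4 * (cusp_F4 a c - cusp_value_qpow 1 2 cusp_F4 a c))"
  have \<alpha>: "mform 2 8 (\<lambda>_. 1) cusp_alpha4 alpha4" by (rule mform_level[OF mform_alpha4]) auto
  have F: "mform 1 8 chi4 cusp_F4 F4" by (rule mform_level[OF mform_F4]) auto
  have "mform 1 8 chi4 ?w (F4 - 8 * alpha8)"
    by (intro mform_diff F mform_scale_numeral mform_alpha8)
  hence "mform 4 8 (\<lambda>d. (1 * chi4 d) * chi4 d) (\<lambda>a c. (cusp_alpha4 a c * cusp_F4 a c) * ?w a c) Delta8"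
    unfolding Delta8_def by (intro mform_mult[of 3 _ _ _ _ 1] mform_mult[OF \<alpha> F]) auto
  thus "mform 4 8 (\<lambda>_. 1) (\<lambda>a c. (cusp_alpha4 a c * cusp_F4 a c) * ?w a c) Delta8"
  proof (rule mform_cong)
    show "1 * chi4 d * chi4 d = 1" if "coprime d (int 8)" for d
      using coprime_not_dvd[OF that, of 2] chi4_square[of d] by simp
  qed auto
  show "(cusp_alpha4 a c * cusp_F4 a c) * ?w a c = 0" for a c
  proof (cases "even c")
    case False
    show ?thesis unfolding cusp_F4_qpow_2[OF False] by simp
  next
    case True
    hence "4 dvd c \<or> \<not> 4 dvd c \<and> c mod 4 = 2" by presburger
    thus ?thesis
    proof
      assume "\<not> 4 dvd c \<and> c mod 4 = 2"
      hence "cusp_F4 a c = 0" by (simp add: cusp_F4_def chi4_def)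
      thus ?thesis by simp
    qed (simp add: cusp_alpha4_def)
  qed
qed

lemma mform_alpha9: "mform 1 9 chi3 (\<lambda>a c. 1 / 6 * (cusp_F3 a c - cusp_value_qpow 1 3 cusp_F3 a c)) alpha9"
  unfolding alpha9_def
  by (intro mform_scale mform_diff mform_level[OF mform_F3] mform_qpow[OF mform_F3]) auto

lemma mform_alpha3: "mform 3 9 chi3 (\<lambda>a c. 1 / of_nat (gcd (9 - 1) 24) * (of_int (gcd (int 9) c) ^ 2 / of_nat 9 - 1) * 
    (1 / 6 * (cusp_F3 a c - cusp_value_qpow 1 3 cusp_F3 a c))) alpha3"
  using mform_mult[OF mform_C_form[of 9] mform_alpha9, of 3] by (simp add: alpha3_def)

lemma chi3_square_coprime:
  assumes "coprime d n" "3 dvd (n :: int)"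
  shows "chi3 d * chi3 d = 1"
  using coprime_not_dvd[OF assms] by (intro chi3_square) auto

text \<open>If 3 does not divide c, the last factor vanishes because \<open>F3\<close> at q^3 takes
  a third of the value of \<open>F3\<close>. If 9 divides c, \<open>alpha9\<close> vanishes; in the
  remaining case gcd(9, c) = 3 and \<open>C_form 9\<close> does.\<close>

lemma Delta9_cusp_form: "Delta9 \<in> cusp_forms 4 9"
proof (rule mform_cusp_form)
  let ?v = "\<lambda>a c. 1 / of_nat (gcd (9 - 1) 24) * (of_int (gcd (int 9) c) ^ 2 / of_nat 9 - 1) * 
    (1 / 6 * (cusp_F3 a c - cusp_value_qpow 1 3 cusp_F3 a c))"
  let ?w = "\<lambda>a c. cusp_F3 a c - 9 * (1 / 6 * (cusp_F3 a c - cusp_value_qpow 1 3 cusp_F3 a c))"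
  have F: "mform 1 9 chi3 cusp_F3 F3" by (rule mform_level[OF mform_F3]) auto
  have "mform 1 9 chi3 ?w (F3 - 9 * alpha9)"
    by (intro mform_diff F mform_scale_numeral mform_alpha9)
  hence "mform 4 9 (\<lambda>d. chi3 d * chi3 d) (\<lambda>a c. ?v a c * ?w a c) Delta9"
    unfolding Delta9_def by (intro mform_mult[OF mform_alpha3]) auto
  thus "mform 4 9 (\<lambda>_. 1) (\<lambda>a c. ?v a c * ?w a c) Delta9"
    by (rule mform_cong) (auto intro: chi3_square_coprime)
  show "?v a c * ?w a c = 0" for a c
  proof (cases "3 dvd c")
    case False
    show ?thesis unfolding cusp_F3_qpow_3(1)[OF False] by simp
  next
    case True
    show ?thesis
    proof (cases "9 dvd c")
      case 9: True
      show ?thesis unfolding cusp_F3_qpow_3(2)[OF 9] by simp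
    next
      case False
      thus ?thesis using True by (simp add: gcd_int_cases power2_eq_square)
    qed
  qed
qed

lemma Delta3_cusp_form: "Delta3 \<in> cusp_forms 6 3"
proof -
  \<comment> \<open>The coefficients 7, -9, 2 are determined up to scaling by vanishing at the two
    cusps: at infinity all three forms have value 1, and at 0, where F_3^2 takes the value -1/3,
    they have the values -1/3, -1/27 and 1. The scaling 432 = 7 * 252 - 9 * 36 - 2 * 504 makes the
    coefficient of q equal to 1.\<close>
  define G where "G = fps_const (1 / 432) * (7 * (F3 ^ 2 * Eisen 4) - 9 * F3 ^ 6 + 2 * Eisen 6)"
  let ?v = "\<lambda>a c. 1 / 432 * (7 * (cusp_F3 a c ^ 2 * 1) - 9 * cusp_F3 a c ^ 6 + 2 * 1)"
  have chi: "chi3 d ^ 2 = 1" "chi3 d ^ 6 = 1" if "coprime d (int N)" "3 dvd N" for d N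
  proof -
    show *: "chi3 d ^ 2 = 1"
      using chi3_square_coprime[OF that(1)] that(2) int_dvd_int_iff[of 3 N] by (simp add: power2_eq_square)
    have "chi3 d ^ 6 = (chi3 d ^ 2) ^ 3" by (simp flip: power_mult)
    thus "chi3 d ^ 6 = 1" using * by simp
  qed
  have F2: "mform 2 3 (\<lambda>_. 1) (\<lambda>a c. cusp_F3 a c ^ 2) (F3 ^ 2)"
    by (rule mform_cong[OF mform_power[OF mform_F3, of 2 2]]) (use chi[of _ 3] in auto)
  have F6: "mform 6 3 (\<lambda>_. 1) (\<lambda>a c. cusp_F3 a c ^ 6) (F3 ^ 6)"
    by (rule mform_cong[OF mform_power[OF mform_F3, of 6 6]]) (use chi[of _ 3] in auto)
  have E: "mform 4 3 (\<lambda>_. 1) (\<lambda>_ _. 1) (Eisen 4)" "mform 6 3 (\<lambda>_. 1) (\<lambda>_ _. 1) (Eisen 6)"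
    by (rule mform_level[OF mform_Eisen_4] mform_level[OF mform_Eisen_6]; simp)+
  have G: "mform 6 3 (\<lambda>_. 1) ?v G"
    unfolding G_def by (intro mform_scale mform_add mform_diff mform_scale_numeral mform_mult_trivial[OF F2 E(1)] F6 E(2)) simp
  have F9: "mform 1 9 chi3 cusp_F3 F3" by (rule mform_level[OF mform_F3]) auto
  have "mform 3 9 chi3 (\<lambda>a c. cusp_F3 a c ^ 3) (F3 ^ 3)"
  proof (rule mform_cong[OF mform_power[OF F9, of 3 3]])
    show "chi3 d ^ 3 = chi3 d" for d
      by (auto simp: chi3_def)
  qed auto
  \<comment> \<open>The cusp values of \<open>Delta3\<close> at level 9 are left existential;
    vanishing at the cusps is checked on \<open>G\<close> at level 3.\<close>
  hence "\<exists>w. mform 6 9 (\<lambda>d. chi3 d * chi3 d) w Delta3"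
    unfolding Delta3_def
    by (intro exI) (rule mform_mult[OF mform_alpha3 mform_diff[OF _ mform_scale_numeral[OF mform_alpha3]]], simp_all)
  then obtain w where w: "mform 6 9 (\<lambda>d. chi3 d * chi3 d) w Delta3" by blast
  have "mform 6 9 (\<lambda>_. 1) w Delta3"
    by (rule mform_cong[OF w]) (auto intro: chi3_square_coprime)
  moreover have "mform 6 9 (\<lambda>_. 1) ?v G" by (rule mform_level[OF G]) auto
  moreover note has_coeffs_Delta3
  moreover have "has_coeffs G [0, 1, - 6, 9, 4, 6, - 54, - 40]"
    unfolding G_def by (rule has_coeffs_cong, (rule has_coeffs_Eisen_4 has_coeffs_Eisen_6 has_coeffs_F3 has_coeffs_intros | code_simp)+)
  ultimately have "Delta3 = G"
  proof (rule mform_eqI[where m = 8])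
    \<comment> \<open>Index 12 and weight 6 call for more than 7.2 coefficients. This comparison
      sets the length eight of all coefficient lists.\<close>
    show "10 * (\<Sum>(c, d)\<in>bottom_rows 9. if c = 0 then int 8 else 0) > int (6 * card (bottom_rows 9))"
      unfolding bottom_rows_code sum.set_conv_list card_set by code_simp
  qed auto
  moreover have "G \<in> cusp_forms 6 3"
  proof (rule mform_cusp_form[OF G])
    show "?v a c = 0" if "coprime a c" for a c
    proof (cases "3 dvd c")
      case True
      hence "coprime a 3" using that by (meson coprime_divisors dvd_refl)
      thus ?thesis using True chi[of a 3] by (simp add: cusp_F3_def)
    next
      case False
      have chi_c: "chi3 c ^ 2 = 1" using chi3_square[OF False] by (simp add: power2_eq_square)
      have sq: "cusp_F3 a c ^ 2 = - 1 / 3"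
      proof -
        have "complex_of_real (sqrt 3) ^ 2 = 3" by (simp flip: of_real_power)
        thus ?thesis using False chi_c by (simp add: cusp_F3_def power_mult_distrib power_divide)
      qed
      have "cusp_F3 a c ^ 6 = (cusp_F3 a c ^ 2) ^ 3" by (simp flip: power_mult)
      thus ?thesis unfolding sq by (simp add: power3_eq_cube)
    qed
  qed
  ultimately show ?thesis by simp
qed

text \<open>One factor for each of the four cusps. By \<open>cusp_F3_qpow_2\<close> the value of
  \<open>alpha6\<close> is 0, 1/3, 1/4 or 1/12 of the value of \<open>F3\<close>, which accounts for
  the constants 3, 4 and 12.\<close>

lemma Delta6_cusp_form: "Delta6 \<in> cusp_forms 4 6"
proof (rule mform_cusp_form)
  let ?u = "\<lambda>a c. 1 / 6 * (cusp_F3 a c - cusp_value_qpow 1 2 cusp_F3 a c)"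
  let ?v = "\<lambda>a c. ?u a c * (cusp_F3 a c - 3 * ?u a c) * (cusp_F3 a c - 4 * ?u a c) * (cusp_F3 a c - 12 * ?u a c)"
  have F: "mform 1 6 chi3 cusp_F3 F3" by (rule mform_level[OF mform_F3]) auto
  have \<alpha>: "mform 1 6 chi3 ?u alpha6"
    unfolding alpha6_def by (intro mform_scale mform_diff F mform_qpow[OF mform_F3]) auto
  have "mform 4 6 (\<lambda>d. chi3 d * chi3 d * chi3 d * chi3 d) ?v Delta6"
    unfolding Delta6_def
    by (rule mform_mult[of 3 _ _ _ _ 1], rule mform_mult[of 2 _ _ _ _ 1], rule mform_mult[of 1 _ _ _ _ 1])
       (intro \<alpha> mform_diff F mform_scale_numeral | simp)+
  thus "mform 4 6 (\<lambda>_. 1) ?v Delta6"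
  proof (rule mform_cong)
    show "chi3 d * chi3 d * chi3 d * chi3 d = 1" if "coprime d (int 6)" for d
      using chi3_square_coprime[OF that] by (simp add: mult.assoc)
  qed auto
  show "?v a c = 0" for a c
    unfolding cusp_F3_qpow_2 by (auto simp: field_simps)
qed

section \<open>Spaces of dimension zero and one\<close>

lemma cusp_forms_small:
  "cusp_forms 8 1 \<subseteq> {0}" "cusp_forms 6 1 \<subseteq> {0}" "cusp_forms 6 2 \<subseteq> {0}" "cusp_forms 4 1 \<subseteq> {0}"
  "cusp_forms 4 2 \<subseteq> {0}" "cusp_forms 4 3 \<subseteq> {0}" "cusp_forms 4 4 \<subseteq> {0}"
  \<comment> \<open>The closest case is weight 6 at level 2: there are two cusps, and weight times
    index over 10 is 1.8.\<close>
  by (rule cusp_forms_trivial, simp,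
      unfold bottom_rows_code sum.set_conv_list card_set, code_simp)+

lemma proper_divisor_cases:
  fixes M :: nat
  shows "M dvd 1 \<Longrightarrow> M \<noteq> 1 \<Longrightarrow> False"
    and "M dvd 2 \<Longrightarrow> M \<noteq> 2 \<Longrightarrow> M = 1"
    and "M dvd 3 \<Longrightarrow> M \<noteq> 3 \<Longrightarrow> M = 1"
    and "M dvd 4 \<Longrightarrow> M \<noteq> 4 \<Longrightarrow> M = 1 \<or> M = 2"
    and "M dvd 6 \<Longrightarrow> M \<noteq> 6 \<Longrightarrow> M = 1 \<or> M = 2 \<or> M = 3"
    and "M dvd 8 \<Longrightarrow> M \<noteq> 8 \<Longrightarrow> M = 1 \<or> M = 2 \<or> M = 4"
    and "M dvd 9 \<Longrightarrow> M \<noteq> 9 \<Longrightarrow> M = 1 \<or> M = 3"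
proof -
  have le: "M \<le> n" if "M dvd n" "n > 0" for n using that by (rule dvd_imp_le)
  have small: "M = 0 \<or> M = 1 \<or> M = 2 \<or> M = 3 \<or> M = 4 \<or> M = 5 \<or> M = 6 \<or> M = 7 \<or> M = 8 \<or> M = 9" if "M \<le> 9"
    using that by presburger
  show "M dvd 1 \<Longrightarrow> M \<noteq> 1 \<Longrightarrow> False" by simp
  show "M dvd 2 \<Longrightarrow> M \<noteq> 2 \<Longrightarrow> M = 1" using le[of 2] small by auto
  show "M dvd 3 \<Longrightarrow> M \<noteq> 3 \<Longrightarrow> M = 1" using le[of 3] small by auto
  show "M dvd 4 \<Longrightarrow> M \<noteq> 4 \<Longrightarrow> M = 1 \<or> M = 2" using le[of 4] small by auto
  show "M dvd 6 \<Longrightarrow> M \<noteq> 6 \<Longrightarrow> M = 1 \<or> M = 2 \<or> M = 3" using le[of 6] small by auto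
  show "M dvd 8 \<Longrightarrow> M \<noteq> 8 \<Longrightarrow> M = 1 \<or> M = 2 \<or> M = 4" using le[of 8] small by auto
  show "M dvd 9 \<Longrightarrow> M \<noteq> 9 \<Longrightarrow> M = 1 \<or> M = 3" using le[of 9] small by auto
qed

lemma primitive_forms_12_1: "primitive_forms 12 1 = {Delta1}"
proof (rule primitive_forms_singleton[OF _ Delta1_cusp_form])
  show "10 * (\<Sum>(c, d)\<in>bottom_rows 1. gcd (c ^ 2) (int 1) + (if c = 0 then int 1 else 0)) > int (12 * 1 * card (bottom_rows 1))"
    unfolding bottom_rows_code sum.set_conv_list card_set by code_simp
  show "cusp_forms 12 M \<subseteq> {0}" if "M dvd 1" "M \<noteq> 1" for M
    using proper_divisor_cases(1)[OF that] cusp_forms_small by auto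
qed (use has_coeffs_nth[OF has_coeffs_Delta1, of 1] in simp_all)

lemma primitive_forms_8_2: "primitive_forms 8 2 = {Delta2}"
proof (rule primitive_forms_singleton[OF _ Delta2_cusp_form])
  show "10 * (\<Sum>(c, d)\<in>bottom_rows 2. gcd (c ^ 2) (int 2) + (if c = 0 then int 2 else 0)) > int (8 * 2 * card (bottom_rows 2))"
    unfolding bottom_rows_code sum.set_conv_list card_set by code_simp
  show "cusp_forms 8 M \<subseteq> {0}" if "M dvd 2" "M \<noteq> 2" for M
    using proper_divisor_cases(2)[OF that] cusp_forms_small by auto
qed (use has_coeffs_nth[OF has_coeffs_Delta2, of 1] in simp_all)

lemma primitive_forms_6_3: "primitive_forms 6 3 = {Delta3}"
proof (rule primitive_forms_singleton[OF _ Delta3_cusp_form])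
  show "10 * (\<Sum>(c, d)\<in>bottom_rows 3. gcd (c ^ 2) (int 3) + (if c = 0 then int 3 else 0)) > int (6 * 3 * card (bottom_rows 3))"
    unfolding bottom_rows_code sum.set_conv_list card_set by code_simp
  show "cusp_forms 6 M \<subseteq> {0}" if "M dvd 3" "M \<noteq> 3" for M
    using proper_divisor_cases(3)[OF that] cusp_forms_small by auto
qed (use has_coeffs_nth[OF has_coeffs_Delta3, of 1] in simp_all)

lemma primitive_forms_6_4: "primitive_forms 6 4 = {Delta4}"
proof (rule primitive_forms_singleton[OF _ Delta4_cusp_form])
  show "10 * (\<Sum>(c, d)\<in>bottom_rows 4. gcd (c ^ 2) (int 4) + (if c = 0 then int 4 else 0)) > int (6 * 4 * card (bottom_rows 4))"
    unfolding bottom_rows_code sum.set_conv_list card_set by code_simp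
  show "cusp_forms 6 M \<subseteq> {0}" if "M dvd 4" "M \<noteq> 4" for M
    using proper_divisor_cases(4)[OF that] cusp_forms_small by auto
qed (use has_coeffs_nth[OF has_coeffs_Delta4, of 1] in simp_all)

lemma primitive_forms_4_6: "primitive_forms 4 6 = {Delta6}"
proof (rule primitive_forms_singleton[OF _ Delta6_cusp_form])
  show "10 * (\<Sum>(c, d)\<in>bottom_rows 6. gcd (c ^ 2) (int 6) + (if c = 0 then int 6 else 0)) > int (4 * 6 * card (bottom_rows 6))"
    unfolding bottom_rows_code sum.set_conv_list card_set by code_simp
  show "cusp_forms 4 M \<subseteq> {0}" if "M dvd 6" "M \<noteq> 6" for M
    using proper_divisor_cases(5)[OF that] cusp_forms_small by auto
qed (use has_coeffs_nth[OF has_coeffs_Delta6, of 1] in simp_all)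

lemma primitive_forms_4_8: "primitive_forms 4 8 = {Delta8}"
proof (rule primitive_forms_singleton[OF _ Delta8_cusp_form])
  show "10 * (\<Sum>(c, d)\<in>bottom_rows 8. gcd (c ^ 2) (int 8) + (if c = 0 then int 8 else 0)) > int (4 * 8 * card (bottom_rows 8))"
    unfolding bottom_rows_code sum.set_conv_list card_set by code_simp
  show "cusp_forms 4 M \<subseteq> {0}" if "M dvd 8" "M \<noteq> 8" for M
    using proper_divisor_cases(6)[OF that] cusp_forms_small by auto
qed (use has_coeffs_nth[OF has_coeffs_Delta8, of 1] in simp_all)

lemma primitive_forms_4_9: "primitive_forms 4 9 = {Delta9}"
proof (rule primitive_forms_singleton[OF _ Delta9_cusp_form])
  show "10 * (\<Sum>(c, d)\<in>bottom_rows 9. gcd (c ^ 2) (int 9) + (if c = 0 then int 9 else 0)) > int (4 * 9 * card (bottom_rows 9))"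
    unfolding bottom_rows_code sum.set_conv_list card_set by code_simp
  show "cusp_forms 4 M \<subseteq> {0}" if "M dvd 9" "M \<noteq> 9" for M
    using proper_divisor_cases(7)[OF that] cusp_forms_small by auto
qed (use has_coeffs_nth[OF has_coeffs_Delta9, of 1] in simp_all)

section \<open>Sign conditions and conclusion\<close>

lemma simple_part_squarefree:
  assumes "\<And>p. prime p \<and> p dvd N \<and> \<not> p\<^sup>2 dvd N \<longleftrightarrow> p \<in> A"
  shows "simple_part N = \<Prod>A"
proof -
  have "{p. prime p \<and> p dvd N \<and> \<not> p\<^sup>2 dvd N} = A" using assms by blast
  thus ?thesis by (simp add: simple_part_def)
qed

lemma prime_dvd_2: "prime p \<and> p dvd 2 \<longleftrightarrow> p = (2 :: nat)"
  using primes_dvd_imp_eq[of p 2] by auto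

lemma prime_dvd_3: "prime p \<and> p dvd 3 \<longleftrightarrow> p = (3 :: nat)"
  using primes_dvd_imp_eq[of p 3] by auto

lemma prime_dvd_6: "prime p \<and> p dvd 6 \<longleftrightarrow> p = 2 \<or> p = (3 :: nat)"
proof
  assume *: "prime p \<and> p dvd 6"
  hence "p dvd 2 * 3" by simp
  with * have "p dvd 2 \<or> p dvd 3" using prime_dvd_mult_iff by blast
  thus "p = 2 \<or> p = 3" using * prime_dvd_2 prime_dvd_3 by blast
qed auto

lemma simple_part_2: "simple_part 2 = 2"
proof -
  have "simple_part 2 = \<Prod>{2}"
    by (rule simple_part_squarefree) (use prime_dvd_2 in auto)
  thus ?thesis by simp
qed

lemma simple_part_3: "simple_part 3 = 3"
proof -
  have "simple_part 3 = \<Prod>{3}"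
    by (rule simple_part_squarefree) (use prime_dvd_3 in auto)
  thus ?thesis by simp
qed

lemma simple_part_6: "simple_part 6 = 6"
proof -
  have "simple_part 6 = \<Prod>{2, 3}"
    by (rule simple_part_squarefree) (use prime_dvd_6 in auto)
  thus ?thesis by simp
qed

theorem theorem2:
  shows "primitive_forms 12 1 = {Delta1} \<and>
         primitive_forms_sign 8 2 2 = {Delta2} \<and>
         primitive_forms_sign 6 3 1 = {Delta3} \<and>
         primitive_forms 6 4 = {Delta4} \<and>
         primitive_forms_sign 4 6 6 = {Delta6} \<and>
         primitive_forms 4 8 = {Delta8} \<and>
         primitive_forms_9_untwisted 4 = {Delta9}"
proof (intro conjI)
  have not_unit: "\<not> (prime p \<and> p dvd (1 :: nat))" for p by auto
  \<comment> \<open>Only one primitive form is available, so its signs just have to be read off.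
    With exponents k/2 - 1 = 3, 2 and 1 at the levels 2, 3 and 6, the coefficients are - 2^3, 3^2,
    and - 2 and - 3.\<close>
  have "fps_nth Delta2 2 = - 8" using has_coeffs_nth[OF has_coeffs_Delta2, of 2] by simp
  thus "primitive_forms_sign 8 2 2 = {Delta2}"
    unfolding primitive_forms_sign_def primitive_forms_8_2 simple_part_2 prime_dvd_2
    using not_unit by auto
  have "fps_nth Delta3 3 = 9" using has_coeffs_nth[OF has_coeffs_Delta3, of 3] by simp
  thus "primitive_forms_sign 6 3 1 = {Delta3}"
    unfolding primitive_forms_sign_def primitive_forms_6_3 simple_part_3 div_by_1 prime_dvd_3
    using not_unit by auto
  have "fps_nth Delta6 2 = - 2" "fps_nth Delta6 3 = - 3"
    using has_coeffs_nth[OF has_coeffs_Delta6, of 2] has_coeffs_nth[OF has_coeffs_Delta6, of 3] by simp_all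
  thus "primitive_forms_sign 4 6 6 = {Delta6}"
    unfolding primitive_forms_sign_def primitive_forms_4_6 simple_part_6 prime_dvd_6
    using not_unit by auto
  \<comment> \<open>A primitive form has a coefficient 1 and is nonzero. As there are no nonzero
    cusp forms of weight 4 at the levels 1 and 3, there is nothing to twist, and all primitive forms
    of level 9 remain.\<close>
  have "primitive_forms 4 N = {}" if "cusp_forms 4 N \<subseteq> {0}" for N
    using that by (auto simp: primitive_forms_def newforms_def)
  hence "primitive_forms_9_twisted 4 = {}"
    using cusp_forms_small by (simp add: primitive_forms_9_twisted_def)
  thus "primitive_forms_9_untwisted 4 = {Delta9}"
    by (simp add: primitive_forms_9_untwisted_def primitive_forms_4_9)
qed (fact primitive_forms_12_1 primitive_forms_6_4 primitive_forms_4_8)+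

end
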